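(* (Provable in $\mathsf{S}$.) Let $\rho$ be a signature that is hereditarily finite, and let $n$ be a finite ordinal; let $\hat\rho$ and $\hat n$ be their canonical names. Then $\mathsf{C}$ proves the sentence: "for every $\hat\rho$-structure $\mathfrak S$ there exists a $\Phi^{\hat\rho}_{\hat n}$-satisfaction relation for $\mathfrak S$."
   Context: $\mathsf{S}$ is $\mathsf{ZF}$ with the Axiom of Infinity omitted; $\mathsf{C}$ is $\mathsf{GB}$ (Gödel–Bernays class theory, class comprehension only for formulas without bound class variables) with the Axiom of Infinity omitted. $\mathrm{HF}$ is the class of hereditarily finite sets. For each $x\in\mathrm{HF}$, its canonical name $\hat x$ is a fixed closed term built from a constant for $0$ and the binary operation $x{}^\curvearrowleft y=x\cup\{y\}$, chosen by a fixed recursive procedure, whose value is $x$. Expressions of a language with signature in $\mathrm{HF}$ are coded as elements of $\mathrm{HF}$, with expression-building operations rank-increasing. For $\rho\subseteq\mathrm{HF}$ and $n\in\omega$, $\Phi^\rho_n$ is the set of $\rho$-formulas of rank $<n$, i.e. (set of $\rho$-formulas)$\cap V_n$. Structures may be proper classes. For a class $\Phi$ of formulas, a $\Phi$-satisfaction relation for $\mathfrak S$ is the set of pairs $\langle\phi,A\rangle$ ($\phi$ a subformula of a member of $\Phi$, $A$ a finite function into $|\mathfrak S|$ whose domain contains the free variables of $\phi$) at which $\phi$ is true, determined by a function assigning values to all such pairs (and to subterms) obeying the usual Tarskian recursive clauses. *)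

theory Defs
  imports Main
begin

section \<open>First-order logic over membership, \<open>0\<close> and adjunction\<close>

text \<open>
  Both theories are formulated in one one-sorted first-order language with equality, membership,
  a constant \<open>0\<close> and the binary operation \<open>x, y \<mapsto> x \<union> {y}\<close>.
  Variables are named by natural numbers.
\<close>

datatype tm = Var nat | Zero | Adj tm tm

datatype fm = Mem tm tm | Eq tm tm | Fls | Imp fm fm | All nat fm

abbreviation Neg :: "fm \<Rightarrow> fm" where "Neg A \<equiv> Imp A Fls"
abbreviation Or :: "fm \<Rightarrow> fm \<Rightarrow> fm" where "Or A B \<equiv> Imp (Neg A) B"
abbreviation And :: "fm \<Rightarrow> fm \<Rightarrow> fm" where "And A B \<equiv> Neg (Imp A (Neg B))"
abbreviation Iff :: "fm \<Rightarrow> fm \<Rightarrow> fm" where "Iff A B \<equiv> And (Imp A B) (Imp B A)"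
abbreviation Ex :: "nat \<Rightarrow> fm \<Rightarrow> fm" where "Ex x A \<equiv> Neg (All x (Neg A))"

primrec vars :: "tm \<Rightarrow> nat set" where
  "vars (Var x) = {x}"
| "vars Zero = {}"
| "vars (Adj s t) = vars s \<union> vars t"

primrec fv :: "fm \<Rightarrow> nat set" where
  "fv (Mem s t) = vars s \<union> vars t"
| "fv (Eq s t) = vars s \<union> vars t"
| "fv Fls = {}"
| "fv (Imp A B) = fv A \<union> fv B"
| "fv (All x A) = fv A - {x}"

primrec subst_tm :: "nat \<Rightarrow> tm \<Rightarrow> tm \<Rightarrow> tm" where
  "subst_tm x t (Var y) = (if y = x then t else Var y)"
| "subst_tm x t Zero = Zero"
| "subst_tm x t (Adj s u) = Adj (subst_tm x t s) (subst_tm x t u)"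

text \<open>Substitution renames no bound variables; it is meaningful under \<open>free_for\<close>.\<close>

primrec subst :: "nat \<Rightarrow> tm \<Rightarrow> fm \<Rightarrow> fm" where
  "subst x t (Mem s u) = Mem (subst_tm x t s) (subst_tm x t u)"
| "subst x t (Eq s u) = Eq (subst_tm x t s) (subst_tm x t u)"
| "subst x t Fls = Fls"
| "subst x t (Imp A B) = Imp (subst x t A) (subst x t B)"
| "subst x t (All y A) = (if y = x then All y A else All y (subst x t A))"

primrec free_for :: "nat \<Rightarrow> tm \<Rightarrow> fm \<Rightarrow> bool" where
  "free_for x t (Mem s u) = True"
| "free_for x t (Eq s u) = True"
| "free_for x t Fls = True"
| "free_for x t (Imp A B) = (free_for x t A \<and> free_for x t B)"
| "free_for x t (All y A) = (x \<notin> fv (All y A) \<or> y \<notin> vars t \<and> free_for x t A)"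

text \<open>
  A Hilbert calculus. Because of unrestricted generalization, a non-logical axiom with free
  variables has the force of its universal closure.
\<close>

inductive provable :: "fm set \<Rightarrow> fm \<Rightarrow> bool" (infix "\<turnstile>" 50) for T :: "fm set" where
  Ax: "A \<in> T \<Longrightarrow> T \<turnstile> A"
| K: "T \<turnstile> Imp A (Imp B A)"
| S: "T \<turnstile> Imp (Imp A (Imp B C)) (Imp (Imp A B) (Imp A C))"
| DN: "T \<turnstile> Imp (Neg (Neg A)) A"
| Inst: "free_for x t A \<Longrightarrow> T \<turnstile> Imp (All x A) (subst x t A)"
| Dist: "x \<notin> fv A \<Longrightarrow> T \<turnstile> Imp (All x (Imp A B)) (Imp A (All x B))"
| Refl: "T \<turnstile> Eq t t"
| Leib: "free_for x s A \<Longrightarrow> free_for x t A \<Longrightarrow>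
    T \<turnstile> Imp (Eq s t) (Imp (subst x s A) (subst x t A))"
| MP: "T \<turnstile> A \<Longrightarrow> T \<turnstile> Imp A B \<Longrightarrow> T \<turnstile> B"
| Gen: "T \<turnstile> A \<Longrightarrow> T \<turnstile> All x A"


section \<open>Notation for writing formulas\<close>

text \<open>
  A value of type \<open>fb\<close> is a formula that still has to be told at which quantifier depth \<open>d\<close> it
  occurs: a quantifier occurring at depth \<open>d\<close> binds the variable named \<open>d\<close>, and its body occurs
  at depth \<open>d + 1\<close>. Hence if all parameters of a formula are variables with names below \<open>d\<close>,
  no capture can arise at depth \<open>d\<close>, and bold connectives and quantifiers may be read naively.
  A closed \<open>b :: fb\<close> stands for the sentence \<open>b 0\<close>.
\<close>

type_synonym fb = "nat \<Rightarrow> fm"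

definition bmem :: "tm \<Rightarrow> tm \<Rightarrow> fb" (infix "\<^bold>\<in>" 50) where "(s \<^bold>\<in> t) = (\<lambda>d. Mem s t)"
definition beq :: "tm \<Rightarrow> tm \<Rightarrow> fb" (infix "\<^bold>=" 50) where "(s \<^bold>= t) = (\<lambda>d. Eq s t)"
definition bneg :: "fb \<Rightarrow> fb" ("\<^bold>\<not> _" [40] 40) where "(\<^bold>\<not> b) = (\<lambda>d. Neg (b d))"
definition band :: "fb \<Rightarrow> fb \<Rightarrow> fb" (infixr "\<^bold>\<and>" 35) where "(b \<^bold>\<and> c) = (\<lambda>d. And (b d) (c d))"
definition bor :: "fb \<Rightarrow> fb \<Rightarrow> fb" (infixr "\<^bold>\<or>" 30) where "(b \<^bold>\<or> c) = (\<lambda>d. Or (b d) (c d))"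
definition bimp :: "fb \<Rightarrow> fb \<Rightarrow> fb" (infixr "\<^bold>\<longrightarrow>" 25) where "(b \<^bold>\<longrightarrow> c) = (\<lambda>d. Imp (b d) (c d))"
definition biff :: "fb \<Rightarrow> fb \<Rightarrow> fb" (infixr "\<^bold>\<longleftrightarrow>" 25) where "(b \<^bold>\<longleftrightarrow> c) = (\<lambda>d. Iff (b d) (c d))"
definition ball :: "(tm \<Rightarrow> fb) \<Rightarrow> fb" (binder "\<^bold>\<forall>" 10) where "ball f = (\<lambda>d. All d (f (Var d) (Suc d)))"
definition bex :: "(tm \<Rightarrow> fb) \<Rightarrow> fb" (binder "\<^bold>\<exists>" 10) where "bex f = (\<lambda>d. Ex d (f (Var d) (Suc d)))"

text \<open>
  In class theory a set is a class that is a member of some class. Relativization restricts all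
  quantifiers to sets, leaving free variables (which may denote proper classes) alone.
\<close>

definition SetF :: "nat \<Rightarrow> fm" where
  "SetF x = Ex (Suc x) (Mem (Var x) (Var (Suc x)))"

primrec relativize :: "fm \<Rightarrow> fm" where
  "relativize (Mem s t) = Mem s t"
| "relativize (Eq s t) = Eq s t"
| "relativize Fls = Fls"
| "relativize (Imp A B) = Imp (relativize A) (relativize B)"
| "relativize (All x A) = All x (Imp (SetF x) (relativize A))"

definition sets_only :: "fb \<Rightarrow> fb" where "sets_only b = (\<lambda>d. relativize (b d))"


section \<open>Elementary set theory\<close>

definition succ :: "tm \<Rightarrow> tm" where "succ t = Adj t t"

primrec num :: "nat \<Rightarrow> tm" where
  "num 0 = Zero"
| "num (Suc k) = succ (num k)"

text \<open>The Kuratowski pair \<open>{{s}, {s, t}}\<close>, as a term.\<close>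

definition pr :: "tm \<Rightarrow> tm \<Rightarrow> tm" where
  "pr s t = Adj (Adj Zero (Adj Zero s)) (Adj (Adj Zero s) t)"

definition subset_of :: "tm \<Rightarrow> tm \<Rightarrow> fb" (infix "\<^bold>\<subseteq>" 50) where
  "(x \<^bold>\<subseteq> y) = (\<^bold>\<forall>z. z \<^bold>\<in> x \<^bold>\<longrightarrow> z \<^bold>\<in> y)"

definition trans_set :: "tm \<Rightarrow> fb" where
  "trans_set x = (\<^bold>\<forall>y. y \<^bold>\<in> x \<^bold>\<longrightarrow> y \<^bold>\<subseteq> x)"

text \<open>By Foundation, the ordinals are the transitive sets of transitive sets.\<close>

definition fin_ord :: "tm \<Rightarrow> fb" where
  "fin_ord n = (trans_set n \<^bold>\<and> (\<^bold>\<forall>m. m \<^bold>\<in> n \<^bold>\<longrightarrow> trans_set m) \<^bold>\<and>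
     (\<^bold>\<forall>m. m \<^bold>\<in> succ n \<^bold>\<longrightarrow> m \<^bold>= Zero \<^bold>\<or> (\<^bold>\<exists>k. m \<^bold>= succ k)))"

definition is_fun :: "tm \<Rightarrow> fb" where
  "is_fun f = ((\<^bold>\<forall>p. p \<^bold>\<in> f \<^bold>\<longrightarrow> (\<^bold>\<exists>x. \<^bold>\<exists>y. p \<^bold>= pr x y)) \<^bold>\<and>
     (\<^bold>\<forall>x. \<^bold>\<forall>y. \<^bold>\<forall>z. pr x y \<^bold>\<in> f \<^bold>\<and> pr x z \<^bold>\<in> f \<^bold>\<longrightarrow> y \<^bold>= z))"

definition in_dom :: "tm \<Rightarrow> tm \<Rightarrow> fb" where
  "in_dom x f = (\<^bold>\<exists>y. pr x y \<^bold>\<in> f)"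

definition fun_on :: "tm \<Rightarrow> tm \<Rightarrow> fb" where
  "fun_on f a = (is_fun f \<^bold>\<and> (\<^bold>\<forall>x. in_dom x f \<^bold>\<longleftrightarrow> x \<^bold>\<in> a))"

definition finite_set :: "tm \<Rightarrow> fb" where
  "finite_set x = (\<^bold>\<exists>n. \<^bold>\<exists>f. fin_ord n \<^bold>\<and> fun_on f n \<^bold>\<and>
     (\<^bold>\<forall>y. y \<^bold>\<in> x \<^bold>\<longleftrightarrow> (\<^bold>\<exists>i. pr i y \<^bold>\<in> f)) \<^bold>\<and>
     (\<^bold>\<forall>i. \<^bold>\<forall>j. \<^bold>\<forall>y. pr i y \<^bold>\<in> f \<^bold>\<and> pr j y \<^bold>\<in> f \<^bold>\<longrightarrow> i \<^bold>= j))"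

definition hered_finite :: "tm \<Rightarrow> fb" where
  "hered_finite x = (\<^bold>\<exists>t. finite_set t \<^bold>\<and> trans_set t \<^bold>\<and> x \<^bold>\<subseteq> t)"

text \<open>\<open>a\<close> is an \<open>m\<close>-tuple, i.e. a function on \<open>m\<close>, of elements of the set or class \<open>D\<close>.\<close>

definition tuple :: "tm \<Rightarrow> tm \<Rightarrow> tm \<Rightarrow> fb" where
  "tuple a m D = (fun_on a m \<^bold>\<and> (\<^bold>\<forall>i. \<^bold>\<forall>x. pr i x \<^bold>\<in> a \<^bold>\<longrightarrow> x \<^bold>\<in> D))"

text \<open>\<open>x \<in> V\<^sub>n\<close> for a finite ordinal \<open>n\<close>; here \<open>f\<close> is the sequence \<open>V\<^sub>0, \<dots>, V\<^sub>n\<close>.\<close>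

definition in_V :: "tm \<Rightarrow> tm \<Rightarrow> fb" where
  "in_V n x = (\<^bold>\<exists>f. fun_on f (succ n) \<^bold>\<and> pr Zero Zero \<^bold>\<in> f \<^bold>\<and>
     (\<^bold>\<forall>k. \<^bold>\<forall>u. \<^bold>\<forall>w. k \<^bold>\<in> n \<^bold>\<and> pr k u \<^bold>\<in> f \<^bold>\<and> pr (succ k) w \<^bold>\<in> f \<^bold>\<longrightarrow>
        (\<^bold>\<forall>y. y \<^bold>\<in> w \<^bold>\<longleftrightarrow> y \<^bold>\<subseteq> u)) \<^bold>\<and>
     (\<^bold>\<exists>u. pr n u \<^bold>\<in> f \<^bold>\<and> x \<^bold>\<in> u))"


section \<open>The theory S: ZF without Infinity\<close>

definition ax_ext :: fb where
  "ax_ext = (\<^bold>\<forall>x. \<^bold>\<forall>y. (\<^bold>\<forall>z. z \<^bold>\<in> x \<^bold>\<longleftrightarrow> z \<^bold>\<in> y) \<^bold>\<longrightarrow> x \<^bold>= y)"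

definition ax_zero :: fb where
  "ax_zero = (\<^bold>\<forall>z. \<^bold>\<not> z \<^bold>\<in> Zero)"

definition ax_adj :: fb where
  "ax_adj = (\<^bold>\<forall>x. \<^bold>\<forall>y. \<^bold>\<forall>z. z \<^bold>\<in> Adj x y \<^bold>\<longleftrightarrow> z \<^bold>\<in> x \<^bold>\<or> z \<^bold>= y)"

definition ax_pairing :: fb where
  "ax_pairing = (\<^bold>\<forall>x. \<^bold>\<forall>y. \<^bold>\<exists>z. \<^bold>\<forall>w. w \<^bold>\<in> z \<^bold>\<longleftrightarrow> w \<^bold>= x \<^bold>\<or> w \<^bold>= y)"

definition ax_union :: fb where
  "ax_union = (\<^bold>\<forall>x. \<^bold>\<exists>y. \<^bold>\<forall>z. z \<^bold>\<in> y \<^bold>\<longleftrightarrow> (\<^bold>\<exists>w. z \<^bold>\<in> w \<^bold>\<and> w \<^bold>\<in> x))"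

definition ax_power :: fb where
  "ax_power = (\<^bold>\<forall>x. \<^bold>\<exists>y. \<^bold>\<forall>z. z \<^bold>\<in> y \<^bold>\<longleftrightarrow> z \<^bold>\<subseteq> x)"

definition ax_foundation :: fb where
  "ax_foundation = (\<^bold>\<forall>x. (\<^bold>\<exists>y. y \<^bold>\<in> x) \<^bold>\<longrightarrow> (\<^bold>\<exists>y. y \<^bold>\<in> x \<^bold>\<and> \<^bold>\<not> (\<^bold>\<exists>z. z \<^bold>\<in> x \<^bold>\<and> z \<^bold>\<in> y)))"

text \<open>
  Replacement for the formula \<open>A(x, y)\<close>, possibly with further parameters: if on \<open>a\<close> it defines a
  partial function, then the image of \<open>a\<close> exists. Separation is the case \<open>x = y \<and> A(x)\<close>.
\<close>

definition replacement :: "nat \<Rightarrow> nat \<Rightarrow> nat \<Rightarrow> nat \<Rightarrow> nat \<Rightarrow> fm \<Rightarrow> fm" where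
  "replacement x y z a b A =
     Imp (All x (Imp (Mem (Var x) (Var a)) (Ex z (All y (Imp A (Eq (Var y) (Var z)))))))
         (Ex b (All y (Iff (Mem (Var y) (Var b)) (Ex x (And (Mem (Var x) (Var a)) A)))))"

definition S_axioms :: "fm set" where
  "S_axioms = {ax_ext 0, ax_zero 0, ax_adj 0, ax_pairing 0, ax_union 0, ax_power 0, ax_foundation 0}
     \<union> {replacement x y z a b A | x y z a b A. distinct [x, y, z, a, b] \<and> z \<notin> fv A \<and> b \<notin> fv A}"


section \<open>Coded syntax\<close>

text \<open>
  Expressions of an arbitrary signature, coded as sets. The following are terms denoting the
  codes; the arguments \<open>a\<close> of a function or relation symbol are coded as a tuple. A quantifier
  carries the code of a variable. All these operations raise the rank.
\<close>

definition cVar :: "tm \<Rightarrow> tm" where "cVar i = pr (num 0) i"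
definition cFun :: "tm \<Rightarrow> tm \<Rightarrow> tm" where "cFun f a = pr (num 1) (pr f a)"
definition cRel :: "tm \<Rightarrow> tm \<Rightarrow> tm" where "cRel R a = pr (num 2) (pr R a)"
definition cEq :: "tm \<Rightarrow> tm \<Rightarrow> tm" where "cEq s t = pr (num 3) (pr s t)"
definition cFls :: tm where "cFls = pr (num 4) Zero"
definition cImp :: "tm \<Rightarrow> tm \<Rightarrow> tm" where "cImp p q = pr (num 5) (pr p q)"
definition cAll :: "tm \<Rightarrow> tm \<Rightarrow> tm" where "cAll v p = pr (num 6) (pr v p)"

abbreviation cNeg :: "tm \<Rightarrow> tm" where "cNeg p \<equiv> cImp p cFls"
abbreviation cAnd :: "tm \<Rightarrow> tm \<Rightarrow> tm" where "cAnd p q \<equiv> cNeg (cImp p (cNeg q))"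
abbreviation cIff :: "tm \<Rightarrow> tm \<Rightarrow> tm" where "cIff p q \<equiv> cAnd (cImp p q) (cImp q p)"
abbreviation cEx :: "tm \<Rightarrow> tm \<Rightarrow> tm" where "cEx v p \<equiv> cNeg (cAll v (cNeg p))"

text \<open>
  A signature is a function assigning to each of its symbols a pair \<open>(k, m)\<close>, where \<open>m\<close> is the
  arity, \<open>k = 0\<close> for a relation symbol and \<open>k = 1\<close> for a function symbol; constants are function
  symbols of arity \<open>0\<close>. Equality is a logical symbol.
\<close>

definition rel_symbol :: "tm \<Rightarrow> tm \<Rightarrow> tm \<Rightarrow> fb" where
  "rel_symbol r R m = (pr R (pr (num 0) m) \<^bold>\<in> r)"

definition fun_symbol :: "tm \<Rightarrow> tm \<Rightarrow> tm \<Rightarrow> fb" where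
  "fun_symbol r f m = (pr f (pr (num 1) m) \<^bold>\<in> r)"

definition signature :: "tm \<Rightarrow> fb" where
  "signature r = (is_fun r \<^bold>\<and>
     (\<^bold>\<forall>p. p \<^bold>\<in> r \<^bold>\<longrightarrow> (\<^bold>\<exists>s. \<^bold>\<exists>k. \<^bold>\<exists>m. p \<^bold>= pr s (pr k m) \<^bold>\<and> (k \<^bold>= num 0 \<^bold>\<or> k \<^bold>= num 1) \<^bold>\<and> fin_ord m)))"

text \<open>
  The inductive notions below are expressed by the existence of a set \<open>T\<close> each of whose members is
  justified by an inductive clause applied to further members of \<open>T\<close>. The operations in question
  raise the rank, so by Foundation such justifications are well-founded.
\<close>

definition is_var :: "tm \<Rightarrow> fb" where
  "is_var v = (\<^bold>\<exists>i. fin_ord i \<^bold>\<and> v \<^bold>= cVar i)"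

definition is_term :: "tm \<Rightarrow> tm \<Rightarrow> fb" where
  "is_term r e = (\<^bold>\<exists>T. e \<^bold>\<in> T \<^bold>\<and> (\<^bold>\<forall>d. d \<^bold>\<in> T \<^bold>\<longrightarrow>
     is_var d \<^bold>\<or>
     (\<^bold>\<exists>f. \<^bold>\<exists>m. \<^bold>\<exists>a. fun_symbol r f m \<^bold>\<and> tuple a m T \<^bold>\<and> d \<^bold>= cFun f a)))"

text \<open>Falsum counts as atomic.\<close>

definition is_atomic :: "tm \<Rightarrow> tm \<Rightarrow> fb" where
  "is_atomic r d =
     ((\<^bold>\<exists>R. \<^bold>\<exists>m. \<^bold>\<exists>a. rel_symbol r R m \<^bold>\<and> fun_on a m \<^bold>\<and> (\<^bold>\<forall>i. \<^bold>\<forall>t. pr i t \<^bold>\<in> a \<^bold>\<longrightarrow> is_term r t) \<^bold>\<and> d \<^bold>= cRel R a) \<^bold>\<or>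
      (\<^bold>\<exists>s. \<^bold>\<exists>t. is_term r s \<^bold>\<and> is_term r t \<^bold>\<and> d \<^bold>= cEq s t) \<^bold>\<or>
      d \<^bold>= cFls)"

definition is_formula :: "tm \<Rightarrow> tm \<Rightarrow> fb" where
  "is_formula r e = (\<^bold>\<exists>T. e \<^bold>\<in> T \<^bold>\<and> (\<^bold>\<forall>d. d \<^bold>\<in> T \<^bold>\<longrightarrow>
     is_atomic r d \<^bold>\<or>
     (\<^bold>\<exists>p. \<^bold>\<exists>q. p \<^bold>\<in> T \<^bold>\<and> q \<^bold>\<in> T \<^bold>\<and> d \<^bold>= cImp p q) \<^bold>\<or>
     (\<^bold>\<exists>v. \<^bold>\<exists>p. is_var v \<^bold>\<and> p \<^bold>\<in> T \<^bold>\<and> d \<^bold>= cAll v p)))"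

definition imm_part :: "tm \<Rightarrow> tm \<Rightarrow> fb" where
  "imm_part c d =
     ((\<^bold>\<exists>s. \<^bold>\<exists>a. \<^bold>\<exists>i. (d \<^bold>= cFun s a \<^bold>\<or> d \<^bold>= cRel s a) \<^bold>\<and> pr i c \<^bold>\<in> a) \<^bold>\<or>
      (\<^bold>\<exists>b. d \<^bold>= cEq c b \<^bold>\<or> d \<^bold>= cEq b c \<^bold>\<or> d \<^bold>= cImp c b \<^bold>\<or> d \<^bold>= cImp b c) \<^bold>\<or>
      (\<^bold>\<exists>v. d \<^bold>= cAll v c))"

definition subexpr :: "tm \<Rightarrow> tm \<Rightarrow> fb" where
  "subexpr e p = (\<^bold>\<exists>T. p \<^bold>\<in> T \<^bold>\<and> (\<^bold>\<forall>d. d \<^bold>\<in> T \<^bold>\<longrightarrow> d \<^bold>= e \<^bold>\<or> (\<^bold>\<exists>c. c \<^bold>\<in> T \<^bold>\<and> imm_part c d)))"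

text \<open>A free occurrence of \<open>v\<close> is reached by a path avoiding the quantifiers over \<open>v\<close>.\<close>

definition free_in :: "tm \<Rightarrow> tm \<Rightarrow> fb" where
  "free_in v e = (\<^bold>\<exists>T. e \<^bold>\<in> T \<^bold>\<and> (\<^bold>\<forall>d. d \<^bold>\<in> T \<^bold>\<longrightarrow>
     d \<^bold>= v \<^bold>\<or> (\<^bold>\<exists>c. c \<^bold>\<in> T \<^bold>\<and> imm_part c d \<^bold>\<and> \<^bold>\<not> (\<^bold>\<exists>p. d \<^bold>= cAll v p))))"

text \<open>
  \<open>t\<close> is substitutable for \<open>v\<close> in the expression \<open>e\<close>, and \<open>e'\<close> is the result of the substitution.
\<close>

definition is_subst :: "tm \<Rightarrow> tm \<Rightarrow> tm \<Rightarrow> tm \<Rightarrow> fb" where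
  "is_subst v t e e' = (\<^bold>\<exists>T. pr e e' \<^bold>\<in> T \<^bold>\<and> (\<^bold>\<forall>x. x \<^bold>\<in> T \<^bold>\<longrightarrow> (\<^bold>\<exists>c. \<^bold>\<exists>c'. x \<^bold>= pr c c' \<^bold>\<and> (
     (c \<^bold>= v \<^bold>\<and> c' \<^bold>= t) \<^bold>\<or>
     (\<^bold>\<not> free_in v c \<^bold>\<and> c' \<^bold>= c) \<^bold>\<or>
     (\<^bold>\<exists>s. \<^bold>\<exists>a. \<^bold>\<exists>a'.
        ((c \<^bold>= cFun s a \<^bold>\<and> c' \<^bold>= cFun s a') \<^bold>\<or> (c \<^bold>= cRel s a \<^bold>\<and> c' \<^bold>= cRel s a')) \<^bold>\<and>
        is_fun a \<^bold>\<and> is_fun a' \<^bold>\<and> (\<^bold>\<forall>i. in_dom i a \<^bold>\<longleftrightarrow> in_dom i a') \<^bold>\<and>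
        (\<^bold>\<forall>i. \<^bold>\<forall>y. \<^bold>\<forall>y'. pr i y \<^bold>\<in> a \<^bold>\<and> pr i y' \<^bold>\<in> a' \<^bold>\<longrightarrow> pr y y' \<^bold>\<in> T)) \<^bold>\<or>
     (\<^bold>\<exists>p. \<^bold>\<exists>p'. \<^bold>\<exists>q. \<^bold>\<exists>q'.
        ((c \<^bold>= cEq p q \<^bold>\<and> c' \<^bold>= cEq p' q') \<^bold>\<or> (c \<^bold>= cImp p q \<^bold>\<and> c' \<^bold>= cImp p' q')) \<^bold>\<and>
        pr p p' \<^bold>\<in> T \<^bold>\<and> pr q q' \<^bold>\<in> T) \<^bold>\<or>
     (\<^bold>\<exists>w. \<^bold>\<exists>p. \<^bold>\<exists>p'. c \<^bold>= cAll w p \<^bold>\<and> c' \<^bold>= cAll w p' \<^bold>\<and>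
        \<^bold>\<not> w \<^bold>= v \<^bold>\<and> \<^bold>\<not> free_in w t \<^bold>\<and> pr p p' \<^bold>\<in> T)))))"


section \<open>Satisfaction\<close>

text \<open>
  A structure may be a proper class. It is given by two classes: its domain \<open>D\<close>, and \<open>I\<close>, which
  consists of the pairs \<open>(R, b)\<close> for which the tuple \<open>b\<close> stands in the relation denoted by \<open>R\<close>,
  and the pairs \<open>(f, (b, u))\<close> for which \<open>u\<close> is the value at \<open>b\<close> of the function denoted by \<open>f\<close>.
  This formula, like \<open>evaluation\<close> below, is used only under \<open>sets_only\<close>.
\<close>

definition is_structure :: "tm \<Rightarrow> tm \<Rightarrow> tm \<Rightarrow> fb" where
  "is_structure r D I = (signature r \<^bold>\<and> (\<^bold>\<exists>x. x \<^bold>\<in> D) \<^bold>\<and>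
     (\<^bold>\<forall>p. p \<^bold>\<in> I \<^bold>\<longrightarrow>
        (\<^bold>\<exists>R. \<^bold>\<exists>m. \<^bold>\<exists>b. rel_symbol r R m \<^bold>\<and> tuple b m D \<^bold>\<and> p \<^bold>= pr R b) \<^bold>\<or>
        (\<^bold>\<exists>f. \<^bold>\<exists>m. \<^bold>\<exists>b. \<^bold>\<exists>u. fun_symbol r f m \<^bold>\<and> tuple b m D \<^bold>\<and> u \<^bold>\<in> D \<^bold>\<and> p \<^bold>= pr f (pr b u))) \<^bold>\<and>
     (\<^bold>\<forall>f. \<^bold>\<forall>m. \<^bold>\<forall>b. fun_symbol r f m \<^bold>\<and> tuple b m D \<^bold>\<longrightarrow>
        (\<^bold>\<exists>u. \<^bold>\<forall>w. pr f (pr b w) \<^bold>\<in> I \<^bold>\<longleftrightarrow> w \<^bold>= u)))"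

definition assignment :: "tm \<Rightarrow> tm \<Rightarrow> fb" where
  "assignment D A = (is_fun A \<^bold>\<and> finite_set A \<^bold>\<and> (\<^bold>\<forall>v. \<^bold>\<forall>x. pr v x \<^bold>\<in> A \<^bold>\<longrightarrow> x \<^bold>\<in> D))"

definition is_update :: "tm \<Rightarrow> tm \<Rightarrow> tm \<Rightarrow> tm \<Rightarrow> fb" where
  "is_update A v x B =
     (\<^bold>\<forall>p. p \<^bold>\<in> B \<^bold>\<longleftrightarrow> p \<^bold>= pr v x \<^bold>\<or> (p \<^bold>\<in> A \<^bold>\<and> \<^bold>\<not> (\<^bold>\<exists>y. p \<^bold>= pr v y)))"

text \<open>
  The pairs \<open>(e, A)\<close> with \<open>e\<close> a subexpression (subformula, or term occurring in it) of a member of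
  the class \<open>P\<close> of formulas, and \<open>A\<close> a finite assignment defined on the free variables of \<open>e\<close>.
\<close>

definition eval_dom :: "(tm \<Rightarrow> fb) \<Rightarrow> tm \<Rightarrow> tm \<Rightarrow> tm \<Rightarrow> fb" where
  "eval_dom P D e A = ((\<^bold>\<exists>p. P p \<^bold>\<and> subexpr e p) \<^bold>\<and> assignment D A \<^bold>\<and>
     (\<^bold>\<forall>v. is_var v \<^bold>\<and> free_in v e \<^bold>\<longrightarrow> in_dom v A))"

text \<open>\<open>b\<close> is the tuple of the values under \<open>A\<close> of the members of the tuple \<open>a\<close> of terms.\<close>

definition arg_values :: "tm \<Rightarrow> tm \<Rightarrow> tm \<Rightarrow> tm \<Rightarrow> fb" where
  "arg_values F A a b = (is_fun b \<^bold>\<and> (\<^bold>\<forall>i. in_dom i a \<^bold>\<longleftrightarrow> in_dom i b) \<^bold>\<and>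
     (\<^bold>\<forall>i. \<^bold>\<forall>t. \<^bold>\<forall>y. pr i t \<^bold>\<in> a \<^bold>\<and> pr i y \<^bold>\<in> b \<^bold>\<longrightarrow> pr (pr t A) y \<^bold>\<in> F))"

text \<open>
  The class \<open>F\<close> is the function on these pairs given by Tarski's clauses: it assigns elements of the
  domain to terms, and truth values (\<open>1\<close> for true, \<open>0\<close> for false) to formulas.
\<close>

definition evaluation :: "(tm \<Rightarrow> fb) \<Rightarrow> tm \<Rightarrow> tm \<Rightarrow> tm \<Rightarrow> tm \<Rightarrow> fb" where
  "evaluation P r D I F =
     ((\<^bold>\<forall>x. x \<^bold>\<in> F \<^bold>\<longrightarrow> (\<^bold>\<exists>e. \<^bold>\<exists>A. \<^bold>\<exists>u. x \<^bold>= pr (pr e A) u \<^bold>\<and> eval_dom P D e A)) \<^bold>\<and>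
      (\<^bold>\<forall>e. \<^bold>\<forall>A. eval_dom P D e A \<^bold>\<longrightarrow> (\<^bold>\<exists>u. \<^bold>\<forall>w. pr (pr e A) w \<^bold>\<in> F \<^bold>\<longleftrightarrow> w \<^bold>= u)) \<^bold>\<and>
      (\<^bold>\<forall>e. \<^bold>\<forall>A. \<^bold>\<forall>u. pr (pr e A) u \<^bold>\<in> F \<^bold>\<longrightarrow>
         (is_var e \<^bold>\<longrightarrow> pr e u \<^bold>\<in> A) \<^bold>\<and>
         (\<^bold>\<forall>f. \<^bold>\<forall>a. e \<^bold>= cFun f a \<^bold>\<longrightarrow> (\<^bold>\<exists>b. arg_values F A a b \<^bold>\<and> pr f (pr b u) \<^bold>\<in> I)) \<^bold>\<and>
         (is_formula r e \<^bold>\<longrightarrow> u \<^bold>= num 0 \<^bold>\<or> u \<^bold>= num 1) \<^bold>\<and>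
         (\<^bold>\<forall>R. \<^bold>\<forall>a. e \<^bold>= cRel R a \<^bold>\<longrightarrow>
            (u \<^bold>= num 1 \<^bold>\<longleftrightarrow> (\<^bold>\<exists>b. arg_values F A a b \<^bold>\<and> pr R b \<^bold>\<in> I))) \<^bold>\<and>
         (\<^bold>\<forall>s. \<^bold>\<forall>t. e \<^bold>= cEq s t \<^bold>\<longrightarrow>
            (u \<^bold>= num 1 \<^bold>\<longleftrightarrow> (\<^bold>\<exists>y. pr (pr s A) y \<^bold>\<in> F \<^bold>\<and> pr (pr t A) y \<^bold>\<in> F))) \<^bold>\<and>
         (e \<^bold>= cFls \<^bold>\<longrightarrow> u \<^bold>= num 0) \<^bold>\<and>
         (\<^bold>\<forall>p. \<^bold>\<forall>q. e \<^bold>= cImp p q \<^bold>\<longrightarrow>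
            (u \<^bold>= num 1 \<^bold>\<longleftrightarrow> (pr (pr p A) (num 1) \<^bold>\<in> F \<^bold>\<longrightarrow> pr (pr q A) (num 1) \<^bold>\<in> F))) \<^bold>\<and>
         (\<^bold>\<forall>v. \<^bold>\<forall>p. e \<^bold>= cAll v p \<^bold>\<longrightarrow>
            (u \<^bold>= num 1 \<^bold>\<longleftrightarrow>
              (\<^bold>\<forall>x. \<^bold>\<forall>B. x \<^bold>\<in> D \<^bold>\<and> is_update A v x B \<^bold>\<longrightarrow> pr (pr p B) (num 1) \<^bold>\<in> F)))))"

text \<open>The quantifier over \<open>F\<close> is a class quantifier.\<close>

definition satisfaction_relation :: "(tm \<Rightarrow> fb) \<Rightarrow> tm \<Rightarrow> tm \<Rightarrow> tm \<Rightarrow> tm \<Rightarrow> fb" where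
  "satisfaction_relation P r D I Sat = (\<^bold>\<exists>F. sets_only (evaluation P r D I F \<^bold>\<and>
     (\<^bold>\<forall>x. x \<^bold>\<in> Sat \<^bold>\<longleftrightarrow>
        (\<^bold>\<exists>p. \<^bold>\<exists>A. x \<^bold>= pr p A \<^bold>\<and> is_formula r p \<^bold>\<and> pr x (num 1) \<^bold>\<in> F))))"

definition Phi :: "tm \<Rightarrow> tm \<Rightarrow> tm \<Rightarrow> fb" where
  "Phi r n p = (is_formula r p \<^bold>\<and> in_V n p)"

text \<open>
  Every \<open>r\<close>-structure has a \<open>Phi r n\<close>-satisfaction relation; the quantifiers over \<open>D\<close>, \<open>I\<close>
  and \<open>Sat\<close> are class quantifiers.
\<close>

definition satisfaction_exists :: "tm \<Rightarrow> tm \<Rightarrow> fb" where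
  "satisfaction_exists r n = (\<^bold>\<forall>D. \<^bold>\<forall>I. sets_only (is_structure r D I) \<^bold>\<longrightarrow>
     (\<^bold>\<exists>Sat. satisfaction_relation (Phi r n) r D I Sat))"


section \<open>The theory C: GB without Infinity, and provability in it, expressed in S\<close>

text \<open>
  In the one-sorted formulation of GB all variables range over classes. All axioms except
  comprehension are collected in a list.
\<close>

definition ax_adj_class :: fb where
  "ax_adj_class = (\<^bold>\<forall>x. \<^bold>\<forall>y. \<^bold>\<forall>z. z \<^bold>\<in> Adj x y \<^bold>\<longleftrightarrow> z \<^bold>\<in> x \<^bold>\<or> (z \<^bold>= y \<^bold>\<and> (\<^bold>\<exists>w. y \<^bold>\<in> w)))"

definition ax_zero_set :: fb where
  "ax_zero_set = (\<^bold>\<exists>w. Zero \<^bold>\<in> w)"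

definition ax_replacement_class :: fb where
  "ax_replacement_class = (\<^bold>\<forall>F. sets_only (
     (\<^bold>\<forall>x. \<^bold>\<forall>y. \<^bold>\<forall>z. pr x y \<^bold>\<in> F \<^bold>\<and> pr x z \<^bold>\<in> F \<^bold>\<longrightarrow> y \<^bold>= z) \<^bold>\<longrightarrow>
     (\<^bold>\<forall>a. \<^bold>\<exists>b. \<^bold>\<forall>y. y \<^bold>\<in> b \<^bold>\<longleftrightarrow> (\<^bold>\<exists>x. x \<^bold>\<in> a \<^bold>\<and> pr x y \<^bold>\<in> F))))"

definition C_finite_axioms :: "fm list" where
  "C_finite_axioms = [ax_ext 0, ax_zero 0, ax_zero_set 0, ax_adj_class 0,
     sets_only ax_pairing 0, sets_only ax_union 0, sets_only ax_power 0,
     sets_only ax_foundation 0, ax_replacement_class 0]"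

text \<open>
  The language of the theories, as a coded signature (symbols: \<open>0\<close> for membership, \<open>1\<close> for the
  constant, \<open>2\<close> for adjunction), and the codes of its terms and formulas, given as closed terms.
\<close>

definition lang :: tm where
  "lang = Adj (Adj (Adj Zero (pr (num 0) (pr (num 0) (num 2))))
     (pr (num 1) (pr (num 1) (num 0)))) (pr (num 2) (pr (num 1) (num 2)))"

definition pair_tuple :: "tm \<Rightarrow> tm \<Rightarrow> tm" where
  "pair_tuple s t = Adj (Adj Zero (pr (num 0) s)) (pr (num 1) t)"

definition cZero :: tm where "cZero = cFun (num 1) Zero"
definition cAdj :: "tm \<Rightarrow> tm \<Rightarrow> tm" where "cAdj s t = cFun (num 2) (pair_tuple s t)"
definition cMem :: "tm \<Rightarrow> tm \<Rightarrow> tm" where "cMem s t = cRel (num 0) (pair_tuple s t)"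

primrec code_tm :: "tm \<Rightarrow> tm" where
  "code_tm (Var i) = cVar (num i)"
| "code_tm Zero = cZero"
| "code_tm (Adj s t) = cAdj (code_tm s) (code_tm t)"

primrec code_fm :: "fm \<Rightarrow> tm" where
  "code_fm (Mem s t) = cMem (code_tm s) (code_tm t)"
| "code_fm (Eq s t) = cEq (code_tm s) (code_tm t)"
| "code_fm Fls = cFls"
| "code_fm (Imp A B) = cImp (code_fm A) (code_fm B)"
| "code_fm (All x A) = cAll (cVar (num x)) (code_fm A)"

text \<open>
  The code of \<open>SetF\<close> for the variable with index \<open>i\<close>, and the formulas all of whose quantifiers
  are restricted to sets in this way, i.e. those without bound class variables.
\<close>

definition cSet :: "tm \<Rightarrow> tm" where
  "cSet i = cEx (cVar (succ i)) (cMem (cVar i) (cVar (succ i)))"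

definition is_predicative :: "tm \<Rightarrow> fb" where
  "is_predicative e = (\<^bold>\<exists>T. e \<^bold>\<in> T \<^bold>\<and> (\<^bold>\<forall>d. d \<^bold>\<in> T \<^bold>\<longrightarrow>
     is_atomic lang d \<^bold>\<or>
     (\<^bold>\<exists>p. \<^bold>\<exists>q. p \<^bold>\<in> T \<^bold>\<and> q \<^bold>\<in> T \<^bold>\<and> d \<^bold>= cImp p q) \<^bold>\<or>
     (\<^bold>\<exists>i. \<^bold>\<exists>p. fin_ord i \<^bold>\<and> p \<^bold>\<in> T \<^bold>\<and> d \<^bold>= cAll (cVar i) (cImp (cSet i) p))))"

text \<open>With \<open>X\<close> and \<open>x\<close> the variables of index \<open>j\<close> and \<open>i\<close>: \<open>\<exists>X. \<forall>x. x is a set \<longrightarrow> (x \<in> X \<longleftrightarrow> p)\<close>.\<close>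

definition is_comprehension :: "tm \<Rightarrow> fb" where
  "is_comprehension d = (\<^bold>\<exists>p. \<^bold>\<exists>i. \<^bold>\<exists>j. is_predicative p \<^bold>\<and> fin_ord i \<^bold>\<and> fin_ord j \<^bold>\<and>
     \<^bold>\<not> i \<^bold>= j \<^bold>\<and> \<^bold>\<not> free_in (cVar j) p \<^bold>\<and>
     d \<^bold>= cEx (cVar j) (cAll (cVar i) (cImp (cSet i) (cIff (cMem (cVar i) (cVar j)) p))))"

definition C_axiom :: "tm \<Rightarrow> fb" where
  "C_axiom d = foldr (\<lambda>A b. d \<^bold>= code_fm A \<^bold>\<or> b) C_finite_axioms (is_comprehension d)"

text \<open>The Hilbert calculus above, for coded formulas of the signature \<open>r\<close>.\<close>

definition logical_axiom :: "tm \<Rightarrow> tm \<Rightarrow> fb" where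
  "logical_axiom r d =
     ((\<^bold>\<exists>p. \<^bold>\<exists>q. is_formula r p \<^bold>\<and> is_formula r q \<^bold>\<and> d \<^bold>= cImp p (cImp q p)) \<^bold>\<or>
      (\<^bold>\<exists>p. \<^bold>\<exists>q. \<^bold>\<exists>s. is_formula r p \<^bold>\<and> is_formula r q \<^bold>\<and> is_formula r s \<^bold>\<and>
         d \<^bold>= cImp (cImp p (cImp q s)) (cImp (cImp p q) (cImp p s))) \<^bold>\<or>
      (\<^bold>\<exists>p. is_formula r p \<^bold>\<and> d \<^bold>= cImp (cNeg (cNeg p)) p) \<^bold>\<or>
      (\<^bold>\<exists>v. \<^bold>\<exists>t. \<^bold>\<exists>p. \<^bold>\<exists>p'. is_var v \<^bold>\<and> is_term r t \<^bold>\<and> is_formula r p \<^bold>\<and> is_subst v t p p' \<^bold>\<and>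
         d \<^bold>= cImp (cAll v p) p') \<^bold>\<or>
      (\<^bold>\<exists>v. \<^bold>\<exists>p. \<^bold>\<exists>q. is_var v \<^bold>\<and> is_formula r p \<^bold>\<and> is_formula r q \<^bold>\<and> \<^bold>\<not> free_in v p \<^bold>\<and>
         d \<^bold>= cImp (cAll v (cImp p q)) (cImp p (cAll v q))) \<^bold>\<or>
      (\<^bold>\<exists>t. is_term r t \<^bold>\<and> d \<^bold>= cEq t t) \<^bold>\<or>
      (\<^bold>\<exists>v. \<^bold>\<exists>s. \<^bold>\<exists>t. \<^bold>\<exists>p. \<^bold>\<exists>p'. \<^bold>\<exists>p''. is_var v \<^bold>\<and> is_term r s \<^bold>\<and> is_term r t \<^bold>\<and> is_formula r p \<^bold>\<and>
         is_subst v s p p' \<^bold>\<and> is_subst v t p p'' \<^bold>\<and> d \<^bold>= cImp (cEq s t) (cImp p' p'')))"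

text \<open>\<open>g\<close> is a derivation of length \<open>k + 1\<close> with last line \<open>p\<close> from the axioms \<open>Ax\<close>.\<close>

definition is_provable :: "tm \<Rightarrow> (tm \<Rightarrow> fb) \<Rightarrow> tm \<Rightarrow> fb" where
  "is_provable r Ax p = (\<^bold>\<exists>k. \<^bold>\<exists>g. fin_ord k \<^bold>\<and> fun_on g (succ k) \<^bold>\<and> pr k p \<^bold>\<in> g \<^bold>\<and>
     (\<^bold>\<forall>i. \<^bold>\<forall>d. pr i d \<^bold>\<in> g \<^bold>\<longrightarrow>
        logical_axiom r d \<^bold>\<or> Ax d \<^bold>\<or>
        (\<^bold>\<exists>j. \<^bold>\<exists>l. \<^bold>\<exists>c. j \<^bold>\<in> i \<^bold>\<and> l \<^bold>\<in> i \<^bold>\<and> pr j c \<^bold>\<in> g \<^bold>\<and> pr l (cImp c d) \<^bold>\<in> g) \<^bold>\<or>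
        (\<^bold>\<exists>j. \<^bold>\<exists>c. \<^bold>\<exists>v. j \<^bold>\<in> i \<^bold>\<and> pr j c \<^bold>\<in> g \<^bold>\<and> is_var v \<^bold>\<and> d \<^bold>= cAll v c)))"

definition C_proves :: "tm \<Rightarrow> fb" where
  "C_proves p = is_provable lang C_axiom p"


section \<open>Canonical names\<close>

text \<open>
  The Ackermann ordering of the hereditarily finite sets: \<open>x\<close> precedes \<open>y\<close> iff some element of
  \<open>y - x\<close> is preceded by all elements of \<open>x - y\<close>.
\<close>

definition ack_less :: "tm \<Rightarrow> tm \<Rightarrow> fb" where
  "ack_less x y = (\<^bold>\<exists>T. pr x y \<^bold>\<in> T \<^bold>\<and> (\<^bold>\<forall>q. q \<^bold>\<in> T \<^bold>\<longrightarrow> (\<^bold>\<exists>a. \<^bold>\<exists>b. \<^bold>\<exists>z. q \<^bold>= pr a b \<^bold>\<and>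
     z \<^bold>\<in> b \<^bold>\<and> \<^bold>\<not> z \<^bold>\<in> a \<^bold>\<and> (\<^bold>\<forall>w. w \<^bold>\<in> a \<^bold>\<and> \<^bold>\<not> w \<^bold>\<in> b \<^bold>\<longrightarrow> pr w z \<^bold>\<in> T))))"

text \<open>
  \<open>c\<close> is the code of the canonical name of \<open>x\<close>. The procedure: the name of the empty set is the
  constant \<open>0\<close>; for nonempty \<open>x\<close>, split off its Ackermann-greatest element \<open>z\<close>, so
  \<open>x = y \<union> {z}\<close> where \<open>z\<close> is not in \<open>y\<close>, and apply the adjunction symbol to the names of \<open>y\<close>
  and \<open>z\<close>. Here Foundation is used in the second components.
\<close>

definition canonical_name :: "tm \<Rightarrow> tm \<Rightarrow> fb" where
  "canonical_name x c = (\<^bold>\<exists>T. pr x c \<^bold>\<in> T \<^bold>\<and> (\<^bold>\<forall>q. q \<^bold>\<in> T \<^bold>\<longrightarrow>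
     q \<^bold>= pr Zero cZero \<^bold>\<or>
     (\<^bold>\<exists>y. \<^bold>\<exists>z. \<^bold>\<exists>s. \<^bold>\<exists>t. q \<^bold>= pr (Adj y z) (cAdj s t) \<^bold>\<and>
        \<^bold>\<not> z \<^bold>\<in> y \<^bold>\<and> (\<^bold>\<forall>w. w \<^bold>\<in> y \<^bold>\<longrightarrow> ack_less w z) \<^bold>\<and> pr y s \<^bold>\<in> T \<^bold>\<and> pr z t \<^bold>\<in> T)))"


section \<open>The assertion made in S\<close>

text \<open>
  The formula \<open>satisfaction_exists\<close> with its free variables \<open>0\<close> (the signature) and \<open>1\<close> (the
  bound on the rank); bound variables are named from \<open>2\<close> on.
\<close>

definition Theta :: fm where
  "Theta = satisfaction_exists (Var 0) (Var 1) 2"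

text \<open>\<open>q\<close> is the sentence obtained from \<open>Theta\<close> by substituting the terms \<open>s\<close> and \<open>t\<close>.\<close>

definition is_Theta_instance :: "tm \<Rightarrow> tm \<Rightarrow> tm \<Rightarrow> fb" where
  "is_Theta_instance s t q = (\<^bold>\<exists>p. is_subst (cVar (num 0)) s (code_fm Theta) p \<^bold>\<and>
     is_subst (cVar (num 1)) t p q)"

definition C_proves_satisfaction_exists :: fb where
  "C_proves_satisfaction_exists = (\<^bold>\<forall>r. \<^bold>\<forall>n. hered_finite r \<^bold>\<and> signature r \<^bold>\<and> fin_ord n \<^bold>\<longrightarrow>
     (\<^bold>\<exists>s. \<^bold>\<exists>t. \<^bold>\<exists>q. canonical_name r s \<^bold>\<and> canonical_name n t \<^bold>\<and>
        is_Theta_instance s t q \<^bold>\<and> C_proves q))"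

end

theory Submission
  imports Defs "HOL-Library.Countable_Set"
begin

text \<open>
  By completeness of the Hilbert calculus it suffices to work in a model of \<open>S\<close>, by induction on its
  finite ordinals \<open>n\<close>, which may be nonstandard. Let \<open>\<theta>(r, n)\<close> say that \<open>V\<^sub>n\<close> is transitive and that every
  \<open>r\<close>-structure has an evaluation of all terms and formulas of \<open>r\<close> in \<open>V\<^sub>n\<close>. Class theory proves
  \<open>\<theta>(r, 0)\<close>; it proves \<open>\<theta>(r, n) \<longrightarrow> \<theta>(r, n \<union> {n})\<close>, because the immediate parts of an expression in \<open>V\<close> at
  \<open>n + 1\<close> lie in \<open>V\<^sub>n\<close> and one Tarski step is predicative; and \<open>\<theta>\<close> yields satisfaction relations by
  restriction. These three facts are again obtained by completeness, from reasoning in the models of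
  class theory. Their derivations have copies in the model of \<open>S\<close>, and as the canonical name of
  \<open>n \<union> {n}\<close> is the adjunction of the name of \<open>n\<close> to itself, instantiation and modus ponens turn a
  coded derivation of \<open>\<theta>\<close> for the names of \<open>r\<close> and \<open>n\<close> into one for \<open>n \<union> {n}\<close>. Canonical names exist
  because the Ackermann ordering is linear on the hereditarily finite sets. Transitive closures are
  never used: \<open>S\<close> does not prove that they exist.
\<close>

section \<open>Completeness of the Hilbert calculus\<close>

text \<open>Each single step is predicative. So the induction is moved out of class theory: set
  theory performs it, and what it carries from \<open>n\<close> to the next ordinal is the existence
  of a coded derivation, a statement about sets only. Just three actual derivations have to be
  coded, whatever the model. For a nonstandard \<open>n\<close> the coded derivation may have
  nonstandard length, so it has to come from an induction inside the model, and every predicate used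
  there must be definable, provability included. This is the purpose of the calculus of definable
  relations \<open>Df\<close>. Infinite term models are rearranged to have all of \<open>nat\<close>
  as carrier, so that set theory may quantify over a type. Class theory has a second range of
  quantification, the sets among the classes; hence the carrier \<open>U\<close> beside the
  type.\<close>

locale interp =
  fixes E :: "'a :: countable \<Rightarrow> 'a \<Rightarrow> bool" (infix "\<epsilon>" 50)
    and Z :: 'a and J :: "'a \<Rightarrow> 'a \<Rightarrow> 'a" and U :: "'a set"
begin

primrec val :: "(nat \<Rightarrow> 'a) \<Rightarrow> tm \<Rightarrow> 'a" where
  "val e (Var i) = e i"
| "val e Zero = Z"
| "val e (Adj s t) = J (val e s) (val e t)"

text \<open>Quantifiers range over \<open>U\<close> only, but free variables may denote any element of the type.\<close>

fun sat :: "(nat \<Rightarrow> 'a) \<Rightarrow> fm \<Rightarrow> bool" where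
  "sat e (Mem s t) = (val e s \<epsilon> val e t)"
| "sat e (Eq s t) = (val e s = val e t)"
| "sat e Fls = False"
| "sat e (Imp A B) = (sat e A \<longrightarrow> sat e B)"
| "sat e (All x A) = (\<forall>a\<in>U. sat (e(x := a)) A)"

lemma val_cong: "(\<And>i. i \<in> vars t \<Longrightarrow> e i = e' i) \<Longrightarrow> val e t = val e' t"
  by (induction t) auto

lemma sat_cong: "(\<And>i. i \<in> fv A \<Longrightarrow> e i = e' i) \<Longrightarrow> sat e A = sat e' A"
proof (induction A arbitrary: e e')
  case (All x A)
  have "sat (e(x := a)) A = sat (e'(x := a)) A" for a
    by (rule All.IH) (use All.prems in auto)
  then show ?case by simp
next
  case (Imp A B)
  have "sat e A = sat e' A" "sat e B = sat e' B"
    by (rule Imp.IH; use Imp.prems in auto)+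
  then show ?case by simp
next
  case (Mem s t)
  have "val e s = val e' s" "val e t = val e' t"
    by (rule val_cong; use Mem in auto)+
  then show ?case by simp
next
  case (Eq s t)
  have "val e s = val e' s" "val e t = val e' t"
    by (rule val_cong; use Eq in auto)+
  then show ?case by simp
qed simp

end

subsection \<open>Derivations from hypotheses\<close>

text \<open>Generalization is not available on the hypotheses \<open>\<Gamma>\<close>, so the deduction theorem holds.\<close>

inductive ded :: "fm set \<Rightarrow> fm set \<Rightarrow> fm \<Rightarrow> bool" for T \<Gamma> where
  hyp: "A \<in> \<Gamma> \<Longrightarrow> ded T \<Gamma> A"
| prv: "T \<turnstile> A \<Longrightarrow> ded T \<Gamma> A"
| detach: "ded T \<Gamma> A \<Longrightarrow> ded T \<Gamma> (Imp A B) \<Longrightarrow> ded T \<Gamma> B"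

lemma imp_refl: "T \<turnstile> Imp A A"
  using MP[OF K[of T A A] MP[OF K[of T A "Imp A A"] S]] .

lemma deduction: "ded T (insert A \<Gamma>) B \<Longrightarrow> ded T \<Gamma> (Imp A B)"
proof (induction rule: ded.induct)
  case (hyp B)
  then show ?case by (metis K ded.hyp ded.detach ded.prv imp_refl insertE)
next
  case (prv B)
  then show ?case by (metis K MP ded.prv)
next
  case (detach B C)
  then show ?case by (metis S ded.detach ded.prv)
qed

lemma ded_empty: "ded T {} A \<longleftrightarrow> T \<turnstile> A"
proof
  show "ded T {} A \<Longrightarrow> T \<turnstile> A" by (induction rule: ded.induct) (auto intro: MP)
qed (rule ded.prv)

lemma ded_mono: "ded T \<Gamma> A \<Longrightarrow> \<Gamma> \<subseteq> \<Delta> \<Longrightarrow> ded T \<Delta> A"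
  by (induction rule: ded.induct) (auto intro: ded.intros)

lemma ded_compact: "ded T \<Gamma> A \<Longrightarrow> \<exists>\<Delta>. finite \<Delta> \<and> \<Delta> \<subseteq> \<Gamma> \<and> ded T \<Delta> A"
proof (induction rule: ded.induct)
  case (hyp A)
  then show ?case by (intro exI[of _ "{A}"]) (auto intro: ded.hyp)
next
  case (prv A)
  then show ?case by (intro exI[of _ "{}"]) (auto intro: ded.prv)
next
  case (detach A B)
  then obtain \<Delta> \<Delta>' where "finite \<Delta>" "\<Delta> \<subseteq> \<Gamma>" "ded T \<Delta> A" "finite \<Delta>'" "\<Delta>' \<subseteq> \<Gamma>" "ded T \<Delta>' (Imp A B)"
    by blast
  then show ?case
    by (intro exI[of _ "\<Delta> \<union> \<Delta>'"]) (auto intro: ded.detach[OF ded_mono ded_mono])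
qed

lemma ded_dn: "ded T \<Gamma> (Neg (Neg A)) \<Longrightarrow> ded T \<Gamma> A"
  by (metis DN ded.detach ded.prv)

lemma ded_ccontr: "ded T (insert (Neg A) \<Gamma>) Fls \<Longrightarrow> ded T \<Gamma> A"
  by (rule ded_dn) (rule deduction)

lemma ded_efq: "ded T \<Gamma> Fls \<Longrightarrow> ded T \<Gamma> A"
  by (metis ded_ccontr ded_mono subset_insertI)

lemma ded_imp_neg: "ded T \<Gamma> (Neg A) \<Longrightarrow> ded T \<Gamma> (Imp A B)"
  by (meson ded_efq deduction ded.hyp ded.detach ded_mono insertI1 subset_insertI)

lemma subst_tm_same [simp]: "subst_tm x (Var x) t = t"
  by (induction t) auto

lemma subst_same [simp]: "subst x (Var x) A = A"
  by (induction A) auto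

lemma free_for_same [simp]: "free_for x (Var x) A"
  by (induction A) auto

lemma ded_inst: "ded T \<Gamma> (All x A) \<Longrightarrow> free_for x t A \<Longrightarrow> ded T \<Gamma> (subst x t A)"
  by (metis Inst ded.detach ded.prv)

lemma ded_inst_same: "ded T \<Gamma> (All x A) \<Longrightarrow> ded T \<Gamma> A"
  by (metis ded_inst free_for_same subst_same)

text \<open>\<open>Dist\<close> moves a quantifier only past an antecedent free of its variable.
  Distribution over an arbitrary implication is obtained by deriving \<open>B\<close> from
  \<open>All y A\<close> and \<open>All y (Imp A B)\<close>, neither of which has \<open>y\<close>
  free, and generalizing.\<close>

lemma ded_gen: "ded T \<Gamma> A \<Longrightarrow> (\<And>B. B \<in> \<Gamma> \<Longrightarrow> y \<notin> fv B) \<Longrightarrow> ded T \<Gamma> (All y A)"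
proof (induction rule: ded.induct)
  case (hyp A)
  have "T \<turnstile> Imp A (All y A)"
    using hyp by (metis Dist Gen MP imp_refl)
  then show ?case using hyp by (metis ded.hyp ded.prv ded.detach)
next
  case (prv A)
  then show ?case by (blast intro: ded.prv Gen)
next
  case (detach A B)
  let ?C = "All y (Imp A B)"
  have "ded T {All y A, ?C} B"
    by (rule ded.detach[of _ _ A]) (rule ded_inst_same, rule ded.hyp, simp)+
  then have "T \<turnstile> Imp ?C (Imp (All y A) B)"
    by (simp add: deduction flip: ded_empty)
  then have 1: "T \<turnstile> Imp ?C (All y (Imp (All y A) B))"
    by (metis Diff_iff Dist Gen MP fv.simps(5) insertI1)
  have "T \<turnstile> Imp (All y (Imp (All y A) B)) (Imp (All y A) (All y B))"
    by (rule Dist) simp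
  then show ?case using detach 1 by (meson ded.detach ded.prv)
qed

lemma all_mono: "T \<turnstile> Imp A B \<Longrightarrow> T \<turnstile> Imp (All x A) (All x B)"
proof -
  assume AB: "T \<turnstile> Imp A B"
  have "ded T {All x A} B"
    by (rule ded.detach[OF ded_inst_same[of _ _ x] ded.prv[OF AB]]) (simp add: ded.hyp)
  then have "ded T {All x A} (All x B)" by (rule ded_gen) simp
  then show ?thesis by (simp add: deduction flip: ded_empty)
qed

subsection \<open>Renaming of all variables\<close>

text \<open>Bound names are counted as well: a name outside this set can be put for any variable
  without capture.\<close>

primrec allv :: "fm \<Rightarrow> nat set" where
  "allv (Mem s t) = vars s \<union> vars t"
| "allv (Eq s t) = vars s \<union> vars t"
| "allv Fls = {}"
| "allv (Imp A B) = allv A \<union> allv B"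
| "allv (All x A) = insert x (allv A)"

primrec ren_tm :: "(nat \<Rightarrow> nat) \<Rightarrow> tm \<Rightarrow> tm" where
  "ren_tm f (Var x) = Var (f x)"
| "ren_tm f Zero = Zero"
| "ren_tm f (Adj s t) = Adj (ren_tm f s) (ren_tm f t)"

primrec ren :: "(nat \<Rightarrow> nat) \<Rightarrow> fm \<Rightarrow> fm" where
  "ren f (Mem s t) = Mem (ren_tm f s) (ren_tm f t)"
| "ren f (Eq s t) = Eq (ren_tm f s) (ren_tm f t)"
| "ren f Fls = Fls"
| "ren f (Imp A B) = Imp (ren f A) (ren f B)"
| "ren f (All x A) = All (f x) (ren f A)"

lemma fv_allv: "fv A \<subseteq> allv A"
  by (induction A) auto

lemma not_allv_fv: "x \<notin> allv A \<Longrightarrow> x \<notin> fv A"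
  using fv_allv by blast

lemma finite_vars [simp]: "finite (vars t)"
  by (induction t) auto

lemma finite_allv [simp]: "finite (allv A)"
  by (induction A) auto

lemma finite_fv [simp]: "finite (fv A)"
  by (metis finite_allv finite_subset fv_allv)

lemma ren_tm_ren_tm: "ren_tm f (ren_tm g t) = ren_tm (f \<circ> g) t"
  by (induction t) auto

lemma ren_ren: "ren f (ren g A) = ren (f \<circ> g) A"
  by (induction A) (auto simp: ren_tm_ren_tm comp_def)

lemma ren_tm_id: "(\<And>x. x \<in> vars t \<Longrightarrow> f x = x) \<Longrightarrow> ren_tm f t = t"
  by (induction t) auto

lemma ren_id: "(\<And>x. x \<in> allv A \<Longrightarrow> f x = x) \<Longrightarrow> ren f A = A"
  by (induction A) (auto simp: ren_tm_id)

lemma vars_ren_tm: "vars (ren_tm f t) = f ` vars t"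
  by (induction t) auto

lemma allv_ren: "allv (ren f A) = f ` allv A"
  by (induction A) (auto simp: vars_ren_tm)

lemma subst_tm_id: "x \<notin> vars s \<Longrightarrow> subst_tm x t s = s"
  by (induction s) auto

lemma subst_id: "x \<notin> fv A \<Longrightarrow> subst x t A = A"
  by (induction A) (auto simp: subst_tm_id)

lemma free_for_fresh: "z \<notin> allv A \<Longrightarrow> free_for x (Var z) A"
  by (induction A) auto

lemma subst_tm_back: "z \<notin> vars t \<Longrightarrow> subst_tm z (Var x) (subst_tm x (Var z) t) = t"
  by (induction t) auto

lemma subst_back: "z \<notin> allv A \<Longrightarrow> subst z (Var x) (subst x (Var z) A) = A"
  by (induction A) (auto simp: subst_tm_back subst_id not_allv_fv)

lemma free_for_back: "z \<notin> allv A \<Longrightarrow> free_for z (Var x) (subst x (Var z) A)"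
proof (induction A)
  case (All y A)
  then show ?case using fv_allv by fastforce
qed auto

lemma fv_subst_tm: "vars (subst_tm x t s) \<subseteq> (vars s - {x}) \<union> vars t"
  by (induction s) auto

lemma fv_subst: "fv (subst x t A) \<subseteq> (fv A - {x}) \<union> vars t"
proof (induction A)
  case (Mem s u)
  then show ?case using fv_subst_tm[of x t s] fv_subst_tm[of x t u] by auto
next
  case (Eq s u)
  then show ?case using fv_subst_tm[of x t s] fv_subst_tm[of x t u] by auto
qed auto

text \<open>Alphabetic variants are different elements of \<open>fm\<close>, so a change of bound
  variable has to be derived: instantiate by the other name, then generalize over that name.\<close>

lemma all_rename:
  assumes "z \<notin> allv A"
  shows "T \<turnstile> Imp (All z (subst x (Var z) A)) (All x A)"
    and "T \<turnstile> Imp (All x A) (All z (subst x (Var z) A))"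
proof -
  let ?B = "subst x (Var z) A"
  have "ded T {All z ?B} A"
    using ded_inst[of T "{All z ?B}" z ?B "Var x"] assms
    by (simp add: ded.hyp subst_back free_for_back)
  then have "ded T {All z ?B} (All x A)"
    by (rule ded_gen) (use fv_subst[of x "Var z" A] in auto)
  then show "T \<turnstile> Imp (All z ?B) (All x A)" by (simp add: deduction flip: ded_empty)
  have "ded T {All x A} ?B"
    using assms by (intro ded_inst) (auto simp: ded.hyp free_for_fresh)
  then have "ded T {All x A} (All z ?B)"
    by (rule ded_gen) (use assms fv_allv in auto)
  then show "T \<turnstile> Imp (All x A) (All z ?B)" by (simp add: deduction flip: ded_empty)
qed

lemma imp_trans: "T \<turnstile> Imp A B \<Longrightarrow> T \<turnstile> Imp B C \<Longrightarrow> T \<turnstile> Imp A C"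
  by (metis K MP S)

lemma imp_mono: "T \<turnstile> Imp A' A \<Longrightarrow> T \<turnstile> Imp B B' \<Longrightarrow> T \<turnstile> Imp (Imp A B) (Imp A' B')"
proof -
  assume *: "T \<turnstile> Imp A' A" "T \<turnstile> Imp B B'"
  have "ded T {A', Imp A B} B'"
    by (rule ded.detach[OF ded.detach[OF ded.detach[OF ded.hyp ded.prv[OF *(1)]] ded.hyp] ded.prv[OF *(2)]]) auto
  then show ?thesis by (simp add: deduction flip: ded_empty)
qed

lemma ren_tm_upd: "ren_tm (id(x := z)) t = subst_tm x (Var z) t"
  by (induction t) auto

text \<open>\<open>ren\<close> renames binders too, \<open>subst\<close> leaves them alone. The two
  results are alphabetic variants, and \<open>all_rename\<close> bridges the gap at the binders of
  \<open>x\<close>.\<close>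

lemma ren_subst:
  "z \<notin> allv A \<Longrightarrow> T \<turnstile> Imp (ren (id(x := z)) A) (subst x (Var z) A) \<and>
     T \<turnstile> Imp (subst x (Var z) A) (ren (id(x := z)) A)"
proof (induction A)
  case (Imp A B)
  then show ?case by (auto intro: imp_mono)
next
  case (All y A)
  show ?case
  proof (cases "y = x")
    case True
    with All show ?thesis
      using all_rename[of z A T x] by (auto intro: imp_trans all_mono)
  next
    case False
    with All show ?thesis by (auto intro: all_mono)
  qed
qed (auto simp: ren_tm_upd imp_refl simp flip: fun_upd_def)

lemma provable_ren: "z \<notin> allv A \<Longrightarrow> T \<turnstile> A \<Longrightarrow> T \<turnstile> ren (id(x := z)) A"
  by (meson Gen Inst MP free_for_fresh ren_subst)

text \<open>Doubling every variable, one variable at a time and starting with the largest.\<close>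

lemma provable_double: "T \<turnstile> ren (\<lambda>i. 2 * i) A \<longleftrightarrow> T \<turnstile> A"
proof -
  define r :: "nat \<Rightarrow> nat \<Rightarrow> nat" where "r k i = (if i < k then i else 2 * i)" for k i
  have step: "T \<turnstile> ren (r (Suc k)) A \<longleftrightarrow> T \<turnstile> ren (r k) A" for k
  proof (cases "k = 0")
    case True
    have "r (Suc 0) = r 0" by (auto simp: r_def fun_eq_iff)
    with True show ?thesis by simp
  next
    case False
    have 1: "id(k := 2 * k) \<circ> r (Suc k) = r k" "id(2 * k := k) \<circ> r k = r (Suc k)"
      using False by (auto simp: r_def fun_eq_iff)
    have 2: "2 * k \<notin> allv (ren (r (Suc k)) A)" "k \<notin> allv (ren (r k) A)"
      using False by (auto simp: r_def allv_ren split: if_splits)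
    show ?thesis
      using provable_ren[OF 2(1), of T k] provable_ren[OF 2(2), of T "2 * k"] by (metis 1 ren_ren)
  qed
  have "T \<turnstile> ren (r k) A \<longleftrightarrow> T \<turnstile> ren (r 0) A" for k
    by (induction k) (auto simp: step)
  moreover have "ren (r (Suc (Max (insert 0 (allv A))))) A = A"
    by (rule ren_id) (simp add: r_def less_Suc_eq_le)
  moreover have "r 0 = (\<lambda>i. 2 * i)" by (auto simp: r_def)
  ultimately show ?thesis by metis
qed

section \<open>Simultaneous instantiation by terms\<close>

primrec inst_tm :: "(nat \<Rightarrow> tm) \<Rightarrow> tm \<Rightarrow> tm" where
  "inst_tm \<sigma> (Var x) = \<sigma> x"
| "inst_tm \<sigma> Zero = Zero"
| "inst_tm \<sigma> (Adj s t) = Adj (inst_tm \<sigma> s) (inst_tm \<sigma> t)"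

text \<open>Every binder receives an even name. With terms in odd variables for the free ones,
  nothing is captured and no fresh name has to be chosen during the recursion.\<close>

fun inst :: "(nat \<Rightarrow> tm) \<Rightarrow> fm \<Rightarrow> fm" where
  "inst \<sigma> (Mem s t) = Mem (inst_tm \<sigma> s) (inst_tm \<sigma> t)"
| "inst \<sigma> (Eq s t) = Eq (inst_tm \<sigma> s) (inst_tm \<sigma> t)"
| "inst \<sigma> Fls = Fls"
| "inst \<sigma> (Imp A B) = Imp (inst \<sigma> A) (inst \<sigma> B)"
| "inst \<sigma> (All x A) = All (2 * x) (inst (\<sigma>(x := Var (2 * x))) A)"

lemma inst_tm_double: "inst_tm (\<lambda>i. Var (2 * i)) t = ren_tm (\<lambda>i. 2 * i) t"
  by (induction t) auto

lemma inst_double: "inst (\<lambda>i. Var (2 * i)) A = ren (\<lambda>i. 2 * i) A"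
proof (induction A)
  case (All x A)
  have "(\<lambda>i. Var (2 * i))(x := Var (2 * x)) = (\<lambda>i. Var (2 * i))" by auto
  with All show ?case by (simp del: fun_upd_apply)
qed (auto simp: inst_tm_double)

lemma subst_inst_tm:
  assumes "\<And>z. z \<noteq> x \<Longrightarrow> 2 * x \<notin> vars (\<sigma> z)" "\<sigma> x = Var (2 * x)"
  shows "subst_tm (2 * x) t (inst_tm \<sigma> s) = inst_tm (\<sigma>(x := t)) s"
  using assms by (induction s) (auto simp: subst_tm_id)

text \<open>Instances of a quantified \<open>inst\<close> are again of the form \<open>inst\<close>:
  no other value of \<open>\<sigma>\<close> contains \<open>2 * x\<close>, so substituting for it
  only changes the value at \<open>x\<close>.\<close>

lemma subst_inst:
  assumes "\<And>z. z \<noteq> x \<Longrightarrow> 2 * x \<notin> vars (\<sigma> z)" "\<sigma> x = Var (2 * x)"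
  shows "subst (2 * x) t (inst \<sigma> A) = inst (\<sigma>(x := t)) A"
  using assms
proof (induction A arbitrary: \<sigma>)
  case (All y A)
  show ?case
  proof (cases "y = x")
    case True
    show ?thesis unfolding True by (simp only: inst.simps subst.simps fun_upd_upd if_True simp_thms)
  next
    case False
    have "subst (2 * x) t (inst (\<sigma>(y := Var (2 * y))) A) = inst (\<sigma>(y := Var (2 * y), x := t)) A"
      by (rule All.IH) (use All.prems False in auto)
    then show ?thesis using False fun_upd_twist[of y x \<sigma> "Var (2 * y)" t]
      by (simp only: inst.simps subst.simps) simp
  qed
qed (simp_all add: subst_inst_tm)

lemma free_for_inst: "(\<And>v. v \<in> vars t \<Longrightarrow> odd v) \<Longrightarrow> free_for x t (inst \<sigma> A)"
  by (induction A arbitrary: \<sigma>) fastforce+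

subsection \<open>Equality\<close>

text \<open>Leibniz's law replaces the occurrences marked by a variable. A fresh \<open>x\<close>
  marks exactly the intended occurrence; transitivity and the congruences below are obtained
  likewise.\<close>

lemma ded_eq_sym: "ded T \<Gamma> (Eq s t) \<Longrightarrow> ded T \<Gamma> (Eq t s)"
proof -
  assume st: "ded T \<Gamma> (Eq s t)"
  obtain x where x: "x \<notin> vars s" using ex_new_if_finite[OF infinite_UNIV_nat finite_vars] by blast
  have "T \<turnstile> Imp (Eq s t) (Imp (Eq s s) (Eq t s))"
    using Leib[of x s "Eq (Var x) s" t T] x by (simp add: subst_tm_id)
  then show ?thesis using st by (meson Refl ded.detach ded.prv)
qed

lemma ded_eq_trans: "ded T \<Gamma> (Eq s t) \<Longrightarrow> ded T \<Gamma> (Eq t u) \<Longrightarrow> ded T \<Gamma> (Eq s u)"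
proof -
  assume st: "ded T \<Gamma> (Eq s t)" "ded T \<Gamma> (Eq t u)"
  obtain x where x: "x \<notin> vars s" using ex_new_if_finite[OF infinite_UNIV_nat finite_vars] by blast
  have "T \<turnstile> Imp (Eq t u) (Imp (Eq s t) (Eq s u))"
    using Leib[of x t "Eq s (Var x)" u T] x by (simp add: subst_tm_id)
  then show ?thesis using st by (meson ded.detach ded.prv)
qed

lemma ded_Adj_cong: "ded T \<Gamma> (Eq s s') \<Longrightarrow> ded T \<Gamma> (Eq t t') \<Longrightarrow> ded T \<Gamma> (Eq (Adj s t) (Adj s' t'))"
proof -
  assume st: "ded T \<Gamma> (Eq s s')" "ded T \<Gamma> (Eq t t')"
  obtain x where x: "x \<notin> vars s \<union> vars t \<union> vars s' \<union> vars t'"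
    using ex_new_if_finite[OF infinite_UNIV_nat, of "vars s \<union> vars t \<union> vars s' \<union> vars t'"] by auto
  have "T \<turnstile> Imp (Eq s s') (Imp (Eq (Adj s t) (Adj s t)) (Eq (Adj s t) (Adj s' t)))"
    "T \<turnstile> Imp (Eq t t') (Imp (Eq (Adj s' t) (Adj s' t)) (Eq (Adj s' t) (Adj s' t')))"
    using Leib[of x s "Eq (Adj s t) (Adj (Var x) t)" s' T]
      Leib[of x t "Eq (Adj s' t) (Adj s' (Var x))" t' T] x by (simp_all add: subst_tm_id)
  then show ?thesis using st by (meson Refl ded.detach ded.prv ded_eq_trans)
qed

lemma ded_Mem_cong:
  "ded T \<Gamma> (Eq s s') \<Longrightarrow> ded T \<Gamma> (Eq t t') \<Longrightarrow> ded T \<Gamma> (Mem s t) \<Longrightarrow> ded T \<Gamma> (Mem s' t')"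
proof -
  assume st: "ded T \<Gamma> (Eq s s')" "ded T \<Gamma> (Eq t t')" "ded T \<Gamma> (Mem s t)"
  obtain x where x: "x \<notin> vars s \<union> vars t \<union> vars s' \<union> vars t'"
    using ex_new_if_finite[OF infinite_UNIV_nat, of "vars s \<union> vars t \<union> vars s' \<union> vars t'"] by auto
  have "T \<turnstile> Imp (Eq s s') (Imp (Mem s t) (Mem s' t))"
    "T \<turnstile> Imp (Eq t t') (Imp (Mem s' t) (Mem s' t'))"
    using Leib[of x s "Mem (Var x) t" s' T] Leib[of x t "Mem s' (Var x)" t' T] x
    by (simp_all add: subst_tm_id)
  then show ?thesis using st by (meson ded.detach ded.prv)
qed

subsection \<open>Henkin sets\<close>

instance tm :: countable by countable_datatype
instance fm :: countable by countable_datatype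

definition con :: "fm set \<Rightarrow> fm set \<Rightarrow> bool" where
  "con T \<Gamma> = (\<not> ded T \<Gamma> Fls)"

text \<open>Were the witness formula inconsistent with \<open>\<Gamma>\<close>, then
  \<open>\<Gamma>\<close> would prove \<open>C\<close> at the fresh \<open>y\<close>, hence
  generally, and renaming back would contradict \<open>Neg (All x C)\<close>.\<close>

lemma con_witness:
  assumes "con T \<Gamma>" "Neg (All x C) \<in> \<Gamma>" "y \<notin> allv C" "y \<noteq> x" "\<And>B. B \<in> \<Gamma> \<Longrightarrow> y \<notin> fv B"
  shows "con T (insert (Neg (subst x (Var y) C)) \<Gamma>)"
  unfolding con_def
proof
  assume "ded T (insert (Neg (subst x (Var y) C)) \<Gamma>) Fls"
  then have "ded T \<Gamma> (All y (subst x (Var y) C))"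
    by (rule ded_gen[OF ded_ccontr]) (use assms in auto)
  then have "ded T \<Gamma> (All x C)" using all_rename(1)[OF assms(3)] by (meson ded.detach ded.prv)
  then show False using assms(1,2) unfolding con_def by (meson ded.hyp ded.detach)
qed

lemma con_extend:
  assumes "con T \<Gamma>" "finite \<Gamma>"
  shows "\<exists>\<Delta>. \<Gamma> \<subseteq> \<Delta> \<and> finite \<Delta> \<and> con T \<Delta> \<and> (B \<in> \<Delta> \<or> \<not> con T (insert B \<Gamma>)) \<and>
    (\<forall>x C. B \<in> \<Delta> \<longrightarrow> B = Neg (All x C) \<longrightarrow> (\<exists>y. odd y \<and> Neg (subst x (Var y) C) \<in> \<Delta>))"
proof (cases "con T (insert B \<Gamma>)")
  case False
  then show ?thesis
    using assms by (intro exI[of _ \<Gamma>]) (auto simp: insert_absorb)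
next
  case con: True
  show ?thesis
  proof (cases "\<exists>x C. B = Neg (All x C)")
    case False
    with con assms show ?thesis by (intro exI[of _ "insert B \<Gamma>"]) auto
  next
    case True
    then obtain x C where B: "B = Neg (All x C)" by blast
    let ?V = "insert x (allv C \<union> \<Union> (fv ` insert B \<Gamma>))"
    have "finite ?V" using assms by simp
    then obtain N where N: "\<forall>v\<in>?V. v < N" by (metis finite_nat_set_iff_bounded)
    \<comment> \<open>Twice a bound plus one is odd and above every name in use.\<close>
    define y where "y = 2 * N + 1"
    have "odd y" by (simp add: y_def)
    have "y \<notin> ?V"
    proof
      assume "y \<in> ?V"
      then have "y < N" using N by blast
      then show False by (simp add: y_def)
    qed
    note y = \<open>odd y\<close> this
    have "con T (insert (Neg (subst x (Var y) C)) (insert B \<Gamma>))"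
      using con y by (intro con_witness) (auto simp: B)
    with y assms show ?thesis
      by (intro exI[of _ "insert (Neg (subst x (Var y) C)) (insert B \<Gamma>)"]) (auto simp: B)
  qed
qed

lemma henkin_extension:
  assumes "con T \<Gamma>" "finite \<Gamma>"
  obtains \<Delta> where "\<Gamma> \<subseteq> \<Delta>" "con T \<Delta>" "\<And>B. B \<in> \<Delta> \<or> ded T \<Delta> (Neg B)"
    "\<And>x C. Neg (All x C) \<in> \<Delta> \<Longrightarrow> \<exists>y. odd y \<and> Neg (subst x (Var y) C) \<in> \<Delta>"
proof -
  \<comment> \<open>Stage \<open>n\<close> treats the formula \<open>from_nat n\<close>, so every
    formula is treated at the stage given by its number.\<close>
  let ?Q = "\<lambda>(n::nat) \<Delta> \<Delta>'. \<Delta> \<subseteq> \<Delta>' \<and> (from_nat n \<in> \<Delta>' \<or> \<not> con T (insert (from_nat n) \<Delta>)) \<and>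
    (\<forall>x C. from_nat n \<in> \<Delta>' \<longrightarrow> from_nat n = Neg (All x C) \<longrightarrow> (\<exists>y. odd y \<and> Neg (subst x (Var y) C) \<in> \<Delta>'))"
  have "\<exists>f. \<forall>n. (finite (f n) \<and> con T (f n) \<and> (n = 0 \<longrightarrow> f n = \<Gamma>)) \<and> ?Q n (f n) (f (Suc n))"
  proof (rule dependent_nat_choice)
    show "\<exists>\<Delta>. finite \<Delta> \<and> con T \<Delta> \<and> (0 = (0::nat) \<longrightarrow> \<Delta> = \<Gamma>)" using assms by blast
  next
    fix \<Delta> and n :: nat assume "finite \<Delta> \<and> con T \<Delta> \<and> (n = 0 \<longrightarrow> \<Delta> = \<Gamma>)"
    then obtain \<Delta>' where "\<Delta> \<subseteq> \<Delta>' \<and> finite \<Delta>' \<and> con T \<Delta>' \<and>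
        (from_nat n \<in> \<Delta>' \<or> \<not> con T (insert (from_nat n) \<Delta>)) \<and>
        (\<forall>x C. from_nat n \<in> \<Delta>' \<longrightarrow> from_nat n = Neg (All x C) \<longrightarrow>
          (\<exists>y. odd y \<and> Neg (subst x (Var y) C) \<in> \<Delta>'))"
      using con_extend[of T \<Delta> "from_nat n"] by auto
    then show "\<exists>\<Delta>'. (finite \<Delta>' \<and> con T \<Delta>' \<and> (Suc n = 0 \<longrightarrow> \<Delta>' = \<Gamma>)) \<and> ?Q n \<Delta> \<Delta>'" by auto
  qed
  then obtain f where f': "\<forall>n. (finite (f n) \<and> con T (f n) \<and> (n = 0 \<longrightarrow> f n = \<Gamma>)) \<and> ?Q n (f n) (f (Suc n))"
    by (rule exE)
  have f: "finite (f n)" "con T (f n)" "f 0 = \<Gamma>" "?Q n (f n) (f (Suc n))" for n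
    using f'[THEN spec, of n] f'[THEN spec, of 0] by blast+
  have mono: "f m \<subseteq> f n" if "m \<le> n" for m n
    using that by (rule lift_Suc_mono_le[rotated]) (use f(4) in blast)
  let ?\<Delta> = "\<Union>n. f n"
  have chain: "\<exists>n. X \<subseteq> f n" if "finite X" "X \<subseteq> ?\<Delta>" for X
    using that
  proof (induction X rule: finite_induct)
    case (insert a X)
    then obtain n m where "X \<subseteq> f n" "a \<in> f m" by blast
    then show ?case using mono[of n "max n m"] mono[of m "max n m"] by (intro exI[of _ "max n m"]) auto
  qed simp
  show ?thesis
  proof
    show "\<Gamma> \<subseteq> ?\<Delta>" using f(3) by blast
    show "con T ?\<Delta>" unfolding con_def
    proof
      assume "ded T ?\<Delta> Fls"
      from ded_compact[OF this] obtain X where X: "finite X" "X \<subseteq> ?\<Delta>" "ded T X Fls" by auto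
      from chain[OF X(1,2)] obtain n where "X \<subseteq> f n" ..
      with X(3) have "ded T (f n) Fls" by (rule ded_mono)
      then show False using f(2)[of n] unfolding con_def by simp
    qed
    show "B \<in> ?\<Delta> \<or> ded T ?\<Delta> (Neg B)" for B
    proof (cases "B \<in> f (Suc (to_nat B))")
      case False
      then have "\<not> con T (insert B (f (to_nat B)))" using f(4)[of "to_nat B"] by simp
      then have "ded T (f (to_nat B)) (Neg B)" unfolding con_def by (auto intro: deduction)
      then show ?thesis by (meson UN_upper UNIV_I ded_mono)
    qed blast
    show "\<exists>y. odd y \<and> Neg (subst x (Var y) C) \<in> ?\<Delta>" if "Neg (All x C) \<in> ?\<Delta>" for x C
    proof -
      let ?B = "Neg (All x C)"
      from that have "\<exists>m. ?B \<in> f m" by blast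
      then obtain m where m: "?B \<in> f m" ..
      \<comment> \<open>\<open>?B\<close> may have entered at another stage, say as a witness
        formula. It was then also accepted at its own stage, where its witness is chosen, since a
        rejection would make a later stage inconsistent.\<close>
      have "?B \<in> f (Suc (to_nat ?B))"
      proof (rule ccontr)
        assume "?B \<notin> f (Suc (to_nat ?B))"
        then have "\<not> con T (insert ?B (f (to_nat ?B)))" using f(4)[of "to_nat ?B"] by simp
        moreover have "insert ?B (f (to_nat ?B)) \<subseteq> f (max m (to_nat ?B))"
          using m mono[of m "max m (to_nat ?B)"] mono[of "to_nat ?B" "max m (to_nat ?B)"] by auto
        ultimately show False using f(2)[of "max m (to_nat ?B)"] unfolding con_def by (meson ded_mono)
      qed
      then show ?thesis using f(4)[of "to_nat ?B"] by fastforce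
    qed
  qed
qed

lemma inst_tm_cong: "(\<And>i. i \<in> vars t \<Longrightarrow> \<sigma> i = \<tau> i) \<Longrightarrow> inst_tm \<sigma> t = inst_tm \<tau> t"
  by (induction t) auto

lemma inst_cong: "(\<And>i. i \<in> fv A \<Longrightarrow> \<sigma> i = \<tau> i) \<Longrightarrow> inst \<sigma> A = inst \<tau> A"
proof (induction A arbitrary: \<sigma> \<tau>)
  case (All x A)
  have "inst (\<sigma>(x := Var (2 * x))) A = inst (\<tau>(x := Var (2 * x))) A"
    by (rule All.IH) (use All.prems in auto)
  then show ?case by simp
next
  case (Imp A B)
  then show ?case by (metis UnCI fv.simps(4) inst.simps(4))
qed (simp_all, (metis UnCI inst_tm_cong)+)

section \<open>Universal closures\<close>

definition closure :: "fm \<Rightarrow> fm" where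
  "closure A = foldr All (sorted_list_of_set (fv A)) A"

lemma fv_closure: "fv (closure A) = {}"
proof -
  have "fv (foldr All xs A) = fv A - set xs" for xs by (induction xs) auto
  then show ?thesis by (simp add: closure_def)
qed

lemma provable_closure: "T \<turnstile> closure A \<longleftrightarrow> T \<turnstile> A"
proof -
  have "T \<turnstile> foldr All xs A \<longleftrightarrow> T \<turnstile> A" for xs
    by (induction xs) (auto intro: Gen, metis ded_empty ded_inst_same)
  then show ?thesis by (simp add: closure_def)
qed

lemma (in interp) sat_closure:
  "(\<forall>e. range e \<subseteq> U \<longrightarrow> sat e (closure A)) \<longleftrightarrow> (\<forall>e. range e \<subseteq> U \<longrightarrow> sat e A)"
proof -
  have "(\<forall>e. range e \<subseteq> U \<longrightarrow> sat e (foldr All xs A)) \<longleftrightarrow> (\<forall>e. range e \<subseteq> U \<longrightarrow> sat e A)" for xs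
  proof (induction xs)
    case (Cons x xs)
    have "(\<forall>e. range e \<subseteq> U \<longrightarrow> sat e (All x B)) \<longleftrightarrow> (\<forall>e. range e \<subseteq> U \<longrightarrow> sat e B)" for B
    proof (intro iffI allI impI)
      fix e :: "nat \<Rightarrow> 'a" assume *: "\<forall>e. range e \<subseteq> U \<longrightarrow> sat e (All x B)" "range e \<subseteq> U"
      then have "sat (e(x := e x)) B" by (metis range_subsetD sat.simps(5))
      then show "sat e B" by simp
    next
      fix e :: "nat \<Rightarrow> 'a" assume *: "\<forall>e. range e \<subseteq> U \<longrightarrow> sat e B" "range e \<subseteq> U"
      have "range (e(x := a)) \<subseteq> U" if "a \<in> U" for a
        using that *(2) by auto
      then show "sat e (All x B)" using *(1) by (simp del: fun_upd_apply)
    qed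
    with Cons show ?case by simp
  qed simp
  then show ?thesis by (simp add: closure_def)
qed

subsection \<open>The model of a Henkin set\<close>

definition odd_tm :: "tm \<Rightarrow> bool" where "odd_tm t = (\<forall>v\<in>vars t. odd v)"

text \<open>
  Formulas are doubled before the Henkin construction, so that the odd witnesses are never captured.
\<close>

lemma model_existence:
  assumes "\<not> T \<turnstile> A"
  obtains E :: "nat \<Rightarrow> nat \<Rightarrow> bool" and Z J V e where
    "Z \<in> V" "\<And>x y. x \<in> V \<Longrightarrow> y \<in> V \<Longrightarrow> J x y \<in> V" "infinite V \<Longrightarrow> V = UNIV"
    "\<And>B e. B \<in> T \<Longrightarrow> range e \<subseteq> V \<Longrightarrow> interp.sat E Z J V e B"
    "range e \<subseteq> V" "\<not> interp.sat E Z J V e A"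
proof -
  define C where "C = ren (\<lambda>i. 2 * i) (closure A)"
  have "\<not> T \<turnstile> C" using assms by (simp add: C_def provable_double provable_closure)
  then have "con T {Neg C}" unfolding con_def by (metis ded_ccontr ded_empty)
  then obtain \<Delta> where \<Delta>: "Neg C \<in> \<Delta>" "con T \<Delta>" and max: "\<And>B. B \<in> \<Delta> \<or> ded T \<Delta> (Neg B)" and
    wit: "\<And>x C. Neg (All x C) \<in> \<Delta> \<Longrightarrow> \<exists>y. odd y \<and> Neg (subst x (Var y) C) \<in> \<Delta>"
    by (rule henkin_extension) auto
  have ded: "ded T \<Delta> B \<longleftrightarrow> B \<in> \<Delta>" for B
    using \<Delta>(2) max[of B] by (metis con_def ded.hyp ded.detach)
  have neg: "Neg B \<in> \<Delta> \<longleftrightarrow> B \<notin> \<Delta>" for B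
    using \<Delta>(2) max[of B] ded by (metis con_def ded.hyp ded.detach)
  have imp: "Imp B B' \<in> \<Delta> \<longleftrightarrow> (B \<in> \<Delta> \<longrightarrow> B' \<in> \<Delta>)" for B B'
    by (metis K ded ded.detach ded.prv ded_imp_neg neg)
  have prv: "T \<turnstile> B \<Longrightarrow> B \<in> \<Delta>" for B using ded ded.prv by blast

  \<comment> \<open>The model consists of classes of odd terms modulo equality in
    \<open>\<Delta>\<close>; odd terms are enough since the witnesses are odd variables.\<close>
  define cls where "cls t = {s. odd_tm s \<and> Eq t s \<in> \<Delta>}" for t
  have eq_refl: "Eq t t \<in> \<Delta>" for t by (simp add: Refl prv)
  have cls_eq: "cls s = cls t \<longleftrightarrow> Eq s t \<in> \<Delta>" if "odd_tm s" "odd_tm t" for s t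
    unfolding cls_def using that eq_refl ded ded_eq_sym ded_eq_trans by (smt (verit) Collect_cong mem_Collect_eq)
  define D where "D = cls ` Collect odd_tm"
  have "countable D" unfolding D_def by simp
  \<comment> \<open>\<open>to_nat_on\<close> is a bijection onto \<open>nat\<close> when there are
    infinitely many classes; this makes an infinite carrier all of the type.\<close>
  define h :: "tm set \<Rightarrow> nat" where "h = to_nat_on D"
  have h: "inj_on h D" "infinite D \<Longrightarrow> h ` D = UNIV"
    using \<open>countable D\<close> by (auto simp: h_def inj_on_to_nat_on dest: bij_betw_imp_surj_on to_nat_on_infinite)
  define f where "f t = h (cls t)" for t
  define V where "V = f ` Collect odd_tm"
  have V: "V = h ` D" by (auto simp: V_def D_def f_def)
  have f_eq: "f s = f t \<longleftrightarrow> Eq s t \<in> \<Delta>" if "odd_tm s" "odd_tm t" for s t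
    using that h(1) cls_eq unfolding f_def D_def by (auto simp: inj_on_eq_iff)
  have "\<forall>n\<in>V. \<exists>t. odd_tm t \<and> f t = n" unfolding V_def by auto
  from bchoice[OF this] obtain g where g: "\<And>n. n \<in> V \<Longrightarrow> odd_tm (g n) \<and> f (g n) = n" by blast
  have gf: "Eq t (g (f t)) \<in> \<Delta>" if "odd_tm t" for t
    using that g f_eq by (metis V_def image_eqI mem_Collect_eq)
  define E where "E m n = (Mem (g m) (g n) \<in> \<Delta>)" for m n
  define J where "J m n = f (Adj (g m) (g n))" for m n
  interpret interp E "f Zero" J V .
  have odd_Adj: "odd_tm (Adj s t) \<longleftrightarrow> odd_tm s \<and> odd_tm t" "odd_tm Zero" for s t
    by (auto simp: odd_tm_def)
  have odd_inst: "odd_tm (inst_tm \<sigma> t)" if "\<And>x. odd_tm (\<sigma> x)" for \<sigma> t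
    using that by (induction t) (auto simp: odd_Adj)
  have fV: "odd_tm t \<Longrightarrow> f t \<in> V" for t by (auto simp: V_def)
  have E_f: "E (f s) (f t) \<longleftrightarrow> Mem s t \<in> \<Delta>" if "odd_tm s" "odd_tm t" for s t
  proof -
    have "Eq (g (f s)) s \<in> \<Delta>" "Eq (g (f t)) t \<in> \<Delta>"
      using gf[OF that(1)] gf[OF that(2)] ded ded_eq_sym by blast+
    then show ?thesis
      using gf[OF that(1)] gf[OF that(2)] unfolding E_def by (meson ded ded_Mem_cong)
  qed
  have J_f: "J (f s) (f t) = f (Adj s t)" if "odd_tm s" "odd_tm t" for s t
  proof -
    have "Eq (Adj s t) (Adj (g (f s)) (g (f t))) \<in> \<Delta>"
      using gf[OF that(1)] gf[OF that(2)] by (metis ded ded_Adj_cong)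
    then show ?thesis unfolding J_def using that g fV f_eq odd_Adj by metis
  qed
  have val_f: "val (\<lambda>x. f (\<sigma> x)) t = f (inst_tm \<sigma> t)" if "\<And>x. odd_tm (\<sigma> x)" for \<sigma> t
    using that by (induction t) (auto simp: J_f odd_inst)
  have truth: "sat (\<lambda>x. f (\<sigma> x)) B \<longleftrightarrow> inst \<sigma> B \<in> \<Delta>" if "\<And>x. odd_tm (\<sigma> x)" for \<sigma> B
    using that
  proof (induction B arbitrary: \<sigma>)
    case (Mem s t)
    then show ?case by (simp add: val_f E_f odd_inst)
  next
    case (Eq s t)
    then show ?case by (simp add: val_f f_eq odd_inst)
  next
    case Fls
    then show ?case using \<Delta>(2) by (auto simp: con_def ded)
  next
    case (Imp B B')
    then show ?case by (simp add: imp)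
  next
    case (All x B)
    let ?B = "inst (\<sigma>(x := Var (2 * x))) B"
    have "2 * x \<notin> vars (\<sigma> z)" for z
    proof
      assume "2 * x \<in> vars (\<sigma> z)"
      then have "odd (2 * x)" using All.prems[of z] unfolding odd_tm_def by blast
      then show False by simp
    qed
    then have sub: "subst (2 * x) t ?B = inst (\<sigma>(x := t)) B" for t
      using subst_inst[of x "\<sigma>(x := Var (2 * x))" t B] by auto
    have upd: "(\<lambda>x. f (\<sigma> x))(x := f t) = (\<lambda>y. f ((\<sigma>(x := t)) y))" for t by auto
    have "sat (\<lambda>x. f (\<sigma> x)) (All x B) \<longleftrightarrow>
        (\<forall>t. odd_tm t \<longrightarrow> sat ((\<lambda>x. f (\<sigma> x))(x := f t)) B)"
    proof -
      have "(\<forall>a\<in>V. P a) \<longleftrightarrow> (\<forall>t. odd_tm t \<longrightarrow> P (f t))" for P by (auto simp: V_def)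
      then show ?thesis by (simp only: sat.simps)
    qed
    also have "\<dots> \<longleftrightarrow> (\<forall>t. odd_tm t \<longrightarrow> inst (\<sigma>(x := t)) B \<in> \<Delta>)"
    proof -
      have "sat (\<lambda>y. f ((\<sigma>(x := t)) y)) B \<longleftrightarrow> inst (\<sigma>(x := t)) B \<in> \<Delta>" if "odd_tm t" for t
        by (rule All.IH) (use All.prems that in auto)
      then show ?thesis unfolding upd by blast
    qed
    also have "\<dots> \<longleftrightarrow> All (2 * x) ?B \<in> \<Delta>"
    proof
      assume *: "\<forall>t. odd_tm t \<longrightarrow> inst (\<sigma>(x := t)) B \<in> \<Delta>"
      show "All (2 * x) ?B \<in> \<Delta>"
      proof (rule ccontr)
        assume "All (2 * x) ?B \<notin> \<Delta>"
        \<comment> \<open>The Henkin witness is an odd term, hence among the values over which the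
          hypothesis quantifies.\<close>
        then obtain y where "odd y" "Neg (subst (2 * x) (Var y) ?B) \<in> \<Delta>" using wit neg by blast
        then show False using * sub[of "Var y"] neg by (auto simp: odd_tm_def)
      qed
    next
      assume "All (2 * x) ?B \<in> \<Delta>"
      then have "subst (2 * x) t ?B \<in> \<Delta>" if "odd_tm t" for t
        using that ded_inst[of T \<Delta> "2 * x" ?B t] free_for_inst[of t "2 * x"]
        by (simp add: ded odd_tm_def)
      then show "\<forall>t. odd_tm t \<longrightarrow> inst (\<sigma>(x := t)) B \<in> \<Delta>" using sub by simp
    qed
    finally show ?case by simp
  qed
  have cl: "sat (\<lambda>x. f (\<sigma> x)) B \<longleftrightarrow> ren (\<lambda>i. 2 * i) B \<in> \<Delta>" if "\<And>x. odd_tm (\<sigma> x)" "fv B = {}" for \<sigma> B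
  proof -
    \<comment> \<open>A sentence has the same \<open>inst\<close> under all \<open>\<sigma>\<close>.
      The one that doubles names turns it into \<open>ren\<close>, under which provability is
      invariant.\<close>
    have "inst \<sigma> B = inst (\<lambda>i. Var (2 * i)) B" by (rule inst_cong) (simp add: that(2))
    then show ?thesis using truth[OF that(1)] by (simp add: inst_double)
  qed
  have env: "\<exists>\<sigma>. (\<forall>x. odd_tm (\<sigma> x)) \<and> e = (\<lambda>x. f (\<sigma> x))" if "range e \<subseteq> V" for e
    using that g by (intro exI[of _ "g \<circ> e"]) (auto simp: fun_eq_iff image_subset_iff)
  have sat_cl: "sat e B \<longleftrightarrow> ren (\<lambda>i. 2 * i) B \<in> \<Delta>" if "range e \<subseteq> V" "fv B = {}" for e B
    using env[OF that(1)] cl that(2) by blast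
  show thesis
  proof (rule that[of "f Zero" V J E])
    show "f Zero \<in> V" "x \<in> V \<Longrightarrow> y \<in> V \<Longrightarrow> J x y \<in> V" for x y
      using fV odd_Adj g by (auto simp: J_def)
    show "V = UNIV" if "infinite V" using that h(2) V by auto
    show "sat e B" if "B \<in> T" "range e \<subseteq> V" for e B
    proof -
      have "ren (\<lambda>i. 2 * i) (closure B) \<in> \<Delta>"
        using that(1) by (intro prv) (simp add: Ax provable_closure provable_double)
      then have "\<forall>e. range e \<subseteq> V \<longrightarrow> sat e (closure B)" using sat_cl fv_closure by blast
      then show ?thesis using sat_closure that(2) by blast
    qed
    have "\<exists>e. range e \<subseteq> V \<and> \<not> sat e (closure A)"
      using sat_cl[OF _ fv_closure] \<Delta>(1) neg fV odd_Adj(2) unfolding C_def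
      by (intro exI[of _ "\<lambda>_. f Zero"]) auto
    then have ex: "\<exists>e. range e \<subseteq> V \<and> \<not> sat e A" using sat_closure[of A] by blast
    show "range (SOME e. range e \<subseteq> V \<and> \<not> sat e A) \<subseteq> V"
      "\<not> sat (SOME e. range e \<subseteq> V \<and> \<not> sat e A) A"
      using someI_ex[OF ex] by auto
  qed
qed

text \<open>A theory without finite models only has to be examined in models whose carrier is the
  whole type \<open>nat\<close>. The first premise speaks of an arbitrary carrier because it is what
  allows this identification.\<close>

theorem completeness:
  assumes "\<And>(E :: nat \<Rightarrow> nat \<Rightarrow> bool) Z J V. Z \<in> V \<Longrightarrow> (\<And>x y. x \<in> V \<Longrightarrow> y \<in> V \<Longrightarrow> J x y \<in> V) \<Longrightarrow>
      (\<And>B e. B \<in> T \<Longrightarrow> range e \<subseteq> V \<Longrightarrow> interp.sat E Z J V e B) \<Longrightarrow> infinite V"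
    and "\<And>(E :: nat \<Rightarrow> nat \<Rightarrow> bool) Z J e. (\<And>B e. B \<in> T \<Longrightarrow> interp.sat E Z J UNIV e B) \<Longrightarrow>
      interp.sat E Z J UNIV e A"
  shows "T \<turnstile> A"
proof (rule ccontr)
  assume "\<not> T \<turnstile> A"
  then obtain E :: "nat \<Rightarrow> nat \<Rightarrow> bool" and Z J V e where
    M: "Z \<in> V" "\<And>x y. x \<in> V \<Longrightarrow> y \<in> V \<Longrightarrow> J x y \<in> V" "infinite V \<Longrightarrow> V = UNIV"
      "\<And>B e. B \<in> T \<Longrightarrow> range e \<subseteq> V \<Longrightarrow> interp.sat E Z J V e B"
      "range e \<subseteq> V" "\<not> interp.sat E Z J V e A"
    by (rule model_existence) (rule that; assumption)
  then have "V = UNIV" using assms(1)[of Z V J E] by blast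
  with M assms(2)[of E Z J e] show False by auto
qed

section \<open>Reading the formulas in an interpretation\<close>

text \<open>
  A primed name denotes the reading in an interpretation of the formula or term with the same
  unprimed name, all quantifiers being restricted to \<open>U\<close>.
\<close>

definition below :: "nat \<Rightarrow> tm \<Rightarrow> bool" where
  "below d t = (\<forall>i\<in>vars t. i < d)"

lemma below_simps [simp]:
  "below d (Var i) \<longleftrightarrow> i < d" "below d Zero" "below d (Adj s t) \<longleftrightarrow> below d s \<and> below d t"
  by (auto simp: below_def)

lemma below_Suc [simp]: "below d t \<Longrightarrow> below (Suc d) t"
  by (auto simp: below_def)

lemma below_num [simp]: "below d (num k)"
  by (induction k) (simp_all add: succ_def)

lemma below_terms [simp]:
  "below d (succ s) \<longleftrightarrow> below d s"
  "below d (pr s t) \<longleftrightarrow> below d s \<and> below d t"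
  "below d (cVar s) \<longleftrightarrow> below d s"
  "below d (cFun s t) \<longleftrightarrow> below d s \<and> below d t"
  "below d (cRel s t) \<longleftrightarrow> below d s \<and> below d t"
  "below d (cEq s t) \<longleftrightarrow> below d s \<and> below d t"
  "below d cFls"
  "below d (cImp s t) \<longleftrightarrow> below d s \<and> below d t"
  "below d (cAll s t) \<longleftrightarrow> below d s \<and> below d t"
  "below d lang"
  "below d (pair_tuple s t) \<longleftrightarrow> below d s \<and> below d t"
  "below d cZero"
  "below d (cAdj s t) \<longleftrightarrow> below d s \<and> below d t"
  "below d (cMem s t) \<longleftrightarrow> below d s \<and> below d t"
  "below d (cSet s) \<longleftrightarrow> below d s"
  by (auto simp: succ_def pr_def cVar_def cFun_def cRel_def cEq_def cFls_def cImp_def cAll_def lang_def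
    pair_tuple_def cZero_def cAdj_def cMem_def cSet_def)

context interp
begin

definition succ' :: "'a \<Rightarrow> 'a" where
  "succ' t = J t t"

primrec num' :: "nat \<Rightarrow> 'a" where
  "num' 0 = Z"
| "num' (Suc k) = succ' (num' k)"

definition pr' :: "'a \<Rightarrow> 'a \<Rightarrow> 'a" where
  "pr' s t = J (J Z (J Z s)) (J (J Z s) t)"

definition subset_of' :: "'a \<Rightarrow> 'a \<Rightarrow> bool" where
  "subset_of' x y = (\<forall>z\<in>U. z \<epsilon> x \<longrightarrow> z \<epsilon> y)"

definition trans_set' :: "'a \<Rightarrow> bool" where
  "trans_set' x = (\<forall>y\<in>U. y \<epsilon> x \<longrightarrow> subset_of' y x)"

definition fin_ord' :: "'a \<Rightarrow> bool" where
  "fin_ord' n = (trans_set' n \<and> (\<forall>m\<in>U. m \<epsilon> n \<longrightarrow> trans_set' m) \<and>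
     (\<forall>m\<in>U. m \<epsilon> succ' n \<longrightarrow> m = Z \<or> (\<exists>k\<in>U. m = succ' k)))"

definition is_fun' :: "'a \<Rightarrow> bool" where
  "is_fun' f = ((\<forall>p\<in>U. p \<epsilon> f \<longrightarrow> (\<exists>x\<in>U. \<exists>y\<in>U. p = pr' x y)) \<and>
     (\<forall>x\<in>U. \<forall>y\<in>U. \<forall>z\<in>U. pr' x y \<epsilon> f \<and> pr' x z \<epsilon> f \<longrightarrow> y = z))"

definition in_dom' :: "'a \<Rightarrow> 'a \<Rightarrow> bool" where
  "in_dom' x f = (\<exists>y\<in>U. pr' x y \<epsilon> f)"

definition fun_on' :: "'a \<Rightarrow> 'a \<Rightarrow> bool" where
  "fun_on' f a = (is_fun' f \<and> (\<forall>x\<in>U. in_dom' x f \<longleftrightarrow> x \<epsilon> a))"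

definition finite_set' :: "'a \<Rightarrow> bool" where
  "finite_set' x = (\<exists>n\<in>U. \<exists>f\<in>U. fin_ord' n \<and> fun_on' f n \<and>
     (\<forall>y\<in>U. y \<epsilon> x \<longleftrightarrow> (\<exists>i\<in>U. pr' i y \<epsilon> f)) \<and>
     (\<forall>i\<in>U. \<forall>j\<in>U. \<forall>y\<in>U. pr' i y \<epsilon> f \<and> pr' j y \<epsilon> f \<longrightarrow> i = j))"

definition hered_finite' :: "'a \<Rightarrow> bool" where
  "hered_finite' x = (\<exists>t\<in>U. finite_set' t \<and> trans_set' t \<and> subset_of' x t)"

definition tuple' :: "'a \<Rightarrow> 'a \<Rightarrow> 'a \<Rightarrow> bool" where
  "tuple' a m D = (fun_on' a m \<and> (\<forall>i\<in>U. \<forall>x\<in>U. pr' i x \<epsilon> a \<longrightarrow> x \<epsilon> D))"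

definition in_V' :: "'a \<Rightarrow> 'a \<Rightarrow> bool" where
  "in_V' n x = (\<exists>f\<in>U. fun_on' f (succ' n) \<and> pr' Z Z \<epsilon> f \<and>
     (\<forall>k\<in>U. \<forall>u\<in>U. \<forall>w\<in>U. k \<epsilon> n \<and> pr' k u \<epsilon> f \<and> pr' (succ' k) w \<epsilon> f \<longrightarrow>
        (\<forall>y\<in>U. y \<epsilon> w \<longleftrightarrow> subset_of' y u)) \<and>
     (\<exists>u\<in>U. pr' n u \<epsilon> f \<and> x \<epsilon> u))"

definition cVar' :: "'a \<Rightarrow> 'a" where
  "cVar' i = pr' (num' 0) i"

definition cFun' :: "'a \<Rightarrow> 'a \<Rightarrow> 'a" where
  "cFun' f a = pr' (num' 1) (pr' f a)"

definition cRel' :: "'a \<Rightarrow> 'a \<Rightarrow> 'a" where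
  "cRel' R a = pr' (num' 2) (pr' R a)"

definition cEq' :: "'a \<Rightarrow> 'a \<Rightarrow> 'a" where
  "cEq' s t = pr' (num' 3) (pr' s t)"

definition cFls' :: "'a" where
  "cFls' = pr' (num' 4) Z"

definition cImp' :: "'a \<Rightarrow> 'a \<Rightarrow> 'a" where
  "cImp' p q = pr' (num' 5) (pr' p q)"

definition cAll' :: "'a \<Rightarrow> 'a \<Rightarrow> 'a" where
  "cAll' v p = pr' (num' 6) (pr' v p)"

abbreviation cNeg' :: "'a \<Rightarrow> 'a" where "cNeg' p \<equiv> cImp' p cFls'"

abbreviation cAnd' :: "'a \<Rightarrow> 'a \<Rightarrow> 'a" where "cAnd' p q \<equiv> cNeg' (cImp' p (cNeg' q))"

abbreviation cIff' :: "'a \<Rightarrow> 'a \<Rightarrow> 'a" where "cIff' p q \<equiv> cAnd' (cImp' p q) (cImp' q p)"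

abbreviation cEx' :: "'a \<Rightarrow> 'a \<Rightarrow> 'a" where "cEx' v p \<equiv> cNeg' (cAll' v (cNeg' p))"

definition rel_symbol' :: "'a \<Rightarrow> 'a \<Rightarrow> 'a \<Rightarrow> bool" where
  "rel_symbol' r R m = (pr' R (pr' (num' 0) m) \<epsilon> r)"

definition fun_symbol' :: "'a \<Rightarrow> 'a \<Rightarrow> 'a \<Rightarrow> bool" where
  "fun_symbol' r f m = (pr' f (pr' (num' 1) m) \<epsilon> r)"

definition signature' :: "'a \<Rightarrow> bool" where
  "signature' r = (is_fun' r \<and>
     (\<forall>p\<in>U. p \<epsilon> r \<longrightarrow> (\<exists>s\<in>U. \<exists>k\<in>U. \<exists>m\<in>U. p = pr' s (pr' k m) \<and> (k = num' 0 \<or> k = num' 1) \<and> fin_ord' m)))"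

definition is_var' :: "'a \<Rightarrow> bool" where
  "is_var' v = (\<exists>i\<in>U. fin_ord' i \<and> v = cVar' i)"

definition is_term' :: "'a \<Rightarrow> 'a \<Rightarrow> bool" where
  "is_term' r e = (\<exists>T\<in>U. e \<epsilon> T \<and> (\<forall>d\<in>U. d \<epsilon> T \<longrightarrow>
     is_var' d \<or>
     (\<exists>f\<in>U. \<exists>m\<in>U. \<exists>a\<in>U. fun_symbol' r f m \<and> tuple' a m T \<and> d = cFun' f a)))"

definition is_atomic' :: "'a \<Rightarrow> 'a \<Rightarrow> bool" where
  "is_atomic' r d =
     ((\<exists>R\<in>U. \<exists>m\<in>U. \<exists>a\<in>U. rel_symbol' r R m \<and> fun_on' a m \<and> (\<forall>i\<in>U. \<forall>t\<in>U. pr' i t \<epsilon> a \<longrightarrow> is_term' r t) \<and> d = cRel' R a) \<or>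
      (\<exists>s\<in>U. \<exists>t\<in>U. is_term' r s \<and> is_term' r t \<and> d = cEq' s t) \<or>
      d = cFls')"

definition is_formula' :: "'a \<Rightarrow> 'a \<Rightarrow> bool" where
  "is_formula' r e = (\<exists>T\<in>U. e \<epsilon> T \<and> (\<forall>d\<in>U. d \<epsilon> T \<longrightarrow>
     is_atomic' r d \<or>
     (\<exists>p\<in>U. \<exists>q\<in>U. p \<epsilon> T \<and> q \<epsilon> T \<and> d = cImp' p q) \<or>
     (\<exists>v\<in>U. \<exists>p\<in>U. is_var' v \<and> p \<epsilon> T \<and> d = cAll' v p)))"

definition imm_part' :: "'a \<Rightarrow> 'a \<Rightarrow> bool" where
  "imm_part' c d =
     ((\<exists>s\<in>U. \<exists>a\<in>U. \<exists>i\<in>U. (d = cFun' s a \<or> d = cRel' s a) \<and> pr' i c \<epsilon> a) \<or>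
      (\<exists>b\<in>U. d = cEq' c b \<or> d = cEq' b c \<or> d = cImp' c b \<or> d = cImp' b c) \<or>
      (\<exists>v\<in>U. d = cAll' v c))"

definition subexpr' :: "'a \<Rightarrow> 'a \<Rightarrow> bool" where
  "subexpr' e p = (\<exists>T\<in>U. p \<epsilon> T \<and> (\<forall>d\<in>U. d \<epsilon> T \<longrightarrow> d = e \<or> (\<exists>c\<in>U. c \<epsilon> T \<and> imm_part' c d)))"

definition free_in' :: "'a \<Rightarrow> 'a \<Rightarrow> bool" where
  "free_in' v e = (\<exists>T\<in>U. e \<epsilon> T \<and> (\<forall>d\<in>U. d \<epsilon> T \<longrightarrow>
     d = v \<or> (\<exists>c\<in>U. c \<epsilon> T \<and> imm_part' c d \<and> \<not> (\<exists>p\<in>U. d = cAll' v p))))"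

definition is_subst' :: "'a \<Rightarrow> 'a \<Rightarrow> 'a \<Rightarrow> 'a \<Rightarrow> bool" where
  "is_subst' v t e e' = (\<exists>T\<in>U. pr' e e' \<epsilon> T \<and> (\<forall>x\<in>U. x \<epsilon> T \<longrightarrow> (\<exists>c\<in>U. \<exists>c'\<in>U. x = pr' c c' \<and> (
     (c = v \<and> c' = t) \<or>
     (\<not> free_in' v c \<and> c' = c) \<or>
     (\<exists>s\<in>U. \<exists>a\<in>U. \<exists>a'\<in>U.
        ((c = cFun' s a \<and> c' = cFun' s a') \<or> (c = cRel' s a \<and> c' = cRel' s a')) \<and>
        is_fun' a \<and> is_fun' a' \<and> (\<forall>i\<in>U. in_dom' i a \<longleftrightarrow> in_dom' i a') \<and>
        (\<forall>i\<in>U. \<forall>y\<in>U. \<forall>y'\<in>U. pr' i y \<epsilon> a \<and> pr' i y' \<epsilon> a' \<longrightarrow> pr' y y' \<epsilon> T)) \<or>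
     (\<exists>p\<in>U. \<exists>p'\<in>U. \<exists>q\<in>U. \<exists>q'\<in>U.
        ((c = cEq' p q \<and> c' = cEq' p' q') \<or> (c = cImp' p q \<and> c' = cImp' p' q')) \<and>
        pr' p p' \<epsilon> T \<and> pr' q q' \<epsilon> T) \<or>
     (\<exists>w\<in>U. \<exists>p\<in>U. \<exists>p'\<in>U. c = cAll' w p \<and> c' = cAll' w p' \<and>
        \<not> w = v \<and> \<not> free_in' w t \<and> pr' p p' \<epsilon> T)))))"

definition is_structure' :: "'a \<Rightarrow> 'a \<Rightarrow> 'a \<Rightarrow> bool" where
  "is_structure' r D I = (signature' r \<and> (\<exists>x\<in>U. x \<epsilon> D) \<and>
     (\<forall>p\<in>U. p \<epsilon> I \<longrightarrow>
        (\<exists>R\<in>U. \<exists>m\<in>U. \<exists>b\<in>U. rel_symbol' r R m \<and> tuple' b m D \<and> p = pr' R b) \<or>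
        (\<exists>f\<in>U. \<exists>m\<in>U. \<exists>b\<in>U. \<exists>u\<in>U. fun_symbol' r f m \<and> tuple' b m D \<and> u \<epsilon> D \<and> p = pr' f (pr' b u))) \<and>
     (\<forall>f\<in>U. \<forall>m\<in>U. \<forall>b\<in>U. fun_symbol' r f m \<and> tuple' b m D \<longrightarrow>
        (\<exists>u\<in>U. \<forall>w\<in>U. pr' f (pr' b w) \<epsilon> I \<longleftrightarrow> w = u)))"

definition assignment' :: "'a \<Rightarrow> 'a \<Rightarrow> bool" where
  "assignment' D A = (is_fun' A \<and> finite_set' A \<and> (\<forall>v\<in>U. \<forall>x\<in>U. pr' v x \<epsilon> A \<longrightarrow> x \<epsilon> D))"

definition is_update' :: "'a \<Rightarrow> 'a \<Rightarrow> 'a \<Rightarrow> 'a \<Rightarrow> bool" where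
  "is_update' A v x B =
     (\<forall>p\<in>U. p \<epsilon> B \<longleftrightarrow> p = pr' v x \<or> (p \<epsilon> A \<and> \<not> (\<exists>y\<in>U. p = pr' v y)))"

definition eval_dom' :: "('a \<Rightarrow> bool) \<Rightarrow> 'a \<Rightarrow> 'a \<Rightarrow> 'a \<Rightarrow> bool" where
  "eval_dom' P D e A = ((\<exists>p\<in>U. P p \<and> subexpr' e p) \<and> assignment' D A \<and>
     (\<forall>v\<in>U. is_var' v \<and> free_in' v e \<longrightarrow> in_dom' v A))"

definition arg_values' :: "'a \<Rightarrow> 'a \<Rightarrow> 'a \<Rightarrow> 'a \<Rightarrow> bool" where
  "arg_values' F A a b = (is_fun' b \<and> (\<forall>i\<in>U. in_dom' i a \<longleftrightarrow> in_dom' i b) \<and>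
     (\<forall>i\<in>U. \<forall>t\<in>U. \<forall>y\<in>U. pr' i t \<epsilon> a \<and> pr' i y \<epsilon> b \<longrightarrow> pr' (pr' t A) y \<epsilon> F))"

definition evaluation' :: "('a \<Rightarrow> bool) \<Rightarrow> 'a \<Rightarrow> 'a \<Rightarrow> 'a \<Rightarrow> 'a \<Rightarrow> bool" where
  "evaluation' P r D I F =
     ((\<forall>x\<in>U. x \<epsilon> F \<longrightarrow> (\<exists>e\<in>U. \<exists>A\<in>U. \<exists>u\<in>U. x = pr' (pr' e A) u \<and> eval_dom' P D e A)) \<and>
      (\<forall>e\<in>U. \<forall>A\<in>U. eval_dom' P D e A \<longrightarrow> (\<exists>u\<in>U. \<forall>w\<in>U. pr' (pr' e A) w \<epsilon> F \<longleftrightarrow> w = u)) \<and>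
      (\<forall>e\<in>U. \<forall>A\<in>U. \<forall>u\<in>U. pr' (pr' e A) u \<epsilon> F \<longrightarrow>
         (is_var' e \<longrightarrow> pr' e u \<epsilon> A) \<and>
         (\<forall>f\<in>U. \<forall>a\<in>U. e = cFun' f a \<longrightarrow> (\<exists>b\<in>U. arg_values' F A a b \<and> pr' f (pr' b u) \<epsilon> I)) \<and>
         (is_formula' r e \<longrightarrow> u = num' 0 \<or> u = num' 1) \<and>
         (\<forall>R\<in>U. \<forall>a\<in>U. e = cRel' R a \<longrightarrow>
            (u = num' 1 \<longleftrightarrow> (\<exists>b\<in>U. arg_values' F A a b \<and> pr' R b \<epsilon> I))) \<and>
         (\<forall>s\<in>U. \<forall>t\<in>U. e = cEq' s t \<longrightarrow>
            (u = num' 1 \<longleftrightarrow> (\<exists>y\<in>U. pr' (pr' s A) y \<epsilon> F \<and> pr' (pr' t A) y \<epsilon> F))) \<and>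
         (e = cFls' \<longrightarrow> u = num' 0) \<and>
         (\<forall>p\<in>U. \<forall>q\<in>U. e = cImp' p q \<longrightarrow>
            (u = num' 1 \<longleftrightarrow> (pr' (pr' p A) (num' 1) \<epsilon> F \<longrightarrow> pr' (pr' q A) (num' 1) \<epsilon> F))) \<and>
         (\<forall>v\<in>U. \<forall>p\<in>U. e = cAll' v p \<longrightarrow>
            (u = num' 1 \<longleftrightarrow>
              (\<forall>x\<in>U. \<forall>B\<in>U. x \<epsilon> D \<and> is_update' A v x B \<longrightarrow> pr' (pr' p B) (num' 1) \<epsilon> F)))))"

definition Phi' :: "'a \<Rightarrow> 'a \<Rightarrow> 'a \<Rightarrow> bool" where
  "Phi' r n p = (is_formula' r p \<and> in_V' n p)"

definition lang' :: "'a" where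
  "lang' = J (J (J Z (pr' (num' 0) (pr' (num' 0) (num' 2))))
     (pr' (num' 1) (pr' (num' 1) (num' 0)))) (pr' (num' 2) (pr' (num' 1) (num' 2)))"

definition pair_tuple' :: "'a \<Rightarrow> 'a \<Rightarrow> 'a" where
  "pair_tuple' s t = J (J Z (pr' (num' 0) s)) (pr' (num' 1) t)"

definition cZero' :: "'a" where
  "cZero' = cFun' (num' 1) Z"

definition cAdj' :: "'a \<Rightarrow> 'a \<Rightarrow> 'a" where
  "cAdj' s t = cFun' (num' 2) (pair_tuple' s t)"

definition cMem' :: "'a \<Rightarrow> 'a \<Rightarrow> 'a" where
  "cMem' s t = cRel' (num' 0) (pair_tuple' s t)"

definition cSet' :: "'a \<Rightarrow> 'a" where
  "cSet' i = cEx' (cVar' (succ' i)) (cMem' (cVar' i) (cVar' (succ' i)))"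

definition is_predicative' :: "'a \<Rightarrow> bool" where
  "is_predicative' e = (\<exists>T\<in>U. e \<epsilon> T \<and> (\<forall>d\<in>U. d \<epsilon> T \<longrightarrow>
     is_atomic' lang' d \<or>
     (\<exists>p\<in>U. \<exists>q\<in>U. p \<epsilon> T \<and> q \<epsilon> T \<and> d = cImp' p q) \<or>
     (\<exists>i\<in>U. \<exists>p\<in>U. fin_ord' i \<and> p \<epsilon> T \<and> d = cAll' (cVar' i) (cImp' (cSet' i) p))))"

definition is_comprehension' :: "'a \<Rightarrow> bool" where
  "is_comprehension' d = (\<exists>p\<in>U. \<exists>i\<in>U. \<exists>j\<in>U. is_predicative' p \<and> fin_ord' i \<and> fin_ord' j \<and>
     \<not> i = j \<and> \<not> free_in' (cVar' j) p \<and>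
     d = cEx' (cVar' j) (cAll' (cVar' i) (cImp' (cSet' i) (cIff' (cMem' (cVar' i) (cVar' j)) p))))"

definition logical_axiom' :: "'a \<Rightarrow> 'a \<Rightarrow> bool" where
  "logical_axiom' r d =
     ((\<exists>p\<in>U. \<exists>q\<in>U. is_formula' r p \<and> is_formula' r q \<and> d = cImp' p (cImp' q p)) \<or>
      (\<exists>p\<in>U. \<exists>q\<in>U. \<exists>s\<in>U. is_formula' r p \<and> is_formula' r q \<and> is_formula' r s \<and>
         d = cImp' (cImp' p (cImp' q s)) (cImp' (cImp' p q) (cImp' p s))) \<or>
      (\<exists>p\<in>U. is_formula' r p \<and> d = cImp' (cNeg' (cNeg' p)) p) \<or>
      (\<exists>v\<in>U. \<exists>t\<in>U. \<exists>p\<in>U. \<exists>p'\<in>U. is_var' v \<and> is_term' r t \<and> is_formula' r p \<and> is_subst' v t p p' \<and>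
         d = cImp' (cAll' v p) p') \<or>
      (\<exists>v\<in>U. \<exists>p\<in>U. \<exists>q\<in>U. is_var' v \<and> is_formula' r p \<and> is_formula' r q \<and> \<not> free_in' v p \<and>
         d = cImp' (cAll' v (cImp' p q)) (cImp' p (cAll' v q))) \<or>
      (\<exists>t\<in>U. is_term' r t \<and> d = cEq' t t) \<or>
      (\<exists>v\<in>U. \<exists>s\<in>U. \<exists>t\<in>U. \<exists>p\<in>U. \<exists>p'\<in>U. \<exists>p''\<in>U. is_var' v \<and> is_term' r s \<and> is_term' r t \<and> is_formula' r p \<and>
         is_subst' v s p p' \<and> is_subst' v t p p'' \<and> d = cImp' (cEq' s t) (cImp' p' p'')))"

definition ack_less' :: "'a \<Rightarrow> 'a \<Rightarrow> bool" where
  "ack_less' x y = (\<exists>T\<in>U. pr' x y \<epsilon> T \<and> (\<forall>q\<in>U. q \<epsilon> T \<longrightarrow> (\<exists>a\<in>U. \<exists>b\<in>U. \<exists>z\<in>U. q = pr' a b \<and>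
     z \<epsilon> b \<and> \<not> z \<epsilon> a \<and> (\<forall>w\<in>U. w \<epsilon> a \<and> \<not> w \<epsilon> b \<longrightarrow> pr' w z \<epsilon> T))))"

definition canonical_name' :: "'a \<Rightarrow> 'a \<Rightarrow> bool" where
  "canonical_name' x c = (\<exists>T\<in>U. pr' x c \<epsilon> T \<and> (\<forall>q\<in>U. q \<epsilon> T \<longrightarrow>
     q = pr' Z cZero' \<or>
     (\<exists>y\<in>U. \<exists>z\<in>U. \<exists>s\<in>U. \<exists>t\<in>U. q = pr' (J y z) (cAdj' s t) \<and>
        \<not> z \<epsilon> y \<and> (\<forall>w\<in>U. w \<epsilon> y \<longrightarrow> ack_less' w z) \<and> pr' y s \<epsilon> T \<and> pr' z t \<epsilon> T)))"

section \<open>Truth of the bold formulas\<close>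

lemma val_upd [simp]: "below d t \<Longrightarrow> val (e(d := a)) t = val e t"
  by (rule val_cong) (auto simp: below_def)

lemma sat_bold [simp]:
  "sat e ((s \<^bold>\<in> t) d) \<longleftrightarrow> val e s \<epsilon> val e t"
  "sat e ((s \<^bold>= t) d) \<longleftrightarrow> val e s = val e t"
  "sat e ((\<^bold>\<not> b) d) \<longleftrightarrow> \<not> sat e (b d)"
  "sat e ((b \<^bold>\<and> c) d) \<longleftrightarrow> sat e (b d) \<and> sat e (c d)"
  "sat e ((b \<^bold>\<or> c) d) \<longleftrightarrow> sat e (b d) \<or> sat e (c d)"
  "sat e ((b \<^bold>\<longrightarrow> c) d) \<longleftrightarrow> (sat e (b d) \<longrightarrow> sat e (c d))"
  "sat e ((b \<^bold>\<longleftrightarrow> c) d) \<longleftrightarrow> (sat e (b d) \<longleftrightarrow> sat e (c d))"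
  "sat e (ball f d) \<longleftrightarrow> (\<forall>a\<in>U. sat (e(d := a)) (f (Var d) (Suc d)))"
  "sat e (bex f d) \<longleftrightarrow> (\<exists>a\<in>U. sat (e(d := a)) (f (Var d) (Suc d)))"
  by (auto simp: bmem_def beq_def bneg_def band_def bor_def bimp_def biff_def ball_def bex_def)

lemma val_num [simp]: "val e (num k) = num' k"
  by (induction k) (simp_all add: succ_def succ'_def)

lemma val_terms [simp]:
  "val e (succ s) = succ' (val e s)"
  "val e (pr s t) = pr' (val e s) (val e t)"
  "val e (cVar s) = cVar' (val e s)"
  "val e (cFun s t) = cFun' (val e s) (val e t)"
  "val e (cRel s t) = cRel' (val e s) (val e t)"
  "val e (cEq s t) = cEq' (val e s) (val e t)"
  "val e cFls = cFls'"
  "val e (cImp s t) = cImp' (val e s) (val e t)"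
  "val e (cAll s t) = cAll' (val e s) (val e t)"
  "val e lang = lang'"
  "val e (pair_tuple s t) = pair_tuple' (val e s) (val e t)"
  "val e cZero = cZero'"
  "val e (cAdj s t) = cAdj' (val e s) (val e t)"
  "val e (cMem s t) = cMem' (val e s) (val e t)"
  "val e (cSet s) = cSet' (val e s)"
  by (simp_all add: succ_def succ'_def pr_def pr'_def cVar_def cVar'_def cFun_def cFun'_def cRel_def cRel'_def
    cEq_def cEq'_def cFls_def cFls'_def cImp_def cImp'_def cAll_def cAll'_def lang_def lang'_def
    pair_tuple_def pair_tuple'_def cZero_def cZero'_def cAdj_def cAdj'_def cMem_def cMem'_def
    cSet_def cSet'_def del: num.simps num'.simps)
lemma sat_subset_of [simp]: "below d s \<Longrightarrow> below d t \<Longrightarrow>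
    sat e (subset_of s t d) \<longleftrightarrow> subset_of' (val e s) (val e t)"
  by (simp add: subset_of_def subset_of'_def)

lemma sat_trans_set [simp]: "below d s \<Longrightarrow>
    sat e (trans_set s d) \<longleftrightarrow> trans_set' (val e s)"
  by (simp add: trans_set_def trans_set'_def)

lemma sat_fin_ord [simp]: "below d s \<Longrightarrow>
    sat e (fin_ord s d) \<longleftrightarrow> fin_ord' (val e s)"
  by (simp add: fin_ord_def fin_ord'_def)

lemma sat_is_fun [simp]: "below d s \<Longrightarrow>
    sat e (is_fun s d) \<longleftrightarrow> is_fun' (val e s)"
  by (simp add: is_fun_def is_fun'_def)

lemma sat_in_dom [simp]: "below d s \<Longrightarrow> below d t \<Longrightarrow>
    sat e (in_dom s t d) \<longleftrightarrow> in_dom' (val e s) (val e t)"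
  by (simp add: in_dom_def in_dom'_def)

lemma sat_fun_on [simp]: "below d s \<Longrightarrow> below d t \<Longrightarrow>
    sat e (fun_on s t d) \<longleftrightarrow> fun_on' (val e s) (val e t)"
  by (simp add: fun_on_def fun_on'_def)

lemma sat_finite_set [simp]: "below d s \<Longrightarrow>
    sat e (finite_set s d) \<longleftrightarrow> finite_set' (val e s)"
  by (simp add: finite_set_def finite_set'_def)

lemma sat_hered_finite [simp]: "below d s \<Longrightarrow>
    sat e (hered_finite s d) \<longleftrightarrow> hered_finite' (val e s)"
  by (simp add: hered_finite_def hered_finite'_def)

lemma sat_tuple [simp]: "below d s \<Longrightarrow> below d t \<Longrightarrow> below d u \<Longrightarrow>
    sat e (tuple s t u d) \<longleftrightarrow> tuple' (val e s) (val e t) (val e u)"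
  by (simp add: tuple_def tuple'_def)

lemma sat_in_V [simp]: "below d s \<Longrightarrow> below d t \<Longrightarrow>
    sat e (in_V s t d) \<longleftrightarrow> in_V' (val e s) (val e t)"
  by (simp add: in_V_def in_V'_def)

lemma sat_rel_symbol [simp]: "below d s \<Longrightarrow> below d t \<Longrightarrow> below d u \<Longrightarrow>
    sat e (rel_symbol s t u d) \<longleftrightarrow> rel_symbol' (val e s) (val e t) (val e u)"
  by (simp add: rel_symbol_def rel_symbol'_def)

lemma sat_fun_symbol [simp]: "below d s \<Longrightarrow> below d t \<Longrightarrow> below d u \<Longrightarrow>
    sat e (fun_symbol s t u d) \<longleftrightarrow> fun_symbol' (val e s) (val e t) (val e u)"
  by (simp add: fun_symbol_def fun_symbol'_def)

lemma sat_signature [simp]: "below d s \<Longrightarrow>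
    sat e (signature s d) \<longleftrightarrow> signature' (val e s)"
  by (simp add: signature_def signature'_def)

lemma sat_is_var [simp]: "below d s \<Longrightarrow>
    sat e (is_var s d) \<longleftrightarrow> is_var' (val e s)"
  by (simp add: is_var_def is_var'_def)

lemma sat_is_term [simp]: "below d s \<Longrightarrow> below d t \<Longrightarrow>
    sat e (is_term s t d) \<longleftrightarrow> is_term' (val e s) (val e t)"
  by (simp add: is_term_def is_term'_def)

lemma sat_is_atomic [simp]: "below d s \<Longrightarrow> below d t \<Longrightarrow>
    sat e (is_atomic s t d) \<longleftrightarrow> is_atomic' (val e s) (val e t)"
  by (simp add: is_atomic_def is_atomic'_def)

lemma sat_is_formula [simp]: "below d s \<Longrightarrow> below d t \<Longrightarrow>
    sat e (is_formula s t d) \<longleftrightarrow> is_formula' (val e s) (val e t)"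
  by (simp add: is_formula_def is_formula'_def)

lemma sat_imm_part [simp]: "below d s \<Longrightarrow> below d t \<Longrightarrow>
    sat e (imm_part s t d) \<longleftrightarrow> imm_part' (val e s) (val e t)"
  by (simp add: imm_part_def imm_part'_def)

lemma sat_subexpr [simp]: "below d s \<Longrightarrow> below d t \<Longrightarrow>
    sat e (subexpr s t d) \<longleftrightarrow> subexpr' (val e s) (val e t)"
  by (simp add: subexpr_def subexpr'_def)

lemma sat_free_in [simp]: "below d s \<Longrightarrow> below d t \<Longrightarrow>
    sat e (free_in s t d) \<longleftrightarrow> free_in' (val e s) (val e t)"
  by (simp add: free_in_def free_in'_def)

lemma sat_is_subst [simp]: "below d s \<Longrightarrow> below d t \<Longrightarrow> below d u \<Longrightarrow> below d v \<Longrightarrow>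
    sat e (is_subst s t u v d) \<longleftrightarrow> is_subst' (val e s) (val e t) (val e u) (val e v)"
  by (simp add: is_subst_def is_subst'_def)

lemma sat_is_structure [simp]: "below d s \<Longrightarrow> below d t \<Longrightarrow> below d u \<Longrightarrow>
    sat e (is_structure s t u d) \<longleftrightarrow> is_structure' (val e s) (val e t) (val e u)"
  by (simp add: is_structure_def is_structure'_def)

lemma sat_assignment [simp]: "below d s \<Longrightarrow> below d t \<Longrightarrow>
    sat e (assignment s t d) \<longleftrightarrow> assignment' (val e s) (val e t)"
  by (simp add: assignment_def assignment'_def)

lemma sat_is_update [simp]: "below d s \<Longrightarrow> below d t \<Longrightarrow> below d u \<Longrightarrow> below d v \<Longrightarrow>
    sat e (is_update s t u v d) \<longleftrightarrow> is_update' (val e s) (val e t) (val e u) (val e v)"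
  by (simp add: is_update_def is_update'_def)

lemma sat_arg_values [simp]: "below d s \<Longrightarrow> below d t \<Longrightarrow> below d u \<Longrightarrow> below d v \<Longrightarrow>
    sat e (arg_values s t u v d) \<longleftrightarrow> arg_values' (val e s) (val e t) (val e u) (val e v)"
  by (simp add: arg_values_def arg_values'_def)

lemma sat_Phi [simp]: "below d s \<Longrightarrow> below d t \<Longrightarrow> below d u \<Longrightarrow>
    sat e (Phi s t u d) \<longleftrightarrow> Phi' (val e s) (val e t) (val e u)"
  by (simp add: Phi_def Phi'_def)

lemma sat_is_predicative [simp]: "below d s \<Longrightarrow>
    sat e (is_predicative s d) \<longleftrightarrow> is_predicative' (val e s)"
  by (simp add: is_predicative_def is_predicative'_def)

lemma sat_is_comprehension [simp]: "below d s \<Longrightarrow>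
    sat e (is_comprehension s d) \<longleftrightarrow> is_comprehension' (val e s)"
  by (simp add: is_comprehension_def is_comprehension'_def)

lemma sat_logical_axiom [simp]: "below d s \<Longrightarrow> below d t \<Longrightarrow>
    sat e (logical_axiom s t d) \<longleftrightarrow> logical_axiom' (val e s) (val e t)"
  by (simp add: logical_axiom_def logical_axiom'_def)

lemma sat_ack_less [simp]: "below d s \<Longrightarrow> below d t \<Longrightarrow>
    sat e (ack_less s t d) \<longleftrightarrow> ack_less' (val e s) (val e t)"
  by (simp add: ack_less_def ack_less'_def)

lemma sat_canonical_name [simp]: "below d s \<Longrightarrow> below d t \<Longrightarrow>
    sat e (canonical_name s t d) \<longleftrightarrow> canonical_name' (val e s) (val e t)"
  by (simp add: canonical_name_def canonical_name'_def)

end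

lemma sat_SetF: "interp.sat E Z J V e (SetF x) \<longleftrightarrow> (\<exists>y\<in>V. E (e x) y)"
  by (simp add: interp.sat.simps interp.val.simps SetF_def)

text \<open>This is why the carrier is kept apart from the type: with a smaller carrier the same
  interpretation quantifies over sets while free variables still denote classes. A general
  \<open>V\<close> is allowed for use before the carrier is known to be everything.\<close>

lemma sat_relativize_carrier:
  "interp.sat E Z J V e (relativize A) \<longleftrightarrow> interp.sat E Z J {x \<in> V. \<exists>y\<in>V. E x y} e A"
proof (induction A arbitrary: e)
  case (All x A)
  then show ?case by (auto simp: interp.sat.simps sat_SetF fun_upd_same simp del: fun_upd_apply)
qed (simp_all add: interp.sat.simps)

lemma sat_relativize:
  "interp.sat E Z J UNIV e (relativize A) \<longleftrightarrow> interp.sat E Z J {x. \<exists>y. E x y} e A"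
  by (simp add: sat_relativize_carrier)

lemma fv_relativize [simp]: "fv (relativize A) = fv A"
  by (induction A) (auto simp: SetF_def)

section \<open>Definability\<close>

context interp
begin

text \<open>
  Definability with parameters of relations on environments. Every element of the model serves as
  a parameter: it is the value of a fixed variable with odd name. In a definable relation the
  variables may be replaced by terms \<open>\<tau>\<close>, which makes the notion closed under substitution; a
  quantifier binds the variable \<open>0\<close> and shifts the others.
\<close>

definition good :: "(nat \<Rightarrow> 'a) \<Rightarrow> bool" where
  "good e = (\<forall>c. e (2 * to_nat c + 1) = c)"

text \<open>Finite dependence leaves room for binders: only finitely many of the terms
  \<open>\<tau> i\<close> matter, so there is a name beyond all their variables.\<close>

definition supp :: "nat \<Rightarrow> ((nat \<Rightarrow> 'a) \<Rightarrow> 'b) \<Rightarrow> bool" where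
  "supp n P = (\<forall>e e'. (\<forall>i<n. e i = e' i) \<longrightarrow> P e = P e')"

definition Df :: "((nat \<Rightarrow> 'a) \<Rightarrow> bool) \<Rightarrow> bool" where
  "Df P = ((\<exists>n. supp n P) \<and> (\<forall>\<tau>. \<exists>A. \<forall>e. good e \<longrightarrow> sat e A = P (\<lambda>i. val e (\<tau> i))))"

definition Tm :: "((nat \<Rightarrow> 'a) \<Rightarrow> 'a) \<Rightarrow> bool" where
  "Tm t = ((\<exists>n. supp n t) \<and> (\<forall>\<tau>. \<exists>u. \<forall>e. good e \<longrightarrow> val e u = t (\<lambda>i. val e (\<tau> i))))"

named_theorems Df_intros

lemma good_upd: "good e \<Longrightarrow> even k \<Longrightarrow> good (e(k := x))"
  by (auto simp: good_def)

lemma ex_good: "\<exists>e. good e \<and> e 0 = x"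
proof -
  let ?e = "(\<lambda>i. from_nat (i div 2))(0 := x) :: nat \<Rightarrow> 'a"
  have "good ?e" by (simp add: good_def)
  then show ?thesis by (intro exI[of _ ?e]) simp
qed

lemma supp_mono: "supp n P \<Longrightarrow> n \<le> m \<Longrightarrow> supp m P"
  by (auto simp: supp_def)

lemma supp_comb:
  assumes "supp n P" "supp m Q"
  shows "supp (n + m) (\<lambda>e. R (P e) (Q e))"
proof -
  have "supp (n + m) P" "supp (n + m) Q" using assms by (auto intro: supp_mono)
  then show ?thesis unfolding supp_def by metis
qed

lemma Tm_var [Df_intros]: "Tm (\<lambda>e. e i)"
  unfolding Tm_def supp_def by blast

lemma Tm_const [Df_intros]: "Tm (\<lambda>e. c)"
proof -
  have "\<forall>e. good e \<longrightarrow> val e (Var (2 * to_nat c + 1)) = c" by (simp add: good_def)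
  then show ?thesis unfolding Tm_def supp_def by blast
qed

lemma Tm_J [Df_intros]:
  assumes "Tm s" "Tm t" shows "Tm (\<lambda>e. J (s e) (t e))"
  unfolding Tm_def
proof
  show "\<exists>n. supp n (\<lambda>e. J (s e) (t e))" 
  proof -
    obtain n m where "supp n s" "supp m t" using assms unfolding Tm_def by auto
    from supp_comb[OF this, of J] show ?thesis by (rule exI)
  qed
  show "\<forall>\<tau>. \<exists>u. \<forall>e. good e \<longrightarrow> val e u = J (s (\<lambda>i. val e (\<tau> i))) (t (\<lambda>i. val e (\<tau> i)))"
  proof
    fix \<tau>
    obtain u v where "\<forall>e. good e \<longrightarrow> val e u = s (\<lambda>i. val e (\<tau> i))" "\<forall>e. good e \<longrightarrow> val e v = t (\<lambda>i. val e (\<tau> i))"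
      using assms unfolding Tm_def by meson
    then show "\<exists>u. \<forall>e. good e \<longrightarrow> val e u = J (s (\<lambda>i. val e (\<tau> i))) (t (\<lambda>i. val e (\<tau> i)))"
      by (intro exI[of _ "Adj u v"]) simp
  qed
qed

lemma Df_term_rel:
  assumes "Tm s" "Tm t" "\<And>u v e. sat e (F u v) = R (val e u) (val e v)"
  shows "Df (\<lambda>e. R (s e) (t e))"
  unfolding Df_def
proof
  show "\<exists>n. supp n (\<lambda>e. R (s e) (t e))" 
  proof -
    obtain n m where "supp n s" "supp m t" using assms unfolding Tm_def by auto
    from supp_comb[OF this, of R] show ?thesis by (rule exI)
  qed
  show "\<forall>\<tau>. \<exists>A. \<forall>e. good e \<longrightarrow> sat e A = R (s (\<lambda>i. val e (\<tau> i))) (t (\<lambda>i. val e (\<tau> i)))"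
  proof
    fix \<tau>
    obtain u v where "\<forall>e. good e \<longrightarrow> val e u = s (\<lambda>i. val e (\<tau> i))" "\<forall>e. good e \<longrightarrow> val e v = t (\<lambda>i. val e (\<tau> i))"
      using assms(1,2) unfolding Tm_def by meson
    then show "\<exists>A. \<forall>e. good e \<longrightarrow> sat e A = R (s (\<lambda>i. val e (\<tau> i))) (t (\<lambda>i. val e (\<tau> i)))"
      using assms(3) by (intro exI[of _ "F u v"]) simp
  qed
qed

lemma Df_mem [Df_intros]: "Tm s \<Longrightarrow> Tm t \<Longrightarrow> Df (\<lambda>e. s e \<epsilon> t e)"
  by (rule Df_term_rel[where F = Mem]) simp_all

lemma Df_eq [Df_intros]: "Tm s \<Longrightarrow> Tm t \<Longrightarrow> Df (\<lambda>e. s e = t e)"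
  by (rule Df_term_rel[where F = Eq]) simp_all

lemma Df_const [Df_intros]: "Df (\<lambda>e. b)"
proof -
  have "\<exists>A. \<forall>e. good e \<longrightarrow> sat e A = b"
    by (cases b) (auto intro: exI[of _ Fls] exI[of _ "Imp Fls Fls"])
  then show ?thesis unfolding Df_def supp_def by blast
qed

lemma Df_imp [Df_intros]:
  assumes "Df P" "Df Q" shows "Df (\<lambda>e. P e \<longrightarrow> Q e)"
  unfolding Df_def
proof
  show "\<exists>n. supp n (\<lambda>e. P e \<longrightarrow> Q e)" 
  proof -
    obtain n m where "supp n P" "supp m Q" using assms unfolding Df_def by auto
    from supp_comb[OF this, of "(\<longrightarrow>)"] show ?thesis by (rule exI)
  qed
  show "\<forall>\<tau>. \<exists>A. \<forall>e. good e \<longrightarrow> sat e A = (P (\<lambda>i. val e (\<tau> i)) \<longrightarrow> Q (\<lambda>i. val e (\<tau> i)))"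
  proof
    fix \<tau>
    obtain A B where "\<forall>e. good e \<longrightarrow> sat e A = P (\<lambda>i. val e (\<tau> i))" "\<forall>e. good e \<longrightarrow> sat e B = Q (\<lambda>i. val e (\<tau> i))"
      using assms[unfolded Df_def, THEN conjunct2, THEN spec, of \<tau>] by (elim exE)
    then show "\<exists>A. \<forall>e. good e \<longrightarrow> sat e A = (P (\<lambda>i. val e (\<tau> i)) \<longrightarrow> Q (\<lambda>i. val e (\<tau> i)))"
      by (intro exI[of _ "Imp A B"]) simp
  qed
qed

lemma Df_not [Df_intros]: "Df P \<Longrightarrow> Df (\<lambda>e. \<not> P e)"
  using Df_imp[of P "\<lambda>_. False"] Df_const by simp

lemma Df_disj [Df_intros]: "Df P \<Longrightarrow> Df Q \<Longrightarrow> Df (\<lambda>e. P e \<or> Q e)"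
  using Df_imp[of "\<lambda>e. \<not> P e" Q] Df_not by (simp add: disj_imp)

lemma Df_conj [Df_intros]: "Df P \<Longrightarrow> Df Q \<Longrightarrow> Df (\<lambda>e. P e \<and> Q e)"
  using Df_not[OF Df_imp[OF _ Df_not], of P Q] by simp

lemma Df_iff [Df_intros]: "Df P \<Longrightarrow> Df Q \<Longrightarrow> Df (\<lambda>e. P e \<longleftrightarrow> Q e)"
  using Df_conj[OF Df_imp Df_imp, of P Q Q P] by (simp add: iff_conv_conj_imp)

lemma Df_ball [Df_intros]:
  assumes "Df (\<lambda>e. Q (e 0) (\<lambda>i. e (Suc i)))"
  shows "Df (\<lambda>e. \<forall>x\<in>U. Q x e)"
proof -
  let ?R = "\<lambda>e. Q (e 0) (\<lambda>i. e (Suc i))"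
  obtain n where n: "supp n ?R" using assms unfolding Df_def by blast
  have "supp n (\<lambda>e. \<forall>x\<in>U. Q x e)" unfolding supp_def
  proof (intro allI impI ball_cong refl)
    fix e e' :: "nat \<Rightarrow> 'a" and x assume "\<forall>i<n. e i = e' i"
    then have "?R (case_nat x e) = ?R (case_nat x e')"
      by (intro n[unfolded supp_def, rule_format]) (auto split: nat.split)
    then show "Q x e = Q x e'" by simp
  qed
  moreover have "\<exists>A. \<forall>e. good e \<longrightarrow> sat e A = (\<forall>x\<in>U. Q x (\<lambda>i. val e (\<tau> i)))" for \<tau>
  proof -
    obtain K where K: "\<forall>i<n. \<forall>v\<in>vars (\<tau> i). v < K"
    proof -
      have "finite (\<Union>i<n. vars (\<tau> i))" by simp
      then obtain K where "\<forall>v\<in>(\<Union>i<n. vars (\<tau> i)). v < K" unfolding finite_nat_set_iff_bounded by blast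
      then show thesis using that[of K] by simp
    qed
    obtain A where A: "\<forall>e. good e \<longrightarrow> sat e A = ?R (\<lambda>i. val e (case_nat (Var (2 * K)) \<tau> i))"
      using assms unfolding Df_def by blast
    \<comment> \<open>\<open>2 * K\<close> is beyond the variables of the terms that matter, and
      being even it does not disturb the parameters.\<close>
    have "sat e (All (2 * K) A) = (\<forall>x\<in>U. Q x (\<lambda>i. val e (\<tau> i)))" if "good e" for e
    proof -
      have "sat (e(2 * K := x)) A = Q x (\<lambda>i. val e (\<tau> i))" for x
      proof -
        let ?e = "e(2 * K := x)"
        have "sat ?e A = ?R (\<lambda>i. val ?e (case_nat (Var (2 * K)) \<tau> i))"
          using A good_upd[OF that] by simp
        also have "\<dots> = ?R (case_nat x (\<lambda>i. val e (\<tau> i)))"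
        proof (intro n[unfolded supp_def, rule_format])
          fix i assume "i < n"
          show "val ?e (case_nat (Var (2 * K)) \<tau> i) = case_nat x (\<lambda>i. val e (\<tau> i)) i"
          proof (cases i)
            case (Suc j)
            then have "v \<noteq> 2 * K" if "v \<in> vars (\<tau> j)" for v
              using K that \<open>i < n\<close> by (metis Suc_lessD le_eq_less_or_eq mult_2 not_less trans_le_add1)
            then show ?thesis using Suc by (simp, intro val_cong) auto
          qed simp
        qed
        finally show ?thesis by simp
      qed
      then show ?thesis by (simp del: fun_upd_apply)
    qed
    then show ?thesis by blast
  qed
  ultimately show ?thesis unfolding Df_def by blast
qed

lemma Df_bex [Df_intros]: "Df (\<lambda>e. Q (e 0) (\<lambda>i. e (Suc i))) \<Longrightarrow> Df (\<lambda>e. \<exists>x\<in>U. Q x e)"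
  using Df_not[OF Df_ball[OF Df_not], of Q] by simp

lemma Df_all: "U = UNIV \<Longrightarrow> Df (\<lambda>e. Q (e 0) (\<lambda>i. e (Suc i))) \<Longrightarrow> Df (\<lambda>e. \<forall>x. Q x e)"
  using Df_ball[of Q] by simp

lemma Df_ex: "U = UNIV \<Longrightarrow> Df (\<lambda>e. Q (e 0) (\<lambda>i. e (Suc i))) \<Longrightarrow> Df (\<lambda>e. \<exists>x. Q x e)"
  using Df_bex[of Q] by simp

text \<open>\<open>S\<close> is a finite set of the metalogic; this covers the disjunction over the
  listed axioms in \<open>C_axiom'\<close>.\<close>

lemma Df_bex_finite [Df_intros]: "finite S \<Longrightarrow> (\<And>A. A \<in> S \<Longrightarrow> Df (\<lambda>e. P A e)) \<Longrightarrow> Df (\<lambda>e. \<exists>A\<in>S. P A e)"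
  by (induction S rule: finite_induct) (auto intro: Df_const Df_disj)

text \<open>Holds because \<open>Df\<close> allows any \<open>\<tau>\<close>: the terms that
  represent the \<open>a i\<close> are taken as the new \<open>\<tau>\<close>.\<close>

lemma Df_subst:
  assumes "Df P" "\<And>i. Tm (a i)"
  shows "Df (\<lambda>e. P (\<lambda>i. a i e))"
proof -
  obtain n where n: "supp n P" using assms unfolding Df_def by blast
  have "\<exists>m. \<forall>i<k. supp m (a i)" for k
  proof (induction k)
    case (Suc k)
    then obtain m m' where "\<forall>i<k. supp m (a i)" "supp m' (a k)" using assms unfolding Tm_def by blast
    then have "\<forall>i<Suc k. supp (m + m') (a i)"
      by (metis le_add1 le_add2 less_antisym supp_mono)
    then show ?case ..
  qed simp
  then obtain m where m: "\<forall>i<n. supp m (a i)" by blast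
  have "supp m (\<lambda>e. P (\<lambda>i. a i e))" unfolding supp_def
    by (intro allI impI n[unfolded supp_def, rule_format]) (use m in \<open>auto simp: supp_def\<close>)
  moreover have "\<exists>A. \<forall>e. good e \<longrightarrow> sat e A = P (\<lambda>i. a i (\<lambda>i. val e (\<tau> i)))" for \<tau>
  proof -
    have "\<forall>i. \<exists>u. \<forall>e. good e \<longrightarrow> val e u = a i (\<lambda>i. val e (\<tau> i))"
      using assms(2) unfolding Tm_def by blast
    then obtain u where u: "\<And>i e. good e \<Longrightarrow> val e (u i) = a i (\<lambda>i. val e (\<tau> i))" by metis
    obtain A where "\<forall>e. good e \<longrightarrow> sat e A = P (\<lambda>i. val e (u i))"
      using assms(1) unfolding Df_def by blast
    then show ?thesis using u by (intro exI[of _ A]) simp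
  qed
  ultimately show ?thesis unfolding Df_def by blast
qed

lemma Df_subst5:
  assumes "Df (\<lambda>e. P (e 0) (e (Suc 0)) (e (Suc (Suc 0))) (e (Suc (Suc (Suc 0)))) (e (Suc (Suc (Suc (Suc 0))))))"
    "Tm a" "Tm b" "Tm c" "Tm d" "Tm f"
  shows "Df (\<lambda>e. P (a e) (b e) (c e) (d e) (f e))"
proof -
  have "Tm ((case_nat a (case_nat b (case_nat c (case_nat d (\<lambda>_. f))))) i)" for i
    using assms by (auto split: nat.split)
  with Df_subst[OF assms(1), of "case_nat a (case_nat b (case_nat c (case_nat d (\<lambda>_. f))))"]
  show ?thesis by simp
qed

text \<open>Smaller arities fill the remaining places with a dummy variable. Each notion below can
  thus be unfolded once, with variables as arguments, and then used with arbitrary terms.\<close>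

lemmas Df_subst4 = Df_subst5[where P = "\<lambda>s t u v w. P s t u v" and f = "\<lambda>e. e 0" for P, OF _ _ _ _ _ Tm_var]
lemmas Df_subst3 = Df_subst4[where P = "\<lambda>s t u v. P s t u" and d = "\<lambda>e. e 0" for P, OF _ _ _ _ Tm_var]
lemmas Df_subst2 = Df_subst3[where P = "\<lambda>s t u. P s t" and c = "\<lambda>e. e 0" for P, OF _ _ _ Tm_var]
lemmas Df_subst1 = Df_subst2[where P = "\<lambda>s t. P s" and b = "\<lambda>e. e 0" for P, OF _ _ Tm_var]

section \<open>Definability of the set-theoretic and syntactic notions\<close>

lemma Tm_succ [Df_intros]: "Tm s \<Longrightarrow> Tm (\<lambda>e. succ' (s e))"
  unfolding succ'_def by (intro Df_intros)

lemma Tm_pr [Df_intros]: "Tm s \<Longrightarrow> Tm t \<Longrightarrow> Tm (\<lambda>e. pr' (s e) (t e))"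
  unfolding pr'_def by (intro Df_intros)

lemma Tm_cVar [Df_intros]: "Tm s \<Longrightarrow> Tm (\<lambda>e. cVar' (s e))"
  unfolding cVar'_def by (intro Df_intros)

lemma Tm_cFun [Df_intros]: "Tm s \<Longrightarrow> Tm t \<Longrightarrow> Tm (\<lambda>e. cFun' (s e) (t e))"
  unfolding cFun'_def by (intro Df_intros)

lemma Tm_cRel [Df_intros]: "Tm s \<Longrightarrow> Tm t \<Longrightarrow> Tm (\<lambda>e. cRel' (s e) (t e))"
  unfolding cRel'_def by (intro Df_intros)

lemma Tm_cEq [Df_intros]: "Tm s \<Longrightarrow> Tm t \<Longrightarrow> Tm (\<lambda>e. cEq' (s e) (t e))"
  unfolding cEq'_def by (intro Df_intros)

lemma Tm_cImp [Df_intros]: "Tm s \<Longrightarrow> Tm t \<Longrightarrow> Tm (\<lambda>e. cImp' (s e) (t e))"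
  unfolding cImp'_def by (intro Df_intros)

lemma Tm_cAll [Df_intros]: "Tm s \<Longrightarrow> Tm t \<Longrightarrow> Tm (\<lambda>e. cAll' (s e) (t e))"
  unfolding cAll'_def by (intro Df_intros)

lemma Tm_pair_tuple [Df_intros]: "Tm s \<Longrightarrow> Tm t \<Longrightarrow> Tm (\<lambda>e. pair_tuple' (s e) (t e))"
  unfolding pair_tuple'_def by (intro Df_intros)

lemma Tm_cAdj [Df_intros]: "Tm s \<Longrightarrow> Tm t \<Longrightarrow> Tm (\<lambda>e. cAdj' (s e) (t e))"
  unfolding cAdj'_def by (intro Df_intros)

lemma Tm_cMem [Df_intros]: "Tm s \<Longrightarrow> Tm t \<Longrightarrow> Tm (\<lambda>e. cMem' (s e) (t e))"
  unfolding cMem'_def by (intro Df_intros)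

lemma Tm_cSet [Df_intros]: "Tm s \<Longrightarrow> Tm (\<lambda>e. cSet' (s e))"
  unfolding cSet'_def by (intro Df_intros)

lemma Df_subset_of [Df_intros]: "Tm s \<Longrightarrow> Tm t \<Longrightarrow> Df (\<lambda>e. subset_of' (s e) (t e))"
  by (rule Df_subst2[where P = subset_of'], unfold subset_of'_def) (intro Df_intros)+

lemma Df_trans_set [Df_intros]: "Tm s \<Longrightarrow> Df (\<lambda>e. trans_set' (s e))"
  by (rule Df_subst1[where P = trans_set'], unfold trans_set'_def) (intro Df_intros)+

lemma Df_fin_ord [Df_intros]: "Tm s \<Longrightarrow> Df (\<lambda>e. fin_ord' (s e))"
  by (rule Df_subst1[where P = fin_ord'], unfold fin_ord'_def) (intro Df_intros)+

lemma Df_is_fun [Df_intros]: "Tm s \<Longrightarrow> Df (\<lambda>e. is_fun' (s e))"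
  by (rule Df_subst1[where P = is_fun'], unfold is_fun'_def) (intro Df_intros)+

lemma Df_in_dom [Df_intros]: "Tm s \<Longrightarrow> Tm t \<Longrightarrow> Df (\<lambda>e. in_dom' (s e) (t e))"
  by (rule Df_subst2[where P = in_dom'], unfold in_dom'_def) (intro Df_intros)+

lemma Df_fun_on [Df_intros]: "Tm s \<Longrightarrow> Tm t \<Longrightarrow> Df (\<lambda>e. fun_on' (s e) (t e))"
  by (rule Df_subst2[where P = fun_on'], unfold fun_on'_def) (intro Df_intros)+

lemma Df_finite_set [Df_intros]: "Tm s \<Longrightarrow> Df (\<lambda>e. finite_set' (s e))"
  by (rule Df_subst1[where P = finite_set'], unfold finite_set'_def) (intro Df_intros)+

lemma Df_tuple [Df_intros]: "Tm s \<Longrightarrow> Tm t \<Longrightarrow> Tm u \<Longrightarrow> Df (\<lambda>e. tuple' (s e) (t e) (u e))"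
  by (rule Df_subst3[where P = tuple'], unfold tuple'_def) (intro Df_intros)+

lemma Df_in_V [Df_intros]: "Tm s \<Longrightarrow> Tm t \<Longrightarrow> Df (\<lambda>e. in_V' (s e) (t e))"
  by (rule Df_subst2[where P = in_V'], unfold in_V'_def) (intro Df_intros)+

lemma Df_rel_symbol [Df_intros]: "Tm s \<Longrightarrow> Tm t \<Longrightarrow> Tm u \<Longrightarrow> Df (\<lambda>e. rel_symbol' (s e) (t e) (u e))"
  by (rule Df_subst3[where P = rel_symbol'], unfold rel_symbol'_def) (intro Df_intros)+

lemma Df_fun_symbol [Df_intros]: "Tm s \<Longrightarrow> Tm t \<Longrightarrow> Tm u \<Longrightarrow> Df (\<lambda>e. fun_symbol' (s e) (t e) (u e))"
  by (rule Df_subst3[where P = fun_symbol'], unfold fun_symbol'_def) (intro Df_intros)+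

lemma Df_is_var [Df_intros]: "Tm s \<Longrightarrow> Df (\<lambda>e. is_var' (s e))"
  by (rule Df_subst1[where P = is_var'], unfold is_var'_def) (intro Df_intros)+

lemma Df_is_term [Df_intros]: "Tm s \<Longrightarrow> Tm t \<Longrightarrow> Df (\<lambda>e. is_term' (s e) (t e))"
  by (rule Df_subst2[where P = is_term'], unfold is_term'_def) (intro Df_intros)+

lemma Df_is_atomic [Df_intros]: "Tm s \<Longrightarrow> Tm t \<Longrightarrow> Df (\<lambda>e. is_atomic' (s e) (t e))"
  by (rule Df_subst2[where P = is_atomic'], unfold is_atomic'_def) (intro Df_intros)+

lemma Df_is_formula [Df_intros]: "Tm s \<Longrightarrow> Tm t \<Longrightarrow> Df (\<lambda>e. is_formula' (s e) (t e))"
  by (rule Df_subst2[where P = is_formula'], unfold is_formula'_def) (intro Df_intros)+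

lemma Df_imm_part [Df_intros]: "Tm s \<Longrightarrow> Tm t \<Longrightarrow> Df (\<lambda>e. imm_part' (s e) (t e))"
  by (rule Df_subst2[where P = imm_part'], unfold imm_part'_def) (intro Df_intros)+

lemma Df_subexpr [Df_intros]: "Tm s \<Longrightarrow> Tm t \<Longrightarrow> Df (\<lambda>e. subexpr' (s e) (t e))"
  by (rule Df_subst2[where P = subexpr'], unfold subexpr'_def) (intro Df_intros)+

lemma Df_free_in [Df_intros]: "Tm s \<Longrightarrow> Tm t \<Longrightarrow> Df (\<lambda>e. free_in' (s e) (t e))"
  by (rule Df_subst2[where P = free_in'], unfold free_in'_def) (intro Df_intros)+

lemma Df_is_subst [Df_intros]: "Tm s \<Longrightarrow> Tm t \<Longrightarrow> Tm u \<Longrightarrow> Tm v \<Longrightarrow> Df (\<lambda>e. is_subst' (s e) (t e) (u e) (v e))"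
  by (rule Df_subst4[where P = is_subst'], unfold is_subst'_def) (intro Df_intros)+

lemma Df_assignment [Df_intros]: "Tm s \<Longrightarrow> Tm t \<Longrightarrow> Df (\<lambda>e. assignment' (s e) (t e))"
  by (rule Df_subst2[where P = assignment'], unfold assignment'_def) (intro Df_intros)+

lemma Df_is_update [Df_intros]: "Tm s \<Longrightarrow> Tm t \<Longrightarrow> Tm u \<Longrightarrow> Tm v \<Longrightarrow> Df (\<lambda>e. is_update' (s e) (t e) (u e) (v e))"
  by (rule Df_subst4[where P = is_update'], unfold is_update'_def) (intro Df_intros)+

lemma Df_arg_values [Df_intros]: "Tm s \<Longrightarrow> Tm t \<Longrightarrow> Tm u \<Longrightarrow> Tm v \<Longrightarrow> Df (\<lambda>e. arg_values' (s e) (t e) (u e) (v e))"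
  by (rule Df_subst4[where P = arg_values'], unfold arg_values'_def) (intro Df_intros)+

lemma Df_Phi [Df_intros]: "Tm s \<Longrightarrow> Tm t \<Longrightarrow> Tm u \<Longrightarrow> Df (\<lambda>e. Phi' (s e) (t e) (u e))"
  by (rule Df_subst3[where P = Phi'], unfold Phi'_def) (intro Df_intros)+

lemma Df_is_predicative [Df_intros]: "Tm s \<Longrightarrow> Df (\<lambda>e. is_predicative' (s e))"
  by (rule Df_subst1[where P = is_predicative'], unfold is_predicative'_def) (intro Df_intros)+

lemma Df_is_comprehension [Df_intros]: "Tm s \<Longrightarrow> Df (\<lambda>e. is_comprehension' (s e))"
  by (rule Df_subst1[where P = is_comprehension'], unfold is_comprehension'_def) (intro Df_intros)+

lemma Df_logical_axiom [Df_intros]: "Tm s \<Longrightarrow> Tm t \<Longrightarrow> Df (\<lambda>e. logical_axiom' (s e) (t e))"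
  by (rule Df_subst2[where P = logical_axiom'], unfold logical_axiom'_def) (intro Df_intros)+

lemma Df_ack_less [Df_intros]: "Tm s \<Longrightarrow> Tm t \<Longrightarrow> Df (\<lambda>e. ack_less' (s e) (t e))"
  by (rule Df_subst2[where P = ack_less'], unfold ack_less'_def) (intro Df_intros)+

lemma Df_canonical_name [Df_intros]: "Tm s \<Longrightarrow> Tm t \<Longrightarrow> Df (\<lambda>e. canonical_name' (s e) (t e))"
  by (rule Df_subst2[where P = canonical_name'], unfold canonical_name'_def) (intro Df_intros)+

end

section \<open>Elementary facts common to both theories\<close>

text \<open>In class theory \<open>ext\<close>, \<open>mem_Z\<close> and the first argument of
  \<open>J\<close> in \<open>mem_J\<close> concern classes as well; only the element that is
  adjoined has to lie in \<open>U\<close>.\<close>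

locale set_interp = interp +
  assumes Z_U [simp]: "Z \<in> U"
    and J_U [simp]: "x \<in> U \<Longrightarrow> y \<in> U \<Longrightarrow> J x y \<in> U"
    and mem_U: "z \<epsilon> x \<Longrightarrow> z \<in> U"
    and ext: "(\<And>z. z \<epsilon> x \<longleftrightarrow> z \<epsilon> y) \<Longrightarrow> x = y"
    and mem_Z [simp]: "\<not> z \<epsilon> Z"
    and mem_J [simp]: "y \<in> U \<Longrightarrow> z \<epsilon> J x y \<longleftrightarrow> z \<epsilon> x \<or> z = y"
    and foundation: "x \<in> U \<Longrightarrow> y \<epsilon> x \<Longrightarrow> \<exists>y. y \<epsilon> x \<and> \<not> (\<exists>z. z \<epsilon> x \<and> z \<epsilon> y)"
begin

lemma not_mem_self: "x \<in> U \<Longrightarrow> \<not> x \<epsilon> x"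
  using foundation[of "J Z x" x] by auto

lemma succ'_U [simp]: "x \<in> U \<Longrightarrow> succ' x \<in> U"
  by (simp add: succ'_def)

lemma mem_succ' [simp]: "x \<in> U \<Longrightarrow> z \<epsilon> succ' x \<longleftrightarrow> z \<epsilon> x \<or> z = x"
  by (simp add: succ'_def)

lemma succ'_neq_Z [simp]: "x \<in> U \<Longrightarrow> succ' x \<noteq> Z"
  by (metis mem_Z mem_succ')

lemma num'_U [simp]: "num' k \<in> U"
  by (induction k) simp_all

lemma mem_num': "i < j \<Longrightarrow> num' i \<epsilon> num' j"
  by (induction j) (auto simp: less_Suc_eq)

lemma num'_eq [simp]: "num' i = num' j \<longleftrightarrow> i = j"
  by (metis linorder_neqE_nat mem_num' not_mem_self num'_U)

lemma pr'_U [simp]: "x \<in> U \<Longrightarrow> y \<in> U \<Longrightarrow> pr' x y \<in> U"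
  by (simp add: pr'_def)

lemma pr'_eq [simp]:
  assumes U: "x \<in> U" "y \<in> U" "x' \<in> U" "y' \<in> U"
  shows "pr' x y = pr' x' y' \<longleftrightarrow> x = x' \<and> y = y'"
proof
  assume eq: "pr' x y = pr' x' y'"
  have mem: "z \<epsilon> pr' a b \<longleftrightarrow> z = J Z a \<or> z = J (J Z a) b" if "a \<in> U" "b \<in> U" for z a b
    using that by (simp add: pr'_def)
  have x: "x = x'"
  proof -
    have "J Z x = J Z x' \<or> J Z x = J (J Z x') y'" using mem[of x y "J Z x"] mem[of x' y' "J Z x"] U eq by simp
    then have "x' \<epsilon> J Z x" using U by (metis Z_U mem_J J_U)
    then show ?thesis using U by simp
  qed
  have "J (J Z x) y = J Z x \<or> J (J Z x) y = J (J Z x) y'"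
    using mem[of x y "J (J Z x) y"] mem[of x' y' "J (J Z x) y"] U eq x by simp
  moreover have "J (J Z x) y' = J Z x \<or> J (J Z x) y' = J (J Z x) y"
    using mem[of x y "J (J Z x) y'"] mem[of x' y' "J (J Z x) y'"] U eq x by simp
  moreover have "y \<epsilon> J (J Z x) y" "y' \<epsilon> J (J Z x) y'" "\<And>z. z \<epsilon> J Z x \<longleftrightarrow> z = x"
    "\<And>z. z \<epsilon> J (J Z x) y' \<longleftrightarrow> z = x \<or> z = y'" "\<And>z. z \<epsilon> J (J Z x) y \<longleftrightarrow> z = x \<or> z = y"
    using U by auto
  ultimately have "y = y'" by metis
  with x show "x = x' \<and> y = y'" ..
qed simp

lemmas code_defs = cVar'_def cFun'_def cRel'_def cEq'_def cFls'_def cImp'_def cAll'_def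

lemma code_U [simp]:
  "x \<in> U \<Longrightarrow> cVar' x \<in> U" "x \<in> U \<Longrightarrow> y \<in> U \<Longrightarrow> cFun' x y \<in> U" "x \<in> U \<Longrightarrow> y \<in> U \<Longrightarrow> cRel' x y \<in> U"
  "x \<in> U \<Longrightarrow> y \<in> U \<Longrightarrow> cEq' x y \<in> U" "cFls' \<in> U" "x \<in> U \<Longrightarrow> y \<in> U \<Longrightarrow> cImp' x y \<in> U"
  "x \<in> U \<Longrightarrow> y \<in> U \<Longrightarrow> cAll' x y \<in> U"
  by (simp_all add: code_defs del: num'.simps)

lemma code_eq [simp]:
  assumes [simp]: "x \<in> U" "y \<in> U" "x' \<in> U" "y' \<in> U"
  shows "cVar' x = cVar' x' \<longleftrightarrow> x = x'" "cVar' x \<noteq> cFun' x' y'" "cVar' x \<noteq> cRel' x' y'"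
    "cVar' x \<noteq> cEq' x' y'" "cVar' x \<noteq> cFls'" "cVar' x \<noteq> cImp' x' y'" "cVar' x \<noteq> cAll' x' y'"
    "cFun' x y \<noteq> cVar' x'" "cFun' x y = cFun' x' y' \<longleftrightarrow> x = x' \<and> y = y'" "cFun' x y \<noteq> cRel' x' y'"
    "cFun' x y \<noteq> cEq' x' y'" "cFun' x y \<noteq> cFls'" "cFun' x y \<noteq> cImp' x' y'" "cFun' x y \<noteq> cAll' x' y'"
    "cRel' x y \<noteq> cVar' x'" "cRel' x y \<noteq> cFun' x' y'" "cRel' x y = cRel' x' y' \<longleftrightarrow> x = x' \<and> y = y'"
    "cRel' x y \<noteq> cEq' x' y'" "cRel' x y \<noteq> cFls'" "cRel' x y \<noteq> cImp' x' y'" "cRel' x y \<noteq> cAll' x' y'"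
    "cEq' x y \<noteq> cVar' x'" "cEq' x y \<noteq> cFun' x' y'" "cEq' x y \<noteq> cRel' x' y'"
    "cEq' x y = cEq' x' y' \<longleftrightarrow> x = x' \<and> y = y'" "cEq' x y \<noteq> cFls'" "cEq' x y \<noteq> cImp' x' y'"
    "cEq' x y \<noteq> cAll' x' y'" "cFls' \<noteq> cVar' x'" "cFls' \<noteq> cFun' x' y'" "cFls' \<noteq> cRel' x' y'"
    "cFls' \<noteq> cEq' x' y'" "cFls' \<noteq> cImp' x' y'" "cFls' \<noteq> cAll' x' y'"
    "cImp' x y \<noteq> cVar' x'" "cImp' x y \<noteq> cFun' x' y'" "cImp' x y \<noteq> cRel' x' y'"
    "cImp' x y \<noteq> cEq' x' y'" "cImp' x y \<noteq> cFls'" "cImp' x y = cImp' x' y' \<longleftrightarrow> x = x' \<and> y = y'"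
    "cImp' x y \<noteq> cAll' x' y'" "cAll' x y \<noteq> cVar' x'" "cAll' x y \<noteq> cFun' x' y'" "cAll' x y \<noteq> cRel' x' y'"
    "cAll' x y \<noteq> cEq' x' y'" "cAll' x y \<noteq> cFls'" "cAll' x y \<noteq> cImp' x' y'"
    "cAll' x y = cAll' x' y' \<longleftrightarrow> x = x' \<and> y = y'"
  by (simp_all add: code_defs del: num'.simps)

declare num'.simps [simp del]

end

section \<open>Satisfaction relations in class theory\<close>

text \<open>
  The induction on \<open>n\<close> takes terms along with formulas and covers all expressions in \<open>V\<^sub>n\<close>; it
  also has to know that \<open>V\<^sub>n\<close> is transitive.
\<close>

definition V_seq :: "tm \<Rightarrow> tm \<Rightarrow> fb" where
  "V_seq n f = (fun_on f (succ n) \<^bold>\<and> pr Zero Zero \<^bold>\<in> f \<^bold>\<and>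
     (\<^bold>\<forall>k. \<^bold>\<forall>u. \<^bold>\<forall>w. k \<^bold>\<in> n \<^bold>\<and> pr k u \<^bold>\<in> f \<^bold>\<and> pr (succ k) w \<^bold>\<in> f \<^bold>\<longrightarrow>
        (\<^bold>\<forall>y. y \<^bold>\<in> w \<^bold>\<longleftrightarrow> y \<^bold>\<subseteq> u)))"

text \<open>Universal over the sequences, so it asserts neither existence nor uniqueness of
  \<open>V\<^sub>n\<close>. As \<open>in_V\<close> is existential, a stage without a sequence simply
  has no expressions.\<close>

definition V_trans :: "tm \<Rightarrow> fb" where
  "V_trans n = (\<^bold>\<forall>f. \<^bold>\<forall>u. V_seq n f \<^bold>\<and> pr n u \<^bold>\<in> f \<^bold>\<longrightarrow> trans_set u)"

definition V_expr :: "tm \<Rightarrow> tm \<Rightarrow> tm \<Rightarrow> fb" where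
  "V_expr r n p = ((is_term r p \<^bold>\<or> is_formula r p) \<^bold>\<and> in_V n p)"

definition evaluations_exist :: "tm \<Rightarrow> tm \<Rightarrow> fb" where
  "evaluations_exist r n = (\<^bold>\<forall>D. \<^bold>\<forall>I. sets_only (is_structure r D I) \<^bold>\<longrightarrow>
     (\<^bold>\<exists>F. sets_only (evaluation (V_expr r n) r D I F)))"

context interp
begin

definition V_seq' :: "'a \<Rightarrow> 'a \<Rightarrow> bool" where
  "V_seq' n f = (fun_on' f (succ' n) \<and> pr' Z Z \<epsilon> f \<and>
     (\<forall>k\<in>U. \<forall>u\<in>U. \<forall>w\<in>U. k \<epsilon> n \<and> pr' k u \<epsilon> f \<and> pr' (succ' k) w \<epsilon> f \<longrightarrow>
        (\<forall>y\<in>U. y \<epsilon> w \<longleftrightarrow> subset_of' y u)))"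

definition V_trans' :: "'a \<Rightarrow> bool" where
  "V_trans' n = (\<forall>f\<in>U. \<forall>u\<in>U. V_seq' n f \<and> pr' n u \<epsilon> f \<longrightarrow> trans_set' u)"

definition V_expr' :: "'a \<Rightarrow> 'a \<Rightarrow> 'a \<Rightarrow> bool" where
  "V_expr' r n p = ((is_term' r p \<or> is_formula' r p) \<and> in_V' n p)"

lemma in_V'_alt: "in_V' n x \<longleftrightarrow> (\<exists>f\<in>U. V_seq' n f \<and> (\<exists>u\<in>U. pr' n u \<epsilon> f \<and> x \<epsilon> u))"
  unfolding in_V'_def V_seq'_def by blast

lemma sat_V_seq [simp]: "below d n \<Longrightarrow> below d f \<Longrightarrow> sat e (V_seq n f d) \<longleftrightarrow> V_seq' (val e n) (val e f)"
  by (simp add: V_seq_def V_seq'_def)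

lemma sat_V_trans [simp]: "below d n \<Longrightarrow> sat e (V_trans n d) \<longleftrightarrow> V_trans' (val e n)"
  by (simp add: V_trans_def V_trans'_def)

lemma sat_V_expr [simp]:
  "below d r \<Longrightarrow> below d n \<Longrightarrow> below d p \<Longrightarrow> sat e (V_expr r n p d) \<longleftrightarrow> V_expr' (val e r) (val e n) (val e p)"
  by (simp add: V_expr_def V_expr'_def)

lemma Df_V_expr [Df_intros]: "Tm r \<Longrightarrow> Tm n \<Longrightarrow> Tm p \<Longrightarrow> Df (\<lambda>e. V_expr' (r e) (n e) (p e))"
  by (rule Df_subst3[where P = V_expr'], unfold V_expr'_def) (intro Df_intros)+

lemma sat_eval_dom:
  assumes "below d r" "below d n" "below d D" "below d x" "below d A"
  shows "sat e (eval_dom (V_expr r n) D x A d) \<longleftrightarrow>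
      eval_dom' (V_expr' (val e r) (val e n)) (val e D) (val e x) (val e A)"
    and "sat e (eval_dom (Phi r n) D x A d) \<longleftrightarrow>
      eval_dom' (Phi' (val e r) (val e n)) (val e D) (val e x) (val e A)"
  using assms by (simp_all add: eval_dom_def eval_dom'_def)

lemma sat_evaluation:
  assumes "below d r" "below d n" "below d D" "below d I" "below d F"
  shows "sat e (evaluation (V_expr r n) r D I F d) \<longleftrightarrow>
      evaluation' (V_expr' (val e r) (val e n)) (val e r) (val e D) (val e I) (val e F)"
    and "sat e (evaluation (Phi r n) r D I F d) \<longleftrightarrow>
      evaluation' (Phi' (val e r) (val e n)) (val e r) (val e D) (val e I) (val e F)"
  using assms by (simp_all add: evaluation_def evaluation'_def sat_eval_dom)

lemma Df_eval_dom [Df_intros]: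
  assumes "Df (\<lambda>e. P (e 0))" "Tm D" "Tm x" "Tm A"
  shows "Df (\<lambda>e. eval_dom' P (D e) (x e) (A e))"
proof (rule Df_subst3[where P = "eval_dom' P", OF _ assms(2-4)])
  have P: "Tm a \<Longrightarrow> Df (\<lambda>e. P (a e))" for a by (rule Df_subst1[where P = P, OF assms(1)])
  show "Df (\<lambda>e. eval_dom' P (e 0) (e (Suc 0)) (e (Suc (Suc 0))))"
    unfolding eval_dom'_def by (intro Df_intros P)
qed

text \<open>Tarski's clauses at a single triple, detached from \<open>evaluation'\<close> so that
  their \<open>F\<close> can be the evaluation of an earlier stage.\<close>

definition clauses :: "'a \<Rightarrow> 'a \<Rightarrow> 'a \<Rightarrow> 'a \<Rightarrow> 'a \<Rightarrow> 'a \<Rightarrow> 'a \<Rightarrow> bool" where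
  "clauses r D I F e A u =
     ((is_var' e \<longrightarrow> pr' e u \<epsilon> A) \<and>
      (\<forall>f\<in>U. \<forall>a\<in>U. e = cFun' f a \<longrightarrow> (\<exists>b\<in>U. arg_values' F A a b \<and> pr' f (pr' b u) \<epsilon> I)) \<and>
      (is_formula' r e \<longrightarrow> u = num' 0 \<or> u = num' 1) \<and>
      (\<forall>R\<in>U. \<forall>a\<in>U. e = cRel' R a \<longrightarrow>
         (u = num' 1 \<longleftrightarrow> (\<exists>b\<in>U. arg_values' F A a b \<and> pr' R b \<epsilon> I))) \<and>
      (\<forall>s\<in>U. \<forall>t\<in>U. e = cEq' s t \<longrightarrow>
         (u = num' 1 \<longleftrightarrow> (\<exists>y\<in>U. pr' (pr' s A) y \<epsilon> F \<and> pr' (pr' t A) y \<epsilon> F))) \<and>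
      (e = cFls' \<longrightarrow> u = num' 0) \<and>
      (\<forall>p\<in>U. \<forall>q\<in>U. e = cImp' p q \<longrightarrow>
         (u = num' 1 \<longleftrightarrow> (pr' (pr' p A) (num' 1) \<epsilon> F \<longrightarrow> pr' (pr' q A) (num' 1) \<epsilon> F))) \<and>
      (\<forall>v\<in>U. \<forall>p\<in>U. e = cAll' v p \<longrightarrow>
         (u = num' 1 \<longleftrightarrow>
           (\<forall>x\<in>U. \<forall>B\<in>U. x \<epsilon> D \<and> is_update' A v x B \<longrightarrow> pr' (pr' p B) (num' 1) \<epsilon> F))))"

lemma evaluation'_alt:
  "evaluation' P r D I F \<longleftrightarrow>
     (\<forall>x\<in>U. x \<epsilon> F \<longrightarrow> (\<exists>e\<in>U. \<exists>A\<in>U. \<exists>u\<in>U. x = pr' (pr' e A) u \<and> eval_dom' P D e A)) \<and>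
     (\<forall>e\<in>U. \<forall>A\<in>U. eval_dom' P D e A \<longrightarrow> (\<exists>u\<in>U. \<forall>w\<in>U. pr' (pr' e A) w \<epsilon> F \<longleftrightarrow> w = u)) \<and>
     (\<forall>e\<in>U. \<forall>A\<in>U. \<forall>u\<in>U. pr' (pr' e A) u \<epsilon> F \<longrightarrow> clauses r D I F e A u)"
  unfolding evaluation'_def clauses_def by (rule refl)

lemma Df_clauses [Df_intros]:
  assumes "Tm x" "Tm A" "Tm u"
  shows "Df (\<lambda>e. clauses r D I F (x e) (A e) (u e))"
  by (rule Df_subst3[where P = "clauses r D I F", OF _ assms], unfold clauses_def) (intro Df_intros)

end

text \<open>The quantifiers of definable relations range over \<open>U\<close> here, while every
  class may serve as a parameter; so \<open>comprehension\<close> is the predicative scheme.\<close>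

locale class_interp = set_interp +
  assumes U_def: "U = {x. \<exists>y. x \<epsilon> y}"
    and J_class: "y \<notin> U \<Longrightarrow> J x y = x"
    and class_replacement: "(\<And>x y z. x \<in> U \<Longrightarrow> y \<in> U \<Longrightarrow> z \<in> U \<Longrightarrow> pr' x y \<epsilon> F \<Longrightarrow> pr' x z \<epsilon> F \<Longrightarrow> y = z) \<Longrightarrow>
      a \<in> U \<Longrightarrow> \<exists>b\<in>U. \<forall>y\<in>U. y \<epsilon> b \<longleftrightarrow> (\<exists>x\<in>U. x \<epsilon> a \<and> pr' x y \<epsilon> F)"
    and comprehension: "Df (\<lambda>e. Q (e 0)) \<Longrightarrow> \<exists>X. \<forall>x\<in>U. x \<epsilon> X \<longleftrightarrow> Q x"
begin

text \<open>Class replacement along the identity function on the class of all \<open>y\<close> with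
  \<open>Q y\<close>.\<close>

lemma class_separation:
  assumes "Df (\<lambda>e. Q (e 0))" "a \<in> U"
  shows "\<exists>b\<in>U. \<forall>y\<in>U. y \<epsilon> b \<longleftrightarrow> y \<epsilon> a \<and> Q y"
proof -
  have Q: "Tm t \<Longrightarrow> Df (\<lambda>e. Q (t e))" for t by (rule Df_subst1[OF assms(1)])
  have "Df (\<lambda>e. \<exists>y\<in>U. e 0 = pr' y y \<and> Q y)" by (intro Df_intros Q)
  from comprehension[OF this] obtain F where F: "\<And>x. x \<in> U \<Longrightarrow> x \<epsilon> F \<longleftrightarrow> (\<exists>y\<in>U. x = pr' y y \<and> Q y)" by blast
  have "\<exists>b\<in>U. \<forall>y\<in>U. y \<epsilon> b \<longleftrightarrow> (\<exists>x\<in>U. x \<epsilon> a \<and> pr' x y \<epsilon> F)"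
    by (rule class_replacement) (use F assms(2) in auto)
  then show ?thesis using F by auto
qed

section \<open>Subexpressions and their ranks\<close>

lemma subexpr'_refl: "e \<in> U \<Longrightarrow> subexpr' e e"
  unfolding subexpr'_def by (intro bexI[of _ "J Z e"]) auto

lemma subexpr'_part: "e \<in> U \<Longrightarrow> c \<in> U \<Longrightarrow> p \<in> U \<Longrightarrow> subexpr' e p \<Longrightarrow> imm_part' c e \<Longrightarrow> subexpr' c p"
  unfolding subexpr'_def by (elim bexE, rule_tac x = "J T c" in bexI) auto

text \<open>The set \<open>T\<close> in \<open>subexpr'\<close> is followed downwards from
  \<open>p\<close>, so unless \<open>e = p\<close> it also serves for some immediate part of
  \<open>p\<close>. \<open>subexpr'_part\<close> extends such a set at the other end.\<close>

lemma subexpr'_cases: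
  assumes "e \<in> U" "p \<in> U" "subexpr' e p"
  shows "e = p \<or> (\<exists>q\<in>U. imm_part' q p \<and> subexpr' e q)"
  using assms unfolding subexpr'_def by blast

lemma free_in'_arg:
  assumes "v \<in> U" "t \<in> U" "f \<in> U" "a \<in> U" "free_in' v t" "imm_part' t (cFun' f a)"
  shows "free_in' v (cFun' f a)"
  using assms unfolding free_in'_def
  by (elim bexE, rule_tac x = "J T (cFun' f a)" in bexI) auto

lemma imm_part'_Fun: "f \<in> U \<Longrightarrow> a \<in> U \<Longrightarrow> c \<in> U \<Longrightarrow> imm_part' c (cFun' f a) \<longleftrightarrow> (\<exists>i\<in>U. pr' i c \<epsilon> a)"
  by (auto simp: imm_part'_def)

text \<open>The clauses at \<open>e\<close> look up \<open>F\<close> only at immediate parts of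
  \<open>e\<close>, though possibly under other assignments. This locality is what permits a
  definition stage by stage.\<close>

lemma clauses_cong:
  assumes "e \<in> U" "A \<in> U" "u \<in> U"
    and "\<And>c B w. c \<in> U \<Longrightarrow> imm_part' c e \<Longrightarrow> B \<in> U \<Longrightarrow> w \<in> U \<Longrightarrow> pr' (pr' c B) w \<epsilon> F \<longleftrightarrow> pr' (pr' c B) w \<epsilon> G"
  shows "clauses r D I F e A u \<longleftrightarrow> clauses r D I G e A u"
proof -
  have "arg_values' F A a b \<longleftrightarrow> arg_values' G A a b"
    if "s \<in> U" "a \<in> U" "b \<in> U" "e = cFun' s a \<or> e = cRel' s a" for s a b
  proof -
    have "imm_part' t e" if "i \<in> U" "t \<in> U" "pr' i t \<epsilon> a" for i t
      using that \<open>e = _ \<or> _\<close> \<open>s \<in> U\<close> \<open>a \<in> U\<close> unfolding imm_part'_def by blast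
    then have "pr' (pr' t A) y \<epsilon> F \<longleftrightarrow> pr' (pr' t A) y \<epsilon> G"
      if "i \<in> U" "t \<in> U" "y \<in> U" "pr' i t \<epsilon> a" for i t y
      using that assms by blast
    then show ?thesis unfolding arg_values'_def by blast
  qed
  moreover have "imm_part' c e" if "b \<in> U" "c \<in> U" "e = cEq' c b \<or> e = cEq' b c \<or> e = cImp' c b \<or> e = cImp' b c \<or> e = cAll' b c" for b c
    using that unfolding imm_part'_def by blast
  then have "pr' (pr' c B) w \<epsilon> F \<longleftrightarrow> pr' (pr' c B) w \<epsilon> G"
    if "B \<in> U" "w \<in> U" "b \<in> U" "c \<in> U" "e = cEq' c b \<or> e = cEq' b c \<or> e = cImp' c b \<or> e = cImp' b c \<or> e = cAll' b c" for b c B w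
    using that assms(4) by blast
  ultimately show ?thesis
    unfolding clauses_def using assms(1-3)
    by (intro conj_cong ball_cong imp_cong refl) (simp_all cong: bex_cong ball_cong)
qed

lemma is_term'_cases:
  assumes "is_term' r e"
  obtains "is_var' e"
  | f m a where "f \<in> U" "m \<in> U" "a \<in> U" "fun_symbol' r f m" "fun_on' a m" "e = cFun' f a"
    "\<And>i t. i \<in> U \<Longrightarrow> t \<in> U \<Longrightarrow> pr' i t \<epsilon> a \<Longrightarrow> is_term' r t"
proof -
  obtain T where T: "T \<in> U" "e \<epsilon> T" "\<And>d. d \<in> U \<Longrightarrow> d \<epsilon> T \<Longrightarrow> is_var' d \<or> (\<exists>f\<in>U. \<exists>m\<in>U. \<exists>a\<in>U. fun_symbol' r f m \<and> tuple' a m T \<and> d = cFun' f a)"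
    using assms unfolding is_term'_def by blast
  consider "is_var' e" | f m a where "f \<in> U" "m \<in> U" "a \<in> U" "fun_symbol' r f m" "tuple' a m T" "e = cFun' f a"
    using T mem_U by blast
  then show thesis
  proof cases
    case 2
    have "is_term' r t" if "i \<in> U" "t \<in> U" "pr' i t \<epsilon> a" for i t
      using 2 that T unfolding tuple'_def is_term'_def by blast
    with 2 that(2) show thesis unfolding tuple'_def by blast
  qed (rule that(1))
qed

lemma is_formula'_cases:
  assumes "is_formula' r e"
  obtains R m a where "R \<in> U" "m \<in> U" "a \<in> U" "e = cRel' R a"
      "\<And>i t. i \<in> U \<Longrightarrow> t \<in> U \<Longrightarrow> pr' i t \<epsilon> a \<Longrightarrow> is_term' r t"
  | s t where "s \<in> U" "t \<in> U" "is_term' r s" "is_term' r t" "e = cEq' s t"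
  | "e = cFls'"
  | p q where "p \<in> U" "q \<in> U" "is_formula' r p" "is_formula' r q" "e = cImp' p q"
  | v p where "v \<in> U" "p \<in> U" "is_formula' r p" "e = cAll' v p"
proof -
  obtain T where T: "T \<in> U" "e \<epsilon> T" "\<And>d. d \<in> U \<Longrightarrow> d \<epsilon> T \<Longrightarrow> is_atomic' r d \<or>
     (\<exists>p\<in>U. \<exists>q\<in>U. p \<epsilon> T \<and> q \<epsilon> T \<and> d = cImp' p q) \<or> (\<exists>v\<in>U. \<exists>p\<in>U. is_var' v \<and> p \<epsilon> T \<and> d = cAll' v p)"
    using assms unfolding is_formula'_def by blast
  have sub: "p \<epsilon> T \<Longrightarrow> is_formula' r p" for p using T unfolding is_formula'_def by blast
  consider "is_atomic' r e" | p q where "p \<in> U" "q \<in> U" "p \<epsilon> T" "q \<epsilon> T" "e = cImp' p q"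
    | v p where "v \<in> U" "p \<in> U" "p \<epsilon> T" "e = cAll' v p"
    using T(3)[OF mem_U[OF T(2)] T(2)] by blast
  then show thesis
  proof cases
    case 1
    then consider R m a where "R \<in> U" "m \<in> U" "a \<in> U" "e = cRel' R a"
        "\<forall>i\<in>U. \<forall>t\<in>U. pr' i t \<epsilon> a \<longrightarrow> is_term' r t"
      | s t where "s \<in> U" "t \<in> U" "is_term' r s" "is_term' r t" "e = cEq' s t" | "e = cFls'"
      unfolding is_atomic'_def by blast
    then show thesis by cases (use that(1-3) in blast)+
  qed (use sub that(4,5) in blast)+
qed

lemma free_in'_self: "e \<in> U \<Longrightarrow> free_in' e e"
  unfolding free_in'_def by (intro bexI[of _ "J Z e"]) auto

text \<open>The members \<open>{a}\<close> and \<open>{a, b}\<close> of the pair lie in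
  \<open>w\<close> by inclusion; transitivity then removes the second layer of braces.\<close>

lemma trans_pair:
  assumes "trans_set' w" "a \<in> U" "b \<in> U" "subset_of' (pr' a b) w"
  shows "a \<epsilon> w" "b \<epsilon> w"
proof -
  have "J Z a \<epsilon> pr' a b" "J (J Z a) b \<epsilon> pr' a b" using assms by (auto simp: pr'_def)
  then have "J Z a \<epsilon> w" "J (J Z a) b \<epsilon> w" using assms unfolding subset_of'_def by auto
  then have "subset_of' (J Z a) w" "subset_of' (J (J Z a) b) w"
    using assms unfolding trans_set'_def by auto
  then show "a \<epsilon> w" "b \<epsilon> w" using assms unfolding subset_of'_def by auto
qed

text \<open>The rank argument: \<open>p\<close> is in the next stage exactly when it is a subset of
  \<open>w\<close>, and the nested pairs that make up a code lead down to its parts without leaving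
  the transitive \<open>w\<close>.\<close>

lemma trans_imm_part:
  assumes w: "trans_set' w" and "c \<in> U" "p \<in> U" "subset_of' p w" "imm_part' c p"
  shows "c \<epsilon> w"
proof -
  have sub: "subset_of' x w" if "x \<epsilon> w" for x
    using w that mem_U[OF that] unfolding trans_set'_def by blast
  have pair: "x \<epsilon> w \<and> y \<epsilon> w" if "x \<in> U" "y \<in> U" "subset_of' (pr' x y) w" for x y
    using trans_pair[OF w that] by blast
  have pair2: "x \<epsilon> w \<and> y \<epsilon> w" if "x \<in> U" "y \<in> U" "subset_of' (pr' (num' k) (pr' x y)) w" for k x y
    using pair[of "num' k" "pr' x y"] pair[of x y] that sub by simp
  have arg: "c \<epsilon> w" if "s \<in> U" "a \<in> U" "i \<in> U" "subset_of' (pr' (num' k) (pr' s a)) w" "pr' i c \<epsilon> a" for k s a i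
  proof -
    have "subset_of' a w" using pair2[OF that(1,2,4)] sub by blast
    then have "pr' i c \<epsilon> w" using that \<open>c \<in> U\<close> unfolding subset_of'_def by simp
    then show ?thesis using pair[of i c] sub that \<open>c \<in> U\<close> by blast
  qed
  show ?thesis
    using assms(5) unfolding imm_part'_def
    by (elim disjE bexE conjE) (use assms(2,4) pair2 arg in \<open>auto simp: code_defs\<close>)
qed

lemma V_seq'_step:
  "V_seq' n f \<Longrightarrow> k \<in> U \<Longrightarrow> u \<in> U \<Longrightarrow> w \<in> U \<Longrightarrow> k \<epsilon> n \<Longrightarrow> pr' k u \<epsilon> f \<Longrightarrow> pr' (succ' k) w \<epsilon> f \<Longrightarrow>
    y \<in> U \<Longrightarrow> y \<epsilon> w \<longleftrightarrow> subset_of' y u"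
  unfolding V_seq'_def by blast

text \<open>Cutting off the last index keeps the value at \<open>n\<close>, so the final power set
  step can be read off from \<open>f\<close> while the hypotheses at stage \<open>n\<close> apply to
  \<open>g\<close>.\<close>

lemma V_seq'_restrict:
  assumes "n \<in> U" "f \<in> U" "V_seq' (succ' n) f"
  obtains g w where "g \<in> U" "V_seq' n g" "w \<in> U" "pr' n w \<epsilon> g" "pr' n w \<epsilon> f"
proof -
  have "Df (\<lambda>e. \<exists>k\<in>U. \<exists>u\<in>U. e 0 = pr' k u \<and> k \<epsilon> succ' n)" by (intro Df_intros)
  from class_separation[OF this assms(2)] obtain g where
    g: "g \<in> U" "\<And>y. y \<in> U \<Longrightarrow> y \<epsilon> g \<longleftrightarrow> y \<epsilon> f \<and> (\<exists>k\<in>U. \<exists>u\<in>U. y = pr' k u \<and> k \<epsilon> succ' n)" by blast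
  have g_mem: "pr' k u \<epsilon> g \<longleftrightarrow> pr' k u \<epsilon> f \<and> k \<epsilon> succ' n" if "k \<in> U" "u \<in> U" for k u
    using that g(2) by auto
  have f: "is_fun' f" "\<And>k. k \<in> U \<Longrightarrow> in_dom' k f \<longleftrightarrow> k \<epsilon> succ' (succ' n)"
    using assms(3) unfolding V_seq'_def fun_on'_def by auto
  obtain w where w: "w \<in> U" "pr' n w \<epsilon> f" using f(2)[of n] assms(1) unfolding in_dom'_def by auto
  \<comment> \<open>The index \<open>Z\<close> survives the cut: it is in the domain of
    \<open>f\<close> and differs from the index \<open>succ' n\<close> that is removed.\<close>
  have zero: "Z \<epsilon> succ' n"
  proof (rule ccontr)
    assume "\<not> Z \<epsilon> succ' n"
    moreover have "in_dom' Z f" using assms(3) Z_U unfolding V_seq'_def in_dom'_def by blast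
    ultimately have "Z = succ' n" using f(2)[of Z] assms(1) by simp
    then show False using assms(1) succ'_neq_Z by metis
  qed
  have "is_fun' g" using f(1) g mem_U unfolding is_fun'_def by blast
  moreover have "in_dom' k g \<longleftrightarrow> k \<epsilon> succ' n" if "k \<in> U" for k
    using f(2)[OF that] that assms(1) g_mem unfolding in_dom'_def by auto
  moreover have "pr' Z Z \<epsilon> g" using assms(3) zero g_mem unfolding V_seq'_def by simp
  moreover have "y \<epsilon> w \<longleftrightarrow> subset_of' y u"
    if "k \<in> U" "u \<in> U" "w \<in> U" "k \<epsilon> n" "pr' k u \<epsilon> g" "pr' (succ' k) w \<epsilon> g" "y \<in> U" for k u w y
    by (rule V_seq'_step[OF assms(3), of k]) (use that assms(1) g_mem in simp_all)
  ultimately have "V_seq' n g" unfolding V_seq'_def fun_on'_def by blast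
  then show thesis using that[OF g(1) _ w(1)] w g_mem assms(1) by simp
qed

text \<open>The power set of a transitive set is transitive.\<close>

lemma V_trans'_succ:
  assumes "n \<in> U" "V_trans' n"
  shows "V_trans' (succ' n)"
  unfolding V_trans'_def
proof (intro ballI impI, elim conjE)
  fix f u assume f: "f \<in> U" "u \<in> U" "V_seq' (succ' n) f" "pr' (succ' n) u \<epsilon> f"
  obtain g w where g: "g \<in> U" "V_seq' n g" "w \<in> U" "pr' n w \<epsilon> g" "pr' n w \<epsilon> f"
    by (rule V_seq'_restrict[OF assms(1) f(1,3)])
  have w: "trans_set' w" using assms g unfolding V_trans'_def by blast
  have "y \<epsilon> u \<longleftrightarrow> subset_of' y w" if "y \<in> U" for y
    by (rule V_seq'_step[OF f(3), of n]) (use f g assms(1) that in simp_all)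
  then show "trans_set' u" using w unfolding trans_set'_def subset_of'_def by blast
qed

lemma in_V'_succ:
  assumes "n \<in> U" "p \<in> U" "c \<in> U" "V_trans' n" "in_V' (succ' n) p" "imm_part' c p"
  shows "in_V' n c"
proof -
  obtain f u where f: "f \<in> U" "u \<in> U" "V_seq' (succ' n) f" "pr' (succ' n) u \<epsilon> f" "p \<epsilon> u"
    using assms(5) unfolding in_V'_alt by blast
  obtain g w where g: "g \<in> U" "V_seq' n g" "w \<in> U" "pr' n w \<epsilon> g" "pr' n w \<epsilon> f"
    by (rule V_seq'_restrict[OF assms(1) f(1,3)])
  have w: "trans_set' w" using assms g unfolding V_trans'_def by blast
  have "subset_of' p w"
    using V_seq'_step[OF f(3), of n w u p] f g assms(1,2) by simp
  then have "c \<epsilon> w" using trans_imm_part[OF w] assms by blast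
  then show ?thesis unfolding in_V'_alt using g by blast
qed

text \<open>As a set, \<open>pr' f (pr' b u)\<close> could also be an entry for a relation symbol
  \<open>f\<close> with tuple \<open>pr' b u\<close>. The signature is a function, so
  \<open>f\<close> cannot be of both kinds.\<close>

lemma interp_value:
  assumes "is_structure' r D I" "f \<in> U" "m \<in> U" "b \<in> U" "u \<in> U" "fun_symbol' r f m" "pr' f (pr' b u) \<epsilon> I"
  shows "u \<epsilon> D"
proof -
  have r_fun: "y = z" if "x \<in> U" "y \<in> U" "z \<in> U" "pr' x y \<epsilon> r" "pr' x z \<epsilon> r" for x y z
    using assms(1) that unfolding is_structure'_def signature'_def is_fun'_def by blast
  have "(\<exists>R\<in>U. \<exists>m\<in>U. \<exists>b'\<in>U. rel_symbol' r R m \<and> pr' f (pr' b u) = pr' R b') \<or>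
      (\<exists>g\<in>U. \<exists>b'\<in>U. \<exists>u'\<in>U. u' \<epsilon> D \<and> pr' f (pr' b u) = pr' g (pr' b' u'))"
    using assms(1,7) mem_U[OF assms(7)] unfolding is_structure'_def by blast
  then show ?thesis
  proof
    assume "\<exists>R\<in>U. \<exists>m\<in>U. \<exists>b'\<in>U. rel_symbol' r R m \<and> pr' f (pr' b u) = pr' R b'"
    then obtain m' where "m' \<in> U" "rel_symbol' r f m'" using assms by auto
    then have "pr' (num' 0) m' = pr' (num' 1) m"
      using r_fun[of f "pr' (num' 0) m'" "pr' (num' 1) m"] assms unfolding rel_symbol'_def fun_symbol'_def by simp
    then show ?thesis using \<open>m' \<in> U\<close> assms by simp
  qed (use assms in auto)
qed

text \<open>A compound term has a value once the values of its arguments form a tuple that is a set;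
  Replacement provides this tuple, and it is the only one that \<open>arg_values'\<close>
  admits.\<close>

lemma term_clauses:
  assumes st: "is_structure' r D I" and A: "assignment' D A" "A \<in> U" and e: "is_term' r e"
    and free: "\<And>v. v \<in> U \<Longrightarrow> is_var' v \<Longrightarrow> free_in' v e \<Longrightarrow> in_dom' v A"
    and val: "\<And>t. t \<in> U \<Longrightarrow> is_term' r t \<Longrightarrow> imm_part' t e \<Longrightarrow>
      \<exists>u\<in>U. u \<epsilon> D \<and> (\<forall>w\<in>U. pr' (pr' t A) w \<epsilon> F \<longleftrightarrow> w = u)"
  shows "\<exists>u\<in>U. u \<epsilon> D \<and> (\<forall>w\<in>U. clauses r D I F e A w \<longleftrightarrow> w = u)"
  using e
proof (cases rule: is_term'_cases)
  case 1
  then obtain i where i: "i \<in> U" "e = cVar' i" "e \<in> U" unfolding is_var'_def by auto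
  have nf: "\<not> is_formula' r e"
  proof
    assume "is_formula' r e"
    then show False by (cases rule: is_formula'_cases) (use i in auto)
  qed
  obtain u where u: "u \<in> U" "pr' e u \<epsilon> A"
    using free[of e] 1 i free_in'_self unfolding in_dom'_def by blast
  have "w = u" if "w \<in> U" "pr' e w \<epsilon> A" for w
    using A u that i unfolding assignment'_def is_fun'_def by blast
  moreover have "clauses r D I F e A w \<longleftrightarrow> pr' e w \<epsilon> A" if "w \<in> U" for w
    using 1 nf i(1) unfolding clauses_def i(2) by simp
  ultimately have "\<forall>w\<in>U. clauses r D I F e A w \<longleftrightarrow> w = u" using u by blast
  moreover have "u \<epsilon> D" using A u i unfolding assignment'_def by blast
  ultimately show ?thesis using u by blast
next
  case (2 f m a)
  have nf: "\<not> is_formula' r e" "\<not> is_var' e"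
  proof
    assume "is_formula' r e"
    then show False by (cases rule: is_formula'_cases) (use 2 in auto)
  qed (use 2 in \<open>auto simp: is_var'_def\<close>)
  have part: "\<exists>u\<in>U. u \<epsilon> D \<and> (\<forall>w\<in>U. pr' (pr' t A) w \<epsilon> F \<longleftrightarrow> w = u)" if "i \<in> U" "t \<in> U" "pr' i t \<epsilon> a" for i t
    using val[of t] that 2 by (auto simp: imm_part'_Fun)
  have a: "is_fun' a" "\<And>i. i \<in> U \<Longrightarrow> in_dom' i a \<longleftrightarrow> i \<epsilon> m" using 2(5) unfolding fun_on'_def by auto
  \<comment> \<open>\<open>R\<close> sends the entry \<open>(i, t)\<close> of the argument tuple to
    the entry \<open>(i, u)\<close> with \<open>u\<close> the value of \<open>t\<close>; the image
    of \<open>a\<close> is the tuple of values.\<close>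
  define R where "R x y \<longleftrightarrow> (\<exists>i\<in>U. \<exists>t\<in>U. \<exists>u\<in>U. x = pr' i t \<and> y = pr' i u \<and> pr' (pr' t A) u \<epsilon> F)" for x y
  have "Df (\<lambda>e. \<exists>x\<in>U. \<exists>y\<in>U. e 0 = pr' x y \<and> x \<epsilon> a \<and> R x y)" unfolding R_def by (intro Df_intros)
  from comprehension[OF this] obtain G where
    G: "\<And>p. p \<in> U \<Longrightarrow> p \<epsilon> G \<longleftrightarrow> (\<exists>x\<in>U. \<exists>y\<in>U. p = pr' x y \<and> x \<epsilon> a \<and> R x y)" by blast
  have "\<exists>b\<in>U. \<forall>y\<in>U. y \<epsilon> b \<longleftrightarrow> (\<exists>x\<in>U. x \<epsilon> a \<and> pr' x y \<epsilon> G)"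
  proof (rule class_replacement)
    fix x y z assume xyz: "x \<in> U" "y \<in> U" "z \<in> U" "pr' x y \<epsilon> G" "pr' x z \<epsilon> G"
    then have R: "R x y" "R x z" "x \<epsilon> a" using G by auto
    then obtain i t u u' where "i \<in> U" "t \<in> U" "u \<in> U" "u' \<in> U" "x = pr' i t" "y = pr' i u" "z = pr' i u'"
      "pr' (pr' t A) u \<epsilon> F" "pr' (pr' t A) u' \<epsilon> F"
      unfolding R_def by auto
    with part[of i t] R show "y = z" by auto
  qed (use 2 in simp)
  then obtain b where b: "b \<in> U" "\<And>y. y \<in> U \<Longrightarrow> y \<epsilon> b \<longleftrightarrow> (\<exists>x\<in>U. x \<epsilon> a \<and> R x y)" using G by auto
  have b_mem: "pr' i u \<epsilon> b \<longleftrightarrow> (\<exists>t\<in>U. pr' i t \<epsilon> a \<and> pr' (pr' t A) u \<epsilon> F)" if "i \<in> U" "u \<in> U" for i u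
    using b(2)[of "pr' i u"] that unfolding R_def by auto
  have b_pair: "\<exists>i\<in>U. \<exists>u\<in>U. p = pr' i u" if "p \<epsilon> b" for p
    using b(2)[of p] mem_U[OF that] that unfolding R_def by blast
  have b_fun: "is_fun' b" unfolding is_fun'_def
  proof (intro conjI ballI impI)
    show "\<exists>x\<in>U. \<exists>y\<in>U. p = pr' x y" if "p \<epsilon> b" for p using b_pair[OF that] .
    show "y = z" if xyz: "x \<in> U" "y \<in> U" "z \<in> U" "pr' x y \<epsilon> b \<and> pr' x z \<epsilon> b" for x y z
    proof -
      obtain t t' where t: "t \<in> U" "t' \<in> U" "pr' x t \<epsilon> a" "pr' x t' \<epsilon> a" "pr' (pr' t A) y \<epsilon> F" "pr' (pr' t' A) z \<epsilon> F"
        using xyz by (auto simp: b_mem)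
      then have "t = t'" using a(1) xyz(1) unfolding is_fun'_def by blast
      then show ?thesis using t part[of x t] that by auto
    qed
  qed
  have dom: "in_dom' i a \<longleftrightarrow> in_dom' i b" if "i \<in> U" for i
    using part that unfolding in_dom'_def by (auto simp: b_mem) blast
  have args: "arg_values' F A a c \<longleftrightarrow> c = b" if "c \<in> U" for c
  proof
    show "c = b" if c: "arg_values' F A a c"
    proof (rule ext)
      fix p
      have cp: "pr' i u \<epsilon> c \<longleftrightarrow> pr' i u \<epsilon> b" if iu: "i \<in> U" "u \<in> U" for i u
      proof
        assume *: "pr' i u \<epsilon> c"
        then have "in_dom' i a" using c iu unfolding arg_values'_def in_dom'_def by blast
        then obtain t where "t \<in> U" "pr' i t \<epsilon> a" unfolding in_dom'_def by blast
        moreover then have "pr' (pr' t A) u \<epsilon> F" using c iu * unfolding arg_values'_def by blast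
        ultimately show "pr' i u \<epsilon> b" using iu by (auto simp: b_mem)
      next
        assume *: "pr' i u \<epsilon> b"
        then obtain t where t: "t \<in> U" "pr' i t \<epsilon> a" "pr' (pr' t A) u \<epsilon> F" using iu by (auto simp: b_mem)
        then have "in_dom' i c" using c iu unfolding arg_values'_def in_dom'_def by blast
        then obtain u' where u': "u' \<in> U" "pr' i u' \<epsilon> c" unfolding in_dom'_def by blast
        then have "pr' (pr' t A) u' \<epsilon> F" using c t iu unfolding arg_values'_def by blast
        then show "pr' i u \<epsilon> c" using part[of i t] t u' iu by auto
      qed
      have "\<exists>i\<in>U. \<exists>u\<in>U. p = pr' i u" if "p \<epsilon> c"
        using c that mem_U[OF that] unfolding arg_values'_def is_fun'_def by blast
      then show "p \<epsilon> c \<longleftrightarrow> p \<epsilon> b" using b_pair cp by metis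
    qed
    show "arg_values' F A a c" if "c = b"
      unfolding that arg_values'_def
    proof (intro conjI ballI impI b_fun)
      show "in_dom' i a \<longleftrightarrow> in_dom' i b" if "i \<in> U" for i using dom[OF that] .
      show "pr' (pr' t A) y \<epsilon> F" if ity: "i \<in> U" "t \<in> U" "y \<in> U" "pr' i t \<epsilon> a \<and> pr' i y \<epsilon> b" for i t y
      proof -
        obtain t' where t': "t' \<in> U" "pr' i t' \<epsilon> a" "pr' (pr' t' A) y \<epsilon> F" using ity by (auto simp: b_mem)
        then have "t = t'" using a(1) ity unfolding is_fun'_def by blast
        with t' show ?thesis by simp
      qed
    qed
  qed
  have "tuple' b m D" unfolding tuple'_def fun_on'_def
  proof (intro conjI ballI impI b_fun)
    show "in_dom' x b \<longleftrightarrow> x \<epsilon> m" if "x \<in> U" for x using dom a(2) that by simp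
    show "x \<epsilon> D" if ix: "i \<in> U" "x \<in> U" "pr' i x \<epsilon> b" for i x
    proof -
      obtain t where "t \<in> U" "pr' i t \<epsilon> a" "pr' (pr' t A) x \<epsilon> F" using ix by (auto simp: b_mem)
      then show ?thesis using part[of i t] ix by auto
    qed
  qed
  then obtain u where u: "u \<in> U" "\<And>w. w \<in> U \<Longrightarrow> pr' f (pr' b w) \<epsilon> I \<longleftrightarrow> w = u"
    using st 2 b(1) unfolding is_structure'_def by metis
  have "u \<epsilon> D" using interp_value[OF st 2(1,2) b(1) u(1) 2(4)] u by simp
  moreover have "\<forall>w\<in>U. clauses r D I F e A w \<longleftrightarrow> w = u"
    using 2 nf args b(1) u unfolding clauses_def by auto
  ultimately show ?thesis using u(1) by blast
qed

text \<open>The code of a formula matches exactly one clause, and that clause fixes whether the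
  value is 1 by a condition on \<open>F\<close> alone. For falsum the condition is
  \<open>False\<close>.\<close>

lemma formula_clauses:
  assumes "is_formula' r e"
  shows "\<exists>c. \<forall>w\<in>U. clauses r D I F e A w \<longleftrightarrow> (w = num' 0 \<or> w = num' 1) \<and> (w = num' 1 \<longleftrightarrow> c)"
  using assms
proof (cases rule: is_formula'_cases)
  case (1 R m a)
  then show ?thesis using assms unfolding clauses_def is_var'_def by auto
next
  case (2 s t)
  then show ?thesis using assms unfolding clauses_def is_var'_def by auto
next
  case 3
  then show ?thesis using assms unfolding clauses_def is_var'_def by (intro exI[of _ False]) auto
next
  case (4 p q)
  then show ?thesis using assms unfolding clauses_def is_var'_def by auto
next
  case (5 v p)
  then show ?thesis using assms unfolding clauses_def is_var'_def by auto
qed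

lemma not_imm_part'_Var: "i \<in> U \<Longrightarrow> c \<in> U \<Longrightarrow> \<not> imm_part' c (cVar' i)"
  by (auto simp: imm_part'_def)

lemma is_term'_part: "is_term' r p \<Longrightarrow> c \<in> U \<Longrightarrow> imm_part' c p \<Longrightarrow> is_term' r c"
  by (cases rule: is_term'_cases, assumption)
    (auto simp: is_var'_def not_imm_part'_Var imm_part'_Fun)

lemma is_formula'_part:
  "is_formula' r p \<Longrightarrow> c \<in> U \<Longrightarrow> imm_part' c p \<Longrightarrow> is_term' r c \<or> is_formula' r c"
  by (cases rule: is_formula'_cases, assumption) (auto simp: imm_part'_def)

lemma V_expr'_part:
  assumes "n \<in> U" "p \<in> U" "c \<in> U" "V_trans' n" "V_expr' r (succ' n) p" "imm_part' c p"
  shows "V_expr' r n c"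
  using assms in_V'_succ is_term'_part is_formula'_part unfolding V_expr'_def by blast

text \<open>\<open>evaluation'\<close> does not say outright that terms take values in the domain.
  For a variable this comes from the assignment, for a function term from the structure.\<close>

lemma evaluation'_value:
  assumes st: "is_structure' r D I" and F: "evaluation' P r D I F" and "A \<in> U" "t \<in> U"
    and t: "is_term' r t" and dom: "eval_dom' P D t A"
  shows "\<exists>u\<in>U. u \<epsilon> D \<and> (\<forall>w\<in>U. pr' (pr' t A) w \<epsilon> F \<longleftrightarrow> w = u)"
proof -
  obtain u where u: "u \<in> U" "\<forall>w\<in>U. pr' (pr' t A) w \<epsilon> F \<longleftrightarrow> w = u"
    using F dom assms(3,4) unfolding evaluation'_alt by blast
  then have cl: "clauses r D I F t A u" using F assms(3,4) unfolding evaluation'_alt by blast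
  from t have "u \<epsilon> D"
  proof (cases rule: is_term'_cases)
    case 1
    then have "pr' t u \<epsilon> A" using cl unfolding clauses_def by blast
    then show ?thesis using dom u assms(4) unfolding eval_dom'_def assignment'_def by blast
  next
    case (2 f m a)
    then obtain b where "b \<in> U" "pr' f (pr' b u) \<epsilon> I" using cl unfolding clauses_def by blast
    then show ?thesis using interp_value[OF st] 2 u(1) by blast
  qed
  with u show ?thesis by blast
qed

text \<open>\<open>G\<close> keeps \<open>F\<close> on the old domain and applies the clauses, with
  \<open>F\<close> inside them, at the new pairs. This definition quantifies over sets only, so
  comprehension yields \<open>G\<close>.\<close>

lemma evaluation_step:
  assumes n: "n \<in> U" "V_trans' n" and st: "is_structure' r D I"
    and F: "evaluation' (V_expr' r n) r D I F"
  shows "\<exists>G. evaluation' (V_expr' r (succ' n)) r D I G"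
proof -
  let ?d = "eval_dom' (V_expr' r n) D" and ?d' = "eval_dom' (V_expr' r (succ' n)) D"
  have "Df (\<lambda>e. \<exists>x\<in>U. \<exists>A\<in>U. \<exists>w\<in>U. e 0 = pr' (pr' x A) w \<and> ?d' x A \<and>
      ((?d x A \<and> e 0 \<epsilon> F) \<or> (\<not> ?d x A \<and> clauses r D I F x A w)))"
    by (intro Df_intros)
  from comprehension[OF this] obtain G where G: "\<And>y. y \<in> U \<Longrightarrow> y \<epsilon> G \<longleftrightarrow>
      (\<exists>x\<in>U. \<exists>A\<in>U. \<exists>w\<in>U. y = pr' (pr' x A) w \<and> ?d' x A \<and>
        ((?d x A \<and> y \<epsilon> F) \<or> (\<not> ?d x A \<and> clauses r D I F x A w)))" by blast
  have G_mem: "pr' (pr' e A) w \<epsilon> G \<longleftrightarrow> ?d' e A \<and>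
      ((?d e A \<and> pr' (pr' e A) w \<epsilon> F) \<or> (\<not> ?d e A \<and> clauses r D I F e A w))"
    if "e \<in> U" "A \<in> U" "w \<in> U" for e A w
    using that by (subst G) auto
  \<comment> \<open>Either \<open>e\<close> is itself the chosen expression at stage
    \<open>n + 1\<close>, whose parts are in \<open>V\<^sub>n\<close>, or the descent to
    \<open>e\<close> passes through such a part.\<close>
  have part: "(\<exists>p\<in>U. V_expr' r (succ' n) p \<and> subexpr' c p) \<and> (\<exists>p\<in>U. V_expr' r n p \<and> subexpr' c p)"
    if ec: "e \<in> U" "c \<in> U" "imm_part' c e" "\<exists>p\<in>U. V_expr' r (succ' n) p \<and> subexpr' e p" for e c
  proof -
    obtain p where p: "p \<in> U" "V_expr' r (succ' n) p" "subexpr' e p" using ec by blast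
    then have "subexpr' c p" using subexpr'_part ec by blast
    moreover have "\<exists>q\<in>U. V_expr' r n q \<and> subexpr' c q"
      using subexpr'_cases[OF that(1) p(1,3)]
    proof
      assume "e = p"
      then have "V_expr' r n c" using V_expr'_part[OF n(1) p(1) that(2) n(2) p(2)] that by blast
      then show ?thesis using subexpr'_refl that by blast
    next
      assume "\<exists>q\<in>U. imm_part' q p \<and> subexpr' e q"
      then obtain q where q: "q \<in> U" "imm_part' q p" "subexpr' e q" by blast
      then have "V_expr' r n q" using V_expr'_part[OF n(1) p(1) _ n(2) p(2)] by blast
      then show ?thesis using subexpr'_part q that by blast
    qed
    ultimately show ?thesis using p by blast
  qed
  \<comment> \<open>At an immediate part of a new expression the old and new domains coincide, so
    \<open>G\<close> takes its entries from \<open>F\<close>; outside the domain neither has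
    any.\<close>
  have agree: "pr' (pr' c B) w \<epsilon> F \<longleftrightarrow> pr' (pr' c B) w \<epsilon> G"
    if "e \<in> U" "A \<in> U" "?d' e A" "c \<in> U" "imm_part' c e" "B \<in> U" "w \<in> U" for e A c B w
  proof -
    have "?d c B \<longleftrightarrow> ?d' c B"
      using part[OF that(1,4,5)] that(3) unfolding eval_dom'_def by blast
    moreover have "?d c B" if cB: "pr' (pr' c B) w \<epsilon> F"
    proof -
      obtain e' A' u' where "e' \<in> U" "A' \<in> U" "u' \<in> U" "pr' (pr' c B) w = pr' (pr' e' A') u'" "?d e' A'"
        using F cB mem_U[OF cB] unfolding evaluation'_alt by blast
      then show ?thesis using \<open>c \<in> U\<close> \<open>B \<in> U\<close> \<open>w \<in> U\<close> by simp
    qed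
    ultimately show ?thesis using G_mem that by blast
  qed
  have cong: "clauses r D I F e A w \<longleftrightarrow> clauses r D I G e A w"
    if "e \<in> U" "A \<in> U" "w \<in> U" "?d' e A" for e A w
    by (rule clauses_cong[OF that(1-3)]) (rule agree[OF that(1,2,4)])
  have ex1: "\<exists>u\<in>U. \<forall>w\<in>U. pr' (pr' e A) w \<epsilon> G \<longleftrightarrow> w = u" if eA: "e \<in> U" "A \<in> U" "?d' e A" for e A
  proof (cases "?d e A")
    case True
    then show ?thesis using F eA unfolding evaluation'_alt by (simp add: G_mem)
  next
    case False
    obtain p where p: "p \<in> U" "V_expr' r (succ' n) p" "subexpr' e p"
      using eA(3) unfolding eval_dom'_def by blast
    \<comment> \<open>An expression without a value so far cannot lie below an immediate part of
      \<open>p\<close>; hence it is \<open>p\<close>.\<close>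
    have "\<not> (\<exists>q\<in>U. imm_part' q p \<and> subexpr' e q)"
    proof
      assume "\<exists>q\<in>U. imm_part' q p \<and> subexpr' e q"
      then obtain q where "q \<in> U" "imm_part' q p" "subexpr' e q" by blast
      moreover then have "V_expr' r n q" using V_expr'_part[OF n(1) p(1) _ n(2) p(2)] by blast
      ultimately show False using False eA(3) unfolding eval_dom'_def by blast
    qed
    then have e: "V_expr' r (succ' n) e" using subexpr'_cases[OF eA(1) p(1,3)] p by blast
    have "\<exists>u\<in>U. \<forall>w\<in>U. clauses r D I F e A w \<longleftrightarrow> w = u"
    proof (cases "is_term' r e")
      case True
      have "\<exists>u\<in>U. u \<epsilon> D \<and> (\<forall>w\<in>U. pr' (pr' t A) w \<epsilon> F \<longleftrightarrow> w = u)"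
        if t: "t \<in> U" "is_term' r t" "imm_part' t e" for t
      proof (rule evaluation'_value[OF st F eA(2) t(1,2)])
        have "free_in' v e" if "v \<in> U" "free_in' v t" for v
          using True
        proof (cases rule: is_term'_cases)
          case 1
          then show ?thesis using t not_imm_part'_Var unfolding is_var'_def by blast
        next
          case (2 f m a)
          then show ?thesis using free_in'_arg that t by blast
        qed
        moreover have "V_expr' r n t" using V_expr'_part[OF n(1) eA(1) t(1) n(2) e t(3)] .
        ultimately show "?d t A" using eA t subexpr'_refl unfolding eval_dom'_def by blast
      qed
      moreover have "assignment' D A" "\<And>v. v \<in> U \<Longrightarrow> is_var' v \<Longrightarrow> free_in' v e \<Longrightarrow> in_dom' v A"
        using eA(3) unfolding eval_dom'_def by auto
      ultimately show ?thesis using term_clauses[OF st _ eA(2) True, of F] by blast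
    next
      case False
      then have "is_formula' r e" using e unfolding V_expr'_def by blast
      from formula_clauses[OF this, of D I F A] obtain c
        where "\<forall>w\<in>U. clauses r D I F e A w \<longleftrightarrow> (w = num' 0 \<or> w = num' 1) \<and> (w = num' 1 \<longleftrightarrow> c)"
        by (elim exE)
      moreover define u where "u = (if c then num' 1 else num' 0)"
      have "(w = num' 0 \<or> w = num' 1) \<and> (w = num' 1 \<longleftrightarrow> c) \<longleftrightarrow> w = u" for w
        unfolding u_def by (cases c) auto
      ultimately show ?thesis by (intro bexI[of _ u]) (simp_all add: u_def)
    qed
    then show ?thesis using False eA by (simp add: G_mem)
  qed
  have "evaluation' (V_expr' r (succ' n)) r D I G"
    unfolding evaluation'_alt
  proof (intro conjI ballI impI)
    show "\<exists>e\<in>U. \<exists>A\<in>U. \<exists>u\<in>U. x = pr' (pr' e A) u \<and> ?d' e A" if "x \<epsilon> G" for x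
      using G[OF mem_U[OF that]] that by blast
    show "\<exists>u\<in>U. \<forall>w\<in>U. pr' (pr' e A) w \<epsilon> G \<longleftrightarrow> w = u" if "e \<in> U" "A \<in> U" "?d' e A" for e A
      using ex1[OF that] .
    show "clauses r D I G e A u" if eA: "e \<in> U" "A \<in> U" "u \<in> U" "pr' (pr' e A) u \<epsilon> G" for e A u
    proof -
      have "pr' (pr' e A) u \<epsilon> F \<Longrightarrow> clauses r D I F e A u"
        using F eA unfolding evaluation'_alt by blast
      then have "?d' e A" "clauses r D I F e A u" using eA G_mem by blast+
      then show ?thesis using cong eA by blast
    qed
  qed
  then show ?thesis ..
qed

text \<open>The smaller domain is also closed under immediate parts, so restricting \<open>F\<close>
  to it leaves the clauses intact.\<close>

lemma evaluation_Phi: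
  assumes F: "evaluation' (V_expr' r n) r D I F"
  shows "\<exists>G. evaluation' (Phi' r n) r D I G"
proof -
  let ?d = "eval_dom' (V_expr' r n) D" and ?d' = "eval_dom' (Phi' r n) D"
  have Phi: "Tm p \<Longrightarrow> Df (\<lambda>e. Phi' r n (p e))" for p by (intro Df_intros)
  have "Df (\<lambda>e. e 0 \<epsilon> F \<and> (\<exists>x\<in>U. \<exists>A\<in>U. \<exists>w\<in>U. e 0 = pr' (pr' x A) w \<and> ?d' x A))"
    by (intro Df_intros Phi)
  from comprehension[OF this] obtain G where G: "\<And>y. y \<in> U \<Longrightarrow> y \<epsilon> G \<longleftrightarrow>
      y \<epsilon> F \<and> (\<exists>x\<in>U. \<exists>A\<in>U. \<exists>w\<in>U. y = pr' (pr' x A) w \<and> ?d' x A)" by blast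
  have G_mem: "pr' (pr' e A) w \<epsilon> G \<longleftrightarrow> ?d' e A \<and> pr' (pr' e A) w \<epsilon> F" if "e \<in> U" "A \<in> U" "w \<in> U" for e A w
    using that by (subst G) auto
  have dom: "?d e A" if "?d' e A" for e A
    using that unfolding eval_dom'_def V_expr'_def Phi'_def by blast
  have cong: "clauses r D I F e A u \<longleftrightarrow> clauses r D I G e A u"
    if eA: "e \<in> U" "A \<in> U" "u \<in> U" "?d' e A" for e A u
  proof (rule clauses_cong[OF eA(1-3)])
    fix c B w assume c: "c \<in> U" "imm_part' c e" "B \<in> U" "w \<in> U"
    have "\<exists>p\<in>U. Phi' r n p \<and> subexpr' c p"
      using eA c subexpr'_part unfolding eval_dom'_def by blast
    moreover have "?d c B" if cB: "pr' (pr' c B) w \<epsilon> F"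
    proof -
      obtain e' A' u' where "e' \<in> U" "A' \<in> U" "u' \<in> U" "pr' (pr' c B) w = pr' (pr' e' A') u'" "?d e' A'"
        using F cB mem_U[OF cB] unfolding evaluation'_alt by blast
      then show ?thesis using c by simp
    qed
    ultimately show "pr' (pr' c B) w \<epsilon> F \<longleftrightarrow> pr' (pr' c B) w \<epsilon> G"
      using G_mem c unfolding eval_dom'_def by blast
  qed
  have "evaluation' (Phi' r n) r D I G"
    unfolding evaluation'_alt
  proof (intro conjI ballI impI)
    show "\<exists>e\<in>U. \<exists>A\<in>U. \<exists>u\<in>U. x = pr' (pr' e A) u \<and> ?d' e A" if "x \<epsilon> G" for x
      using G[OF mem_U[OF that]] that by blast
    show "\<exists>u\<in>U. \<forall>w\<in>U. pr' (pr' e A) w \<epsilon> G \<longleftrightarrow> w = u" if "e \<in> U" "A \<in> U" "?d' e A" for e A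
      using F dom that unfolding evaluation'_alt by (simp add: G_mem)
    show "clauses r D I G e A u" if eA: "e \<in> U" "A \<in> U" "u \<in> U" "pr' (pr' e A) u \<epsilon> G" for e A u
    proof -
      have "pr' (pr' e A) u \<epsilon> F \<Longrightarrow> clauses r D I F e A u"
        using F eA unfolding evaluation'_alt by blast
      then have "?d' e A" "clauses r D I F e A u" using eA G_mem by blast+
      then show ?thesis using cong eA by blast
    qed
  qed
  then show ?thesis ..
qed

lemma V_seq'_zero: "V_seq' Z f \<Longrightarrow> u \<in> U \<Longrightarrow> pr' Z u \<epsilon> f \<Longrightarrow> u = Z"
  unfolding V_seq'_def fun_on'_def is_fun'_def by (metis Z_U)

lemma V_trans'_zero: "V_trans' Z"
  unfolding V_trans'_def trans_set'_def by (metis V_seq'_zero mem_Z)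

text \<open>No expression lies in the empty \<open>V\<^sub>0\<close>, so there is nothing to
  evaluate.\<close>

lemma evaluation_zero: "evaluation' (V_expr' r Z) r D I Z"
proof -
  have "\<not> in_V' Z p" for p unfolding in_V'_alt by (metis V_seq'_zero mem_Z)
  then have "\<not> eval_dom' (V_expr' r Z) D e A" for e A unfolding eval_dom'_def V_expr'_def by blast
  then show ?thesis unfolding evaluation'_alt by simp
qed

end

text \<open>This is the formula \<theta> of the overview. Its class quantifiers range over
  structures and evaluations only.\<close>

definition evaluations_step_hyp :: "tm \<Rightarrow> tm \<Rightarrow> fb" where
  "evaluations_step_hyp r n = (sets_only (V_trans n) \<^bold>\<and> evaluations_exist r n)"

text \<open>The axioms of class theory as elements of \<open>fm\<close>, for actual derivations.
  Formulas with quantifiers restricted to sets appear as values of \<open>relativize\<close>; by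
  \<open>C_axiom'_code\<close> the codes of these axioms are axioms in the coded sense.\<close>

definition C_axioms :: "fm set" where
  "C_axioms = set C_finite_axioms \<union>
     {Ex j (All i (Imp (SetF i) (Iff (Mem (Var i) (Var j)) (relativize p)))) | i j p.
       i \<noteq> j \<and> j \<notin> fv p}"

text \<open>The iterated singletons of \<open>Z\<close> are distinct: descending from two equal ones
  would end with a member of \<open>Z\<close>. \<open>P\<close> singles out the elements whose
  singleton is as expected, in class theory the sets.\<close>

lemma (in interp) infinite_carrier:
  assumes "Z \<in> V" "\<And>x y. x \<in> V \<Longrightarrow> y \<in> V \<Longrightarrow> J x y \<in> V" "\<And>z. z \<in> V \<Longrightarrow> \<not> z \<epsilon> Z"
    and "P Z" "\<And>x. x \<in> V \<Longrightarrow> P x \<Longrightarrow> P (J Z x)"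
    and "\<And>y z. y \<in> V \<Longrightarrow> z \<in> V \<Longrightarrow> P y \<Longrightarrow> z \<epsilon> J Z y \<longleftrightarrow> z = y"
  shows "infinite V"
proof -
  define f where "f k = (J Z ^^ k) Z" for k
  have f: "f k \<in> V \<and> P (f k)" for k by (induction k) (use assms in \<open>auto simp: f_def\<close>)
  have "i < j \<Longrightarrow> f i \<noteq> f j" for i j
  proof (induction j arbitrary: i)
    case (Suc j)
    have mem: "z \<epsilon> f (Suc k) \<longleftrightarrow> z = f k" if "z \<in> V" for z k
      using assms(6)[of "f k" z] f[of k] that by (simp add: f_def)
    show ?case
    proof
      assume eq: "f i = f (Suc j)"
      then have "f j \<epsilon> f i" using mem[of "f j" j] f[of j] by simp
      then obtain i' where i': "i = Suc i'" using assms(3)[of "f j"] f by (cases i) (auto simp: f_def)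
      then have "f i' = f j" using mem[of "f i'" i'] mem[of "f i'" j] f eq by metis
      then show False using Suc i' by auto
    qed
  qed simp
  then have "inj f" by (auto simp: inj_def) (metis linorder_neqE_nat)
  moreover have "range f \<subseteq> V" using f by auto
  ultimately show ?thesis using range_inj_infinite infinite_super by blast
qed

section \<open>Models of class theory\<close>

lemma sat_sets_only: "interp.sat E Z J UNIV e (sets_only b d) \<longleftrightarrow> interp.sat E Z J {x. \<exists>y. E x y} e (b d)"
  by (simp add: sets_only_def sat_relativize)

lemma C_axioms_finite: "B \<in> set C_finite_axioms \<Longrightarrow> B \<in> C_axioms"
  by (simp add: C_axioms_def)

lemma class_interp_model:
  assumes sat: "\<And>B e. B \<in> C_axioms \<Longrightarrow> interp.sat E Z J UNIV e B"
  shows "class_interp E Z J {x. \<exists>y. E x y}"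
proof -
  let ?U = "{x. \<exists>y. E x y}"
  interpret full: interp E Z J UNIV .
  interpret interp E Z J ?U .
  have fin: "full.sat e B" if "B \<in> set C_finite_axioms" for B e
    using sat that C_axioms_finite by blast
  have ext: "x = y" if "\<And>z. E z x \<longleftrightarrow> E z y" for x y
    using fin[of "ax_ext 0"] that by (simp add: C_finite_axioms_def ax_ext_def)
  have zero: "\<not> E z Z" for z
    using fin[of "ax_zero 0"] by (simp add: C_finite_axioms_def ax_zero_def)
  have Z_U: "Z \<in> ?U"
    using fin[of "ax_zero_set 0"] by (simp add: C_finite_axioms_def ax_zero_set_def)
  have adj: "E z (J x y) \<longleftrightarrow> E z x \<or> z = y \<and> y \<in> ?U" for x y z
    using fin[of "ax_adj_class 0"] by (simp add: C_finite_axioms_def ax_adj_class_def)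
  have pairing: "\<exists>z\<in>?U. \<forall>w\<in>?U. E w z \<longleftrightarrow> w = x \<or> w = y" if "x \<in> ?U" "y \<in> ?U" for x y
  proof -
    have "sat e (ax_pairing 0)" for e
      using fin[of "sets_only ax_pairing 0"] by (simp add: C_finite_axioms_def sat_sets_only)
    then show ?thesis using that by (simp add: ax_pairing_def)
  qed
  have union: "\<exists>z\<in>?U. \<forall>w\<in>?U. E w z \<longleftrightarrow> (\<exists>v\<in>?U. E w v \<and> E v x)" if "x \<in> ?U" for x
  proof -
    have "sat e (ax_union 0)" for e
      using fin[of "sets_only ax_union 0"] by (simp add: C_finite_axioms_def sat_sets_only)
    then show ?thesis using that by (simp add: ax_union_def)
  qed
  have foundation: "\<exists>y. E y x \<and> \<not> (\<exists>z. E z x \<and> E z y)" if "x \<in> ?U" "E y x" for x y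
  proof -
    have "sat e (ax_foundation 0)" for e
      using fin[of "sets_only ax_foundation 0"] by (simp add: C_finite_axioms_def sat_sets_only)
    then show ?thesis using that by (simp add: ax_foundation_def) blast
  qed
  have J_U: "J x y \<in> ?U" if xy: "x \<in> ?U" "y \<in> ?U" for x y
  proof -
    \<comment> \<open>The adjunction of \<open>y\<close> to \<open>x\<close> is the union of the
      pair of \<open>x\<close> and the singleton \<open>p\<close> of \<open>y\<close>, hence a
      set.\<close>
    obtain p where p: "p \<in> ?U" "\<forall>w\<in>?U. E w p \<longleftrightarrow> w = y" using pairing[OF xy(2) xy(2)] by blast
    obtain q where q: "q \<in> ?U" "\<forall>w\<in>?U. E w q \<longleftrightarrow> w = x \<or> w = p" using pairing[OF xy(1) p(1)] by blast
    obtain z where z: "z \<in> ?U" "\<forall>w\<in>?U. E w z \<longleftrightarrow> (\<exists>v\<in>?U. E w v \<and> E v q)" using union[OF q(1)] by blast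
    have "E w z \<longleftrightarrow> E w (J x y)" for w
    proof (cases "w \<in> ?U")
      case True
      then have "E w z \<longleftrightarrow> (\<exists>v\<in>?U. E w v \<and> E v q)" using z(2) by (rule bspec[rotated])
      also have "\<dots> \<longleftrightarrow> E w x \<or> E w p"
      proof -
        have "E v q \<longleftrightarrow> v = x \<or> v = p" if "v \<in> ?U" for v using q(2) that by (rule bspec)
        then show ?thesis using xy(1) p(1) by (metis (no_types, lifting))
      qed
      finally have "E w z \<longleftrightarrow> E w x \<or> E w p" .
      then show ?thesis using True p xy adj by blast
    next
      case False
      then show ?thesis by blast
    qed
    then have "z = J x y" by (rule ext)
    with z show ?thesis by simp
  qed
  interpret set_interp E Z J ?U
  proof
    show "x = y" if "\<And>z. E z x \<longleftrightarrow> E z y" for x y using ext[OF that] .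
  qed (use Z_U J_U zero adj foundation in auto)
  show ?thesis
  proof
    show "J x y = x" if "y \<notin> ?U" for x y by (rule ext) (use that adj in blast)
    show "\<exists>b\<in>?U. \<forall>y\<in>?U. E y b \<longleftrightarrow> (\<exists>x\<in>?U. E x a \<and> E (pr' x y) F)"
      if F: "\<And>x y z. x \<in> ?U \<Longrightarrow> y \<in> ?U \<Longrightarrow> z \<in> ?U \<Longrightarrow> E (pr' x y) F \<Longrightarrow> E (pr' x z) F \<Longrightarrow> y = z"
      and a: "a \<in> ?U" for F a
    proof -
      have "\<forall>F. (\<forall>x\<in>?U. \<forall>y\<in>?U. \<forall>z\<in>?U. E (pr' x y) F \<and> E (pr' x z) F \<longrightarrow> y = z) \<longrightarrow>
        (\<forall>a\<in>?U. \<exists>b\<in>?U. \<forall>y\<in>?U. E y b \<longleftrightarrow> (\<exists>x\<in>?U. E x a \<and> E (pr' x y) F))"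
        using fin[of "ax_replacement_class 0"]
        by (simp add: C_finite_axioms_def ax_replacement_class_def sat_sets_only)
      then show ?thesis using F a by blast
    qed
    show "\<exists>X. \<forall>x\<in>?U. E x X \<longleftrightarrow> Q x" if Q: "Df (\<lambda>e. Q (e 0))" for Q
    proof -
      have "\<exists>A. \<forall>e. good e \<longrightarrow> sat e A = Q (val e (Var 0))"
        using Q[unfolded Df_def, THEN conjunct2, THEN spec, of "\<lambda>_. Var 0"] by simp
      then obtain A where A: "\<And>e. good e \<Longrightarrow> sat e A \<longleftrightarrow> Q (e 0)" by auto
      obtain N where N: "\<forall>v\<in>fv A. v < N" using finite_fv finite_nat_set_iff_bounded by blast
      \<comment> \<open>The variable for the new class must not occur in \<open>A\<close>, must
        differ from 0, and must be even so as not to displace a parameter.\<close>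
      define j where "j = 2 * (N + 1)"
      have "j \<notin> fv A"
      proof
        assume "j \<in> fv A"
        then have "j < N" using N by blast
        then show False by (simp add: j_def)
      qed
      moreover have "j \<noteq> 0" "even j" by (simp_all add: j_def)
      ultimately have j: "j \<notin> fv A" "j \<noteq> 0" "even j" by blast+
      obtain e where e: "good e" using ex_good by blast
      have "full.sat e (Ex j (All 0 (Imp (SetF 0) (Iff (Mem (Var 0) (Var j)) (relativize A)))))"
        by (rule sat) (use j in \<open>auto simp: C_axioms_def\<close>)
      then obtain X where X: "\<forall>a. (\<exists>y. E a y) \<longrightarrow> (E a X \<longleftrightarrow> full.sat (e(j := X, 0 := a)) (relativize A))"
        by (auto simp: sat_SetF simp del: fun_upd_apply) (auto simp: j)
      have "full.sat (e(j := X, 0 := a)) (relativize A) \<longleftrightarrow> Q a" for a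
      proof -
        have "sat (e(j := X, 0 := a)) A = sat (e(0 := a)) A"
          by (rule sat_cong) (use j in auto)
        then show ?thesis using A[of "e(0 := a)"] good_upd[OF e] by (simp add: sat_relativize)
      qed
      then show ?thesis using X by blast
    qed
  qed simp
qed

text \<open>Pairing makes the singleton of a set a set, so adjoining to \<open>Z\<close> can be
  iterated within the sets. The carrier is still arbitrary here.\<close>

lemma C_axioms_infinite:
  fixes E :: "nat \<Rightarrow> nat \<Rightarrow> bool"
  assumes V: "Z \<in> V" "\<And>x y. x \<in> V \<Longrightarrow> y \<in> V \<Longrightarrow> J x y \<in> V"
    and sat: "\<And>B e. B \<in> C_axioms \<Longrightarrow> range e \<subseteq> V \<Longrightarrow> interp.sat E Z J V e B"
  shows "infinite V"
proof -
  interpret interp E Z J V .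
  have fin: "sat (\<lambda>_. Z) B" if "B \<in> set C_finite_axioms" for B
    by (rule sat) (use that V C_axioms_finite in auto)
  have ext: "x = y" if "x \<in> V" "y \<in> V" "\<forall>z\<in>V. E z x \<longleftrightarrow> E z y" for x y
    using fin[of "ax_ext 0"] that by (simp add: C_finite_axioms_def ax_ext_def)
  have zero: "\<forall>z\<in>V. \<not> E z Z"
    using fin[of "ax_zero 0"] by (simp add: C_finite_axioms_def ax_zero_def)
  have Z_set: "\<exists>w\<in>V. E Z w"
    using fin[of "ax_zero_set 0"] by (simp add: C_finite_axioms_def ax_zero_set_def)
  have adj: "E z (J x y) \<longleftrightarrow> E z x \<or> z = y \<and> (\<exists>w\<in>V. E y w)" if "x \<in> V" "y \<in> V" "z \<in> V" for x y z
    using fin[of "ax_adj_class 0"] that by (simp add: C_finite_axioms_def ax_adj_class_def)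
  have pairing: "\<exists>z\<in>V. (\<exists>w\<in>V. E z w) \<and> (\<forall>w\<in>V. (\<exists>v\<in>V. E w v) \<longrightarrow> (E w z \<longleftrightarrow> w = x))"
    if x: "x \<in> V" "\<exists>w\<in>V. E x w" for x
  proof -
    let ?W = "{x \<in> V. \<exists>y\<in>V. E x y}"
    interpret W: interp E Z J ?W .
    have "W.sat (\<lambda>_. Z) (ax_pairing 0)"
      using fin[of "sets_only ax_pairing 0"]
      by (simp add: C_finite_axioms_def sets_only_def sat_relativize_carrier)
    then have all: "\<forall>x\<in>?W. \<forall>y\<in>?W. \<exists>z\<in>?W. \<forall>w\<in>?W. E w z \<longleftrightarrow> w = x \<or> w = y"
      by (simp only: ax_pairing_def W.sat_bold) simp
    have "x \<in> ?W" using x by blast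
    from bspec[OF bspec[OF all this] this] show ?thesis by simp blast
  qed
  show ?thesis
  proof (rule infinite_carrier[where P = "\<lambda>x. \<exists>w\<in>V. E x w"])
    fix x assume x: "x \<in> V" "\<exists>w\<in>V. E x w"
    then obtain z where z: "z \<in> V" "\<exists>w\<in>V. E z w" "\<forall>w\<in>V. (\<exists>v\<in>V. E w v) \<longrightarrow> (E w z \<longleftrightarrow> w = x)"
      using pairing by blast
    have "z = J Z x" by (rule ext) (use z x V adj zero in blast)+
    then show "\<exists>w\<in>V. E (J Z x) w" using z by simp
  qed (use V zero Z_set adj in auto)
qed

lemma C_complete:
  assumes "\<And>(E :: nat \<Rightarrow> nat \<Rightarrow> bool) Z J e. class_interp E Z J {x. \<exists>y. E x y} \<Longrightarrow>
    interp.sat E Z J UNIV e A"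
  shows "C_axioms \<turnstile> A"
proof (rule completeness)
  show "infinite V" if "Z \<in> V" "\<And>x y. x \<in> V \<Longrightarrow> y \<in> V \<Longrightarrow> J x y \<in> V"
    "\<And>B e. B \<in> C_axioms \<Longrightarrow> range e \<subseteq> V \<Longrightarrow> interp.sat E Z J V e B"
    for E :: "nat \<Rightarrow> nat \<Rightarrow> bool" and Z J V
    by (rule C_axioms_infinite[OF that])
  show "interp.sat E Z J UNIV e A" if "\<And>B e. B \<in> C_axioms \<Longrightarrow> interp.sat E Z J UNIV e B"
    for E :: "nat \<Rightarrow> nat \<Rightarrow> bool" and Z J e
    by (rule assms[OF class_interp_model[OF that]])
qed

section \<open>The three derivations in class theory\<close>

lemma sat_evaluations_step_hyp:
  "interp.sat E Z J UNIV e (evaluations_step_hyp (Var 0) (Var 1) 2) \<longleftrightarrow>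
     interp.V_trans' E Z J {x. \<exists>y. E x y} (e 1) \<and>
     (\<forall>D I. interp.is_structure' E Z J {x. \<exists>y. E x y} (e 0) D I \<longrightarrow>
       (\<exists>F. interp.evaluation' E Z J {x. \<exists>y. E x y} (interp.V_expr' E Z J {x. \<exists>y. E x y} (e 0) (e 1)) (e 0) D I F))"
proof -
  interpret full: interp E Z J UNIV .
  interpret interp E Z J "{x. \<exists>y. E x y}" .
  show ?thesis
    by (simp add: evaluations_step_hyp_def evaluations_exist_def sat_sets_only sat_evaluation)
qed

lemma sat_Theta:
  "interp.sat E Z J UNIV e Theta \<longleftrightarrow>
     (\<forall>D I. interp.is_structure' E Z J {x. \<exists>y. E x y} (e 0) D I \<longrightarrow>
       (\<exists>S F. interp.evaluation' E Z J {x. \<exists>y. E x y} (interp.Phi' E Z J {x. \<exists>y. E x y} (e 0) (e 1)) (e 0) D I F \<and>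
         (\<forall>x\<in>{x. \<exists>y. E x y}. E x S \<longleftrightarrow> (\<exists>p\<in>{x. \<exists>y. E x y}. \<exists>A\<in>{x. \<exists>y. E x y}. x = interp.pr' Z J p A \<and>
           interp.is_formula' E Z J {x. \<exists>y. E x y} (e 0) p \<and> E (interp.pr' Z J x (interp.num' Z J 1)) F))))"
proof -
  interpret full: interp E Z J UNIV .
  interpret interp E Z J "{x. \<exists>y. E x y}" .
  show ?thesis
    by (simp add: Theta_def satisfaction_exists_def satisfaction_relation_def sat_sets_only sat_evaluation)
qed

text \<open>Zero enters by an equation and not by substitution, so that \<theta> remains literally
  the same formula. After coding, the equation becomes an instance of reflexivity.\<close>

theorem C_step_zero:
  "C_axioms \<turnstile> All 0 (All 1 (Imp (Eq (Var 1) Zero) (evaluations_step_hyp (Var 0) (Var 1) 2)))" (is "_ \<turnstile> ?A")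
proof (rule C_complete)
  fix E :: "nat \<Rightarrow> nat \<Rightarrow> bool" and Z J e
  assume "class_interp E Z J {x. \<exists>y. E x y}"
  then interpret class_interp E Z J "{x. \<exists>y. E x y}" .
  interpret full: interp E Z J UNIV .
  show "full.sat e ?A"
    using V_trans'_zero evaluation_zero
    by (auto simp: sat_evaluations_step_hyp simp del: One_nat_def)
qed

text \<open>Variable 1 is bound anew after its successor has been stored in variable 2. The
  conclusion is thus \<theta> itself, and no compound term has to be substituted into it.\<close>

theorem C_step_succ:
  "C_axioms \<turnstile> All 0 (All 1 (Imp (evaluations_step_hyp (Var 0) (Var 1) 2)
     (All 2 (Imp (Eq (Var 2) (succ (Var 1)))
       (All 1 (Imp (Eq (Var 1) (Var 2)) (evaluations_step_hyp (Var 0) (Var 1) 2)))))))" (is "_ \<turnstile> ?A")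
proof (rule C_complete)
  fix E :: "nat \<Rightarrow> nat \<Rightarrow> bool" and Z J e
  assume "class_interp E Z J {x. \<exists>y. E x y}"
  then interpret class_interp E Z J "{x. \<exists>y. E x y}" .
  interpret full: interp E Z J UNIV .
  have "(\<forall>D I. is_structure' r D I \<longrightarrow> (\<exists>F. evaluation' (V_expr' r n) r D I F)) \<Longrightarrow> V_trans' n \<Longrightarrow>
    V_trans' (succ' n) \<and> (\<forall>D I. is_structure' r D I \<longrightarrow> (\<exists>F. evaluation' (V_expr' r (succ' n)) r D I F))"
    for r n
  \<comment> \<open>Variable 1 ranges over all classes. To adjoin a proper class changes nothing, so
    in that case the step is trivial.\<close>
  proof (cases "\<exists>y. E n y")
    case False
    then have "succ' n = n" unfolding succ'_def using J_class[of n n] by simp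
    then show "(\<forall>D I. is_structure' r D I \<longrightarrow> (\<exists>F. evaluation' (V_expr' r n) r D I F)) \<Longrightarrow> V_trans' n \<Longrightarrow>
        V_trans' (succ' n) \<and> (\<forall>D I. is_structure' r D I \<longrightarrow> (\<exists>F. evaluation' (V_expr' r (succ' n)) r D I F))"
      by simp
  qed (use V_trans'_succ evaluation_step in blast)
  then show "full.sat e ?A"
    by (simp add: sat_evaluations_step_hyp del: One_nat_def) blast
qed

theorem C_step_Theta:
  "C_axioms \<turnstile> All 0 (All 1 (Imp (evaluations_step_hyp (Var 0) (Var 1) 2) Theta))" (is "_ \<turnstile> ?A")
proof (rule C_complete)
  fix E :: "nat \<Rightarrow> nat \<Rightarrow> bool" and Z J e
  assume "class_interp E Z J {x. \<exists>y. E x y}"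
  then interpret class_interp E Z J "{x. \<exists>y. E x y}" .
  interpret full: interp E Z J UNIV .
  let ?U = "{x. \<exists>y. E x y}"
  have "\<exists>S F. evaluation' (Phi' r n) r D I F \<and> (\<forall>x\<in>?U. E x S \<longleftrightarrow>
      (\<exists>p\<in>?U. \<exists>A\<in>?U. x = pr' p A \<and> is_formula' r p \<and> E (pr' x (num' 1)) F))"
    if F: "evaluation' (V_expr' r n) r D I F" for r n D I F
  proof -
    obtain G where G: "evaluation' (Phi' r n) r D I G" using evaluation_Phi[OF F] by blast
    have "Df (\<lambda>e. \<exists>p\<in>?U. \<exists>A\<in>?U. e 0 = pr' p A \<and> is_formula' r p \<and> E (pr' (e 0) (num' 1)) G)"
      by (intro Df_intros)
    from comprehension[OF this] G show ?thesis by blast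
  qed
  then show "full.sat e ?A"
    by (simp only: full.sat.simps sat_evaluations_step_hyp sat_Theta) blast
qed

section \<open>Elementary set theory without Infinity\<close>

locale zf_interp = set_interp E Z J UNIV for E :: "'a :: countable \<Rightarrow> 'a \<Rightarrow> bool" (infix "\<epsilon>" 50) and Z J +
  assumes union: "\<exists>y. \<forall>z. z \<epsilon> y \<longleftrightarrow> (\<exists>w. z \<epsilon> w \<and> w \<epsilon> x)"
    and power: "\<exists>y. \<forall>z. z \<epsilon> y \<longleftrightarrow> subset_of' z x"
    and replacement: "Df (\<lambda>e. Q (e 0) (e (Suc 0))) \<Longrightarrow> (\<And>x y z. x \<epsilon> a \<Longrightarrow> Q x y \<Longrightarrow> Q x z \<Longrightarrow> y = z) \<Longrightarrow>
      \<exists>b. \<forall>y. y \<epsilon> b \<longleftrightarrow> (\<exists>x. x \<epsilon> a \<and> Q x y)"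
begin

declare ball_UNIV [simp] bex_UNIV [simp]

lemmas Df_UNIV [Df_intros] = Df_all[OF refl] Df_ex[OF refl]

lemma separation:
  assumes "Df (\<lambda>e. Q (e 0))"
  shows "\<exists>b. \<forall>y. y \<epsilon> b \<longleftrightarrow> y \<epsilon> a \<and> Q y"
proof -
  have Q: "Tm t \<Longrightarrow> Df (\<lambda>e. Q (t e))" for t by (rule Df_subst1[OF assms])
  have "Df (\<lambda>e. e 0 = e (Suc 0) \<and> Q (e 0))" by (intro Df_intros Q)
  from replacement[OF this, of a] show ?thesis by auto
qed

definition un :: "'a \<Rightarrow> 'a \<Rightarrow> 'a" where
  "un x y = (SOME u. \<forall>z. z \<epsilon> u \<longleftrightarrow> z \<epsilon> x \<or> z \<epsilon> y)"

lemma mem_un [simp]: "z \<epsilon> un x y \<longleftrightarrow> z \<epsilon> x \<or> z \<epsilon> y"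
proof -
  have "\<exists>u. \<forall>z. z \<epsilon> u \<longleftrightarrow> z \<epsilon> x \<or> z \<epsilon> y" using union[of "J (J Z x) y"] by auto
  from someI_ex[OF this] show ?thesis unfolding un_def by blast
qed

lemma trans_set'_iff: "trans_set' x \<longleftrightarrow> (\<forall>y z. y \<epsilon> x \<longrightarrow> z \<epsilon> y \<longrightarrow> z \<epsilon> x)"
  by (auto simp: trans_set'_def subset_of'_def)

lemma fin_ord'_iff: "fin_ord' n \<longleftrightarrow> trans_set' n \<and> (\<forall>m. m \<epsilon> n \<longrightarrow> trans_set' m) \<and>
    (\<forall>m. m \<epsilon> n \<or> m = n \<longrightarrow> m = Z \<or> (\<exists>k. m = succ' k))"
  by (simp add: fin_ord'_def)

lemma fin_ord'_zero [simp]: "fin_ord' Z"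
  by (simp add: fin_ord'_iff trans_set'_iff)

lemma trans_set'_succ: "trans_set' n \<Longrightarrow> trans_set' (succ' n)"
  unfolding trans_set'_iff by (simp only: mem_succ'[OF UNIV_I]) blast

lemma fin_ord'_succ [simp]: "fin_ord' n \<Longrightarrow> fin_ord' (succ' n)"
  unfolding fin_ord'_iff by (simp only: mem_succ'[OF UNIV_I]) (metis trans_set'_succ)

lemma fin_ord'_mem:
  assumes "fin_ord' n" "m \<epsilon> n"
  shows "fin_ord' m"
proof -
  have "k \<epsilon> n" if "k \<epsilon> m" for k
    using assms that unfolding fin_ord'_iff trans_set'_iff by blast
  then show ?thesis using assms unfolding fin_ord'_iff by blast
qed

lemma fin_ord'_num [simp]: "fin_ord' (num' k)"
  by (induction k) (simp_all add: num'.simps)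

lemma fin_ord'_trans: "fin_ord' n \<Longrightarrow> y \<epsilon> n \<Longrightarrow> z \<epsilon> y \<Longrightarrow> z \<epsilon> n"
  unfolding fin_ord'_def trans_set'_iff by blast

lemma fin_ord'_cases:
  assumes "fin_ord' n"
  obtains "n = Z" | k where "n = succ' k" "fin_ord' k"
proof -
  have "n = Z \<or> (\<exists>k. n = succ' k)" using assms unfolding fin_ord'_def by auto
  then show thesis using that fin_ord'_mem[OF assms] by auto
qed

text \<open>A least counterexample is taken inside the model, which may be nonstandard; separation
  has to supply the set of counterexamples, hence the demand that \<open>P\<close> be
  definable.\<close>

lemma fin_ord'_induct:
  assumes Df: "Df (\<lambda>e. P (e 0))" and "fin_ord' n" "P Z" "\<And>k. fin_ord' k \<Longrightarrow> P k \<Longrightarrow> P (succ' k)"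
  shows "P n"
proof (rule ccontr)
  assume "\<not> P n"
  obtain b where b: "\<And>m. m \<epsilon> b \<longleftrightarrow> m \<epsilon> succ' n \<and> \<not> P m"
    using separation[OF Df_not[OF Df], of "succ' n"] by blast
  then have "n \<epsilon> b" using \<open>\<not> P n\<close> by simp
  then obtain m where m: "m \<epsilon> b" "\<not> (\<exists>z. z \<epsilon> b \<and> z \<epsilon> m)" using foundation[of b n] by auto
  then have m': "m \<epsilon> succ' n" "\<not> P m" using b by auto
  have FO: "fin_ord' (succ' n)" using assms(2) by simp
  from fin_ord'_mem[OF FO m'(1)] show False
  proof (cases rule: fin_ord'_cases)
    case 1
    then show False using m'(2) assms(3) by simp
  next
    case (2 k)
    then have "k \<epsilon> m" by simp
    then have "P k" using m b fin_ord'_trans[OF FO m'(1)] by blast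
    then show False using 2 m'(2) assms(4) by simp
  qed
qed

section \<open>Coded syntax in set theory\<close>

text \<open>The shape of the notions of coded syntax that are defined by the existence of a set \<open>T\<close>.\<close>

definition justified :: "('a \<Rightarrow> 'a \<Rightarrow> bool) \<Rightarrow> 'a \<Rightarrow> bool" where
  "justified \<Phi> e = (\<exists>T. e \<epsilon> T \<and> (\<forall>d. d \<epsilon> T \<longrightarrow> \<Phi> T d))"

text \<open>The union of two justifying sets together with \<open>e\<close> is again justifying,
  since a monotone \<open>\<Phi>\<close> keeps the old members justified.\<close>

lemma justified_step:
  assumes "justified \<Phi> a" "justified \<Phi> b"
    and mono': "\<forall>T T' d. (\<forall>x. x \<epsilon> T \<longrightarrow> x \<epsilon> T') \<longrightarrow> \<Phi> T d \<longrightarrow> \<Phi> T' d" and step: "\<Phi> (J (J Z a) b) e"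
  shows "justified \<Phi> e"
proof -
  note mono = mono'[rule_format]
  obtain T T' where T: "a \<epsilon> T" "\<forall>d. d \<epsilon> T \<longrightarrow> \<Phi> T d" "b \<epsilon> T'" "\<forall>d. d \<epsilon> T' \<longrightarrow> \<Phi> T' d"
    using assms unfolding justified_def by blast
  let ?U = "J (un T T') e"
  have "\<Phi> ?U d" if "d \<epsilon> ?U" for d
  proof -
    consider "d \<epsilon> T" | "d \<epsilon> T'" | "d = e" using \<open>d \<epsilon> ?U\<close> by auto
    then show ?thesis
    proof cases
      case 1
      then show ?thesis using T by (intro mono[of T ?U d]) auto
    next
      case 2
      then show ?thesis using T by (intro mono[of T' ?U d]) auto
    next
      case 3
      then show ?thesis using T step by (intro mono[of "J (J Z a) b" ?U d]) auto
    qed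
  qed
  then show ?thesis unfolding justified_def by (intro exI[of _ ?U]) simp
qed

lemma justified_base:
  assumes "\<And>T. \<Phi> T e" shows "justified \<Phi> e"
  unfolding justified_def using assms by (intro exI[of _ "J Z e"]) simp

lemma is_term'_justified: "is_term' r = justified (\<lambda>T d. is_var' d \<or>
    (\<exists>f m a. fun_symbol' r f m \<and> tuple' a m T \<and> d = cFun' f a))"
  by (simp add: fun_eq_iff is_term'_def justified_def)

lemma is_formula'_justified: "is_formula' r = justified (\<lambda>T d. is_atomic' r d \<or>
    (\<exists>p q. p \<epsilon> T \<and> q \<epsilon> T \<and> d = cImp' p q) \<or> (\<exists>v p. is_var' v \<and> p \<epsilon> T \<and> d = cAll' v p))"
  by (simp add: fun_eq_iff is_formula'_def justified_def)

lemma is_predicative'_justified: "is_predicative' = justified (\<lambda>T d. is_atomic' lang' d \<or>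
    (\<exists>p q. p \<epsilon> T \<and> q \<epsilon> T \<and> d = cImp' p q) \<or>
    (\<exists>i p. fin_ord' i \<and> p \<epsilon> T \<and> d = cAll' (cVar' i) (cImp' (cSet' i) p)))"
  by (simp add: fun_eq_iff is_predicative'_def justified_def)

lemma is_var'_iff: "is_var' v \<longleftrightarrow> (\<exists>i. fin_ord' i \<and> v = cVar' i)"
  by (simp add: is_var'_def)

lemma is_var'_num [simp]: "is_var' (cVar' (num' i))"
  by (auto simp: is_var'_iff)

lemma num'_2: "z \<epsilon> num' 2 \<longleftrightarrow> z = num' 0 \<or> z = num' 1"
proof -
  have "num' 2 = succ' (succ' Z)" "num' 1 = succ' Z" "num' 0 = Z"
    by (simp_all add: num'.simps numeral_2_eq_2)
  then show ?thesis by auto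
qed

lemma pair_tuple'_mem [simp]: "pr' i x \<epsilon> pair_tuple' s t \<longleftrightarrow> i = num' 0 \<and> x = s \<or> i = num' 1 \<and> x = t"
  by (auto simp: pair_tuple'_def)

lemma is_fun'_pair_tuple [simp]: "is_fun' (pair_tuple' s t)"
  unfolding is_fun'_def by (simp only: ball_UNIV bex_UNIV pair_tuple'_mem) (auto simp: pair_tuple'_def)

lemma in_dom'_pair_tuple [simp]: "in_dom' i (pair_tuple' s t) \<longleftrightarrow> i = num' 0 \<or> i = num' 1"
  by (auto simp: in_dom'_def)

lemma fun_on'_pair_tuple [simp]: "fun_on' (pair_tuple' s t) (num' 2)"
  by (simp add: fun_on'_def num'_2)

lemma lang'_symbols:
  "rel_symbol' lang' (num' 0) (num' 2)" "fun_symbol' lang' (num' 1) (num' 0)" "fun_symbol' lang' (num' 2) (num' 2)"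
  by (simp_all add: rel_symbol'_def fun_symbol'_def lang'_def)

section \<open>Closure of coded terms and formulas under their operations\<close>

lemma is_term'_var: "is_var' v \<Longrightarrow> is_term' r v"
  unfolding is_term'_justified by (rule justified_base) simp

lemma is_term'_zero: "is_term' lang' cZero'"
  unfolding is_term'_justified
proof (rule justified_base, rule disjI2)
  fix T
  have "tuple' Z (num' 0) T" by (simp add: tuple'_def fun_on'_def is_fun'_def in_dom'_def num'.simps)
  then show "\<exists>f m a. fun_symbol' lang' f m \<and> tuple' a m T \<and> cZero' = cFun' f a"
    using lang'_symbols unfolding cZero'_def by blast
qed

lemma tuple'_mono: "(\<And>x. x \<epsilon> T \<Longrightarrow> x \<epsilon> T') \<Longrightarrow> tuple' a m T \<Longrightarrow> tuple' a m T'"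
  unfolding tuple'_def by blast

lemma is_term'_adj:
  assumes "is_term' lang' s" "is_term' lang' t"
  shows "is_term' lang' (cAdj' s t)"
  using assms unfolding is_term'_justified
proof (rule justified_step)
  have "tuple' (pair_tuple' s t) (num' 2) (J (J Z s) t)"
    by (auto simp: tuple'_def)
  then show "is_var' (cAdj' s t) \<or>
      (\<exists>f m a. fun_symbol' lang' f m \<and> tuple' a m (J (J Z s) t) \<and> cAdj' s t = cFun' f a)"
    using lang'_symbols unfolding cAdj'_def by blast
qed (use tuple'_mono in blast)

lemma is_atomic'_intros:
  assumes "is_term' lang' s" "is_term' lang' t"
  shows "is_atomic' lang' (cMem' s t)" "is_atomic' lang' (cEq' s t)" "is_atomic' r cFls'"
proof -
  show "is_atomic' lang' (cMem' s t)" unfolding is_atomic'_def cMem'_def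
    by (intro disjI1 bexI[of _ "num' 0"] bexI[of _ "num' 2"] bexI[of _ "pair_tuple' s t"])
      (use assms lang'_symbols in auto)
qed (use assms in \<open>auto simp: is_atomic'_def\<close>)

lemma is_formula'_atomic: "is_atomic' r e \<Longrightarrow> is_formula' r e"
  unfolding is_formula'_justified by (rule justified_base) simp

lemma is_formula'_imp: "is_formula' r p \<Longrightarrow> is_formula' r q \<Longrightarrow> is_formula' r (cImp' p q)"
  unfolding is_formula'_justified
  by (rule justified_step[where a = p and b = q]) (assumption, assumption, blast, simp)

lemma is_formula'_all: "is_var' v \<Longrightarrow> is_formula' r p \<Longrightarrow> is_formula' r (cAll' v p)"
  unfolding is_formula'_justified
  by (rule justified_step[where a = p and b = p]) (assumption, assumption, blast, simp)

lemma is_predicative'_atomic: "is_atomic' lang' e \<Longrightarrow> is_predicative' e"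
  unfolding is_predicative'_justified by (rule justified_base) simp

lemma is_predicative'_imp: "is_predicative' p \<Longrightarrow> is_predicative' q \<Longrightarrow> is_predicative' (cImp' p q)"
  unfolding is_predicative'_justified
  by (rule justified_step[where a = p and b = q]) (assumption, assumption, blast, simp)

lemma is_predicative'_all:
  "fin_ord' i \<Longrightarrow> is_predicative' p \<Longrightarrow> is_predicative' (cAll' (cVar' i) (cImp' (cSet' i) p))"
  unfolding is_predicative'_justified
  by (rule justified_step[where a = p and b = p]) (assumption, assumption, blast, auto)

lemma imm_part'_simps [simp]:
  "\<not> imm_part' c (cVar' i)" "imm_part' c (cFun' s a) \<longleftrightarrow> (\<exists>i. pr' i c \<epsilon> a)"
  "imm_part' c (cRel' s a) \<longleftrightarrow> (\<exists>i. pr' i c \<epsilon> a)" "imm_part' c (cEq' s t) \<longleftrightarrow> c = s \<or> c = t"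
  "\<not> imm_part' c cFls'" "imm_part' c (cImp' s t) \<longleftrightarrow> c = s \<or> c = t" "imm_part' c (cAll' v t) \<longleftrightarrow> c = t"
  by (auto simp: imm_part'_def)

lemma free_in'_cases:
  "free_in' v e \<Longrightarrow> e = v \<or> (\<exists>c. imm_part' c e \<and> free_in' v c \<and> \<not> (\<exists>p. e = cAll' v p))"
  unfolding free_in'_def by auto

text \<open>A free occurrence is a path from the top of \<open>e\<close>, so its absence is checked
  at the immediate parts; below a quantifier over \<open>v\<close> there is nothing to
  check.\<close>

lemma not_free_in'I:
  "e \<noteq> v \<Longrightarrow> (\<And>c. imm_part' c e \<Longrightarrow> \<forall>p. e \<noteq> cAll' v p \<Longrightarrow> \<not> free_in' v c) \<Longrightarrow> \<not> free_in' v e"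
  using free_in'_cases by blast

lemma not_free_in':
  assumes "is_var' v"
  shows "cVar' i \<noteq> v \<Longrightarrow> \<not> free_in' v (cVar' i)" "\<not> free_in' v cZero'" "\<not> free_in' v cFls'"
    "\<not> free_in' v s \<Longrightarrow> \<not> free_in' v t \<Longrightarrow> \<not> free_in' v (cAdj' s t)"
    "\<not> free_in' v s \<Longrightarrow> \<not> free_in' v t \<Longrightarrow> \<not> free_in' v (cMem' s t)"
    "\<not> free_in' v s \<Longrightarrow> \<not> free_in' v t \<Longrightarrow> \<not> free_in' v (cEq' s t)"
    "\<not> free_in' v s \<Longrightarrow> \<not> free_in' v t \<Longrightarrow> \<not> free_in' v (cImp' s t)"
    "\<not> free_in' v t \<Longrightarrow> \<not> free_in' v (cAll' w t)" "\<not> free_in' v (cAll' v t)"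
  by (rule not_free_in'I; use assms in \<open>auto simp: is_var'_iff cZero'_def cAdj'_def cMem'_def\<close>)+

text \<open>
  The code of a term or formula in which elements of the model, meant to be codes of terms, are
  substituted for the free variables.
\<close>

primrec ctm :: "(nat \<Rightarrow> 'a) \<Rightarrow> tm \<Rightarrow> 'a" where
  "ctm \<sigma> (Var i) = \<sigma> i"
| "ctm \<sigma> Zero = cZero'"
| "ctm \<sigma> (Adj s t) = cAdj' (ctm \<sigma> s) (ctm \<sigma> t)"

fun cfm :: "(nat \<Rightarrow> 'a) \<Rightarrow> fm \<Rightarrow> 'a" where
  "cfm \<sigma> (Mem s t) = cMem' (ctm \<sigma> s) (ctm \<sigma> t)"
| "cfm \<sigma> (Eq s t) = cEq' (ctm \<sigma> s) (ctm \<sigma> t)"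
| "cfm \<sigma> Fls = cFls'"
| "cfm \<sigma> (Imp A B) = cImp' (cfm \<sigma> A) (cfm \<sigma> B)"
| "cfm \<sigma> (All x A) = cAll' (cVar' (num' x)) (cfm (\<sigma>(x := cVar' (num' x))) A)"

abbreviation cvars :: "nat \<Rightarrow> 'a" where "cvars \<equiv> \<lambda>i. cVar' (num' i)"

lemma cvars_upd [simp]: "cvars(x := cVar' (num' x)) = cvars"
  by auto

lemma val_code_tm [simp]: "val e (code_tm t) = ctm cvars t"
  by (induction t) simp_all

lemma val_code_fm [simp]: "val e (code_fm A) = cfm cvars A"
  by (induction A) (simp_all del: fun_upd_apply)

lemma ctm_cong: "(\<And>i. i \<in> vars t \<Longrightarrow> \<sigma> i = \<tau> i) \<Longrightarrow> ctm \<sigma> t = ctm \<tau> t"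
  by (induction t) auto

lemma cfm_cong: "(\<And>i. i \<in> fv A \<Longrightarrow> \<sigma> i = \<tau> i) \<Longrightarrow> cfm \<sigma> A = cfm \<tau> A"
proof (induction A arbitrary: \<sigma> \<tau>)
  case (All x A)
  have "cfm (\<sigma>(x := cVar' (num' x))) A = cfm (\<tau>(x := cVar' (num' x))) A"
    by (rule All.IH) (use All.prems in auto)
  then show ?case by simp
next
  case (Imp A B)
  have "cfm \<sigma> A = cfm \<tau> A" "cfm \<sigma> B = cfm \<tau> B" by (rule Imp.IH; use Imp.prems in auto)+
  then show ?case by simp
next
  case (Mem s t)
  have "ctm \<sigma> s = ctm \<tau> s" "ctm \<sigma> t = ctm \<tau> t" by (rule ctm_cong; use Mem in auto)+
  then show ?case by simp
next
  case (Eq s t)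
  have "ctm \<sigma> s = ctm \<tau> s" "ctm \<sigma> t = ctm \<tau> t" by (rule ctm_cong; use Eq in auto)+
  then show ?case by simp
qed simp

lemma is_term'_ctm: "(\<And>i. i \<in> vars t \<Longrightarrow> is_term' lang' (\<sigma> i)) \<Longrightarrow> is_term' lang' (ctm \<sigma> t)"
  by (induction t) (auto intro: is_term'_zero is_term'_adj)

lemma is_formula'_cfm: "(\<And>i. i \<in> fv A \<Longrightarrow> is_term' lang' (\<sigma> i)) \<Longrightarrow> is_formula' lang' (cfm \<sigma> A)"
proof (induction A arbitrary: \<sigma>)
  case (All x A)
  have "is_formula' lang' (cfm (\<sigma>(x := cVar' (num' x))) A)"
    by (rule All.IH) (use All.prems in \<open>auto intro: is_term'_var\<close>)
  then show ?case by (simp add: is_formula'_all)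
next
  case (Imp A B)
  then show ?case by (simp add: is_formula'_imp)
next
  case (Mem s t)
  then show ?case by (simp add: is_formula'_atomic is_atomic'_intros is_term'_ctm)
next
  case (Eq s t)
  then show ?case by (simp add: is_formula'_atomic is_atomic'_intros is_term'_ctm)
qed (simp add: is_formula'_atomic is_atomic'_def)

lemma free_in'_cvarD: "free_in' (cVar' (num' i)) (cVar' (num' j)) \<Longrightarrow> i = j"
  using not_free_in'(1)[of "cVar' (num' i)" "num' j"] by auto

lemma not_free_in'_ctm: "is_var' v \<Longrightarrow> (\<And>i. i \<in> vars t \<Longrightarrow> \<not> free_in' v (\<sigma> i)) \<Longrightarrow> \<not> free_in' v (ctm \<sigma> t)"
  by (induction t) (auto simp: not_free_in')

lemma not_free_in'_cfm: "is_var' v \<Longrightarrow> (\<And>i. i \<in> fv A \<Longrightarrow> \<not> free_in' v (\<sigma> i)) \<Longrightarrow> \<not> free_in' v (cfm \<sigma> A)"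
proof (induction A arbitrary: \<sigma>)
  case (All x A)
  show ?case
  proof (cases "v = cVar' (num' x)")
    case True
    then show ?thesis using All.prems by (simp add: not_free_in')
  next
    case False
    have "\<not> free_in' v (cfm (\<sigma>(x := cVar' (num' x))) A)"
      by (rule All.IH) (use All.prems False in \<open>auto simp: not_free_in'\<close>)
    then show ?thesis using All.prems by (simp add: not_free_in')
  qed
qed (auto simp: not_free_in' not_free_in'_ctm)

lemma not_free_in'_code: "x \<notin> fv A \<Longrightarrow> \<not> free_in' (cVar' (num' x)) (cfm cvars A)"
  by (rule not_free_in'_cfm) (auto dest!: free_in'_cvarD)

lemma ctm_subst: "ctm \<sigma> (subst_tm x t s) = ctm (\<sigma>(x := ctm \<sigma> t)) s"
  by (induction s) auto

text \<open>Substitution before coding amounts to an update of \<open>\<sigma>\<close>; by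
  \<open>free_for\<close> the updates made at binders do not affect the value of
  \<open>t\<close>.\<close>

lemma cfm_subst: "free_for x t A \<Longrightarrow> cfm \<sigma> (subst x t A) = cfm (\<sigma>(x := ctm \<sigma> t)) A"
proof (induction A arbitrary: \<sigma>)
  case (All y A)
  consider "x \<notin> fv (All y A)" | "x \<noteq> y" "y \<notin> vars t" "free_for x t A" using All.prems by auto
  then show ?case
  proof cases
    case 1
    have "cfm \<sigma> (All y A) = cfm (\<sigma>(x := ctm \<sigma> t)) (All y A)" by (rule cfm_cong) (use 1 in auto)
    then show ?thesis unfolding subst_id[OF 1] .
  next
    case 2
    have "ctm (\<sigma>(y := cVar' (num' y))) t = ctm \<sigma> t" by (rule ctm_cong) (use 2 in auto)
    moreover have "\<sigma>(y := cVar' (num' y), x := ctm \<sigma> t) = \<sigma>(x := ctm \<sigma> t, y := cVar' (num' y))"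
      using 2(1) by auto
    ultimately show ?thesis using All.IH[OF 2(3)] 2(1) by (simp del: fun_upd_apply)
  qed
qed (simp_all add: ctm_subst)

subsection \<open>Coded substitution\<close>

definition subst_clause :: "'a \<Rightarrow> 'a \<Rightarrow> 'a \<Rightarrow> 'a \<Rightarrow> bool" where
  "subst_clause v t T x = (\<exists>c c'. x = pr' c c' \<and> (
     (c = v \<and> c' = t) \<or>
     (\<not> free_in' v c \<and> c' = c) \<or>
     (\<exists>s a a'.
        ((c = cFun' s a \<and> c' = cFun' s a') \<or> (c = cRel' s a \<and> c' = cRel' s a')) \<and>
        is_fun' a \<and> is_fun' a' \<and> (\<forall>i. in_dom' i a \<longleftrightarrow> in_dom' i a') \<and>
        (\<forall>i y y'. pr' i y \<epsilon> a \<and> pr' i y' \<epsilon> a' \<longrightarrow> pr' y y' \<epsilon> T)) \<or>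
     (\<exists>p p' q q'.
        ((c = cEq' p q \<and> c' = cEq' p' q') \<or> (c = cImp' p q \<and> c' = cImp' p' q')) \<and>
        pr' p p' \<epsilon> T \<and> pr' q q' \<epsilon> T) \<or>
     (\<exists>w p p'. c = cAll' w p \<and> c' = cAll' w p' \<and> \<not> w = v \<and> \<not> free_in' w t \<and> pr' p p' \<epsilon> T)))"

lemma is_subst'_justified: "is_subst' v t c c' \<longleftrightarrow> justified (subst_clause v t) (pr' c c')"
  unfolding is_subst'_def justified_def subst_clause_def by simp

lemma subst_clause_mono:
  assumes "\<And>x. x \<epsilon> T \<Longrightarrow> x \<epsilon> T'" "subst_clause v t T d" shows "subst_clause v t T' d"
  using assms(2) unfolding subst_clause_def
  by (elim ex_forward conj_forward disj_forward; (assumption | use assms(1) in blast))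

lemmas is_subst'_step =
  justified_step[where \<Phi> = "subst_clause v t" and a = "pr' a a'" and b = "pr' b b'"
    and e = "pr' e e'" for v t a a' b b' e e',
    folded is_subst'_justified]

lemma is_subst'_var: "is_subst' v t v t"
  unfolding is_subst'_justified by (rule justified_base) (auto simp: subst_clause_def)

lemma is_subst'_id: "\<not> free_in' v c \<Longrightarrow> is_subst' v t c c"
  unfolding is_subst'_justified by (rule justified_base) (auto simp: subst_clause_def)

lemma subst_clause_pair:
  "subst_clause v t (J (J Z (pr' p p')) (pr' q q')) (pr' (cFun' s (pair_tuple' p q)) (cFun' s (pair_tuple' p' q')))"
  "subst_clause v t (J (J Z (pr' p p')) (pr' q q')) (pr' (cRel' s (pair_tuple' p q)) (cRel' s (pair_tuple' p' q')))"
proof -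
  have pairs: "\<forall>i y y'. pr' i y \<epsilon> pair_tuple' p q \<and> pr' i y' \<epsilon> pair_tuple' p' q' \<longrightarrow>
      pr' y y' \<epsilon> J (J Z (pr' p p')) (pr' q q')"
    by (auto simp del: One_nat_def)
  have dom: "\<forall>i. in_dom' i (pair_tuple' p q) \<longleftrightarrow> in_dom' i (pair_tuple' p' q')" by simp
  show "subst_clause v t (J (J Z (pr' p p')) (pr' q q')) (pr' (cFun' s (pair_tuple' p q)) (cFun' s (pair_tuple' p' q')))"
    "subst_clause v t (J (J Z (pr' p p')) (pr' q q')) (pr' (cRel' s (pair_tuple' p q)) (cRel' s (pair_tuple' p' q')))"
    unfolding subst_clause_def using pairs dom is_fun'_pair_tuple by blast+
qed

lemma is_subst'_intros:
  assumes "is_subst' v t p p'" "is_subst' v t q q'"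
  shows "is_subst' v t (cAdj' p q) (cAdj' p' q')" "is_subst' v t (cMem' p q) (cMem' p' q')"
    "is_subst' v t (cEq' p q) (cEq' p' q')" "is_subst' v t (cImp' p q) (cImp' p' q')"
proof -
  have mono: "\<forall>T T' d. (\<forall>x. x \<epsilon> T \<longrightarrow> x \<epsilon> T') \<longrightarrow> subst_clause v t T d \<longrightarrow> subst_clause v t T' d"
    using subst_clause_mono by blast
  note step = is_subst'_step[OF assms mono]
  show "is_subst' v t (cAdj' p q) (cAdj' p' q')" "is_subst' v t (cMem' p q) (cMem' p' q')"
    unfolding cAdj'_def cMem'_def by (rule step, rule subst_clause_pair)+
  show "is_subst' v t (cEq' p q) (cEq' p' q')" "is_subst' v t (cImp' p q) (cImp' p' q')"
    by (rule step, simp add: subst_clause_def)+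
qed

lemma is_subst'_all:
  assumes "is_subst' v t p p'" "w \<noteq> v" "\<not> free_in' w t"
  shows "is_subst' v t (cAll' w p) (cAll' w p')"
proof (rule is_subst'_step[OF assms(1) assms(1)])
  show "\<forall>T T' d. (\<forall>x. x \<epsilon> T \<longrightarrow> x \<epsilon> T') \<longrightarrow> subst_clause v t T d \<longrightarrow> subst_clause v t T' d"
    using subst_clause_mono by blast
qed (use assms in \<open>simp add: subst_clause_def\<close>)

text \<open>Counterpart of \<open>free_for\<close> for an inserted code that need not come from any
  \<open>tm\<close>; \<open>P y\<close> will say that the variable \<open>y\<close> is not free in
  it.\<close>

primrec binders_avoid :: "nat \<Rightarrow> (nat \<Rightarrow> bool) \<Rightarrow> fm \<Rightarrow> bool" where
  "binders_avoid x P (Mem s t) = True"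
| "binders_avoid x P (Eq s t) = True"
| "binders_avoid x P Fls = True"
| "binders_avoid x P (Imp A B) = (binders_avoid x P A \<and> binders_avoid x P B)"
| "binders_avoid x P (All y A) = (x \<notin> fv (All y A) \<or> P y \<and> binders_avoid x P A)"

lemma is_subst'_ctm:
  assumes "\<sigma> x = cVar' (num' x)" "\<And>y. y \<noteq> x \<Longrightarrow> y \<in> vars u \<Longrightarrow> \<not> free_in' (cVar' (num' x)) (\<sigma> y)"
  shows "is_subst' (cVar' (num' x)) s (ctm \<sigma> u) (ctm (\<sigma>(x := s)) u)"
  using assms by (induction u) (auto intro: is_subst'_var is_subst'_id is_subst'_intros simp: not_free_in')

text \<open>\<open>\<sigma>\<close> may already carry codes put in for other variables. They must
  not contain the variable \<open>x\<close>, or the coded substitution would change them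
  too.\<close>

lemma is_subst'_cfm:
  assumes "\<sigma> x = cVar' (num' x)" "\<And>y. y \<noteq> x \<Longrightarrow> y \<in> fv A \<Longrightarrow> \<not> free_in' (cVar' (num' x)) (\<sigma> y)"
    and "binders_avoid x (\<lambda>y. \<not> free_in' (cVar' (num' y)) s) A"
  shows "is_subst' (cVar' (num' x)) s (cfm \<sigma> A) (cfm (\<sigma>(x := s)) A)"
  using assms
proof (induction A arbitrary: \<sigma>)
  case (All y A)
  show ?case
  proof (cases "x \<in> fv (All y A)")
    case False
    have eq: "cfm (\<sigma>(x := s)) (All y A) = cfm \<sigma> (All y A)" by (rule cfm_cong) (use False in auto)
    have "\<not> free_in' (cVar' (num' x)) (\<sigma> i)" if "i \<in> fv (All y A)" for i
      by (rule All.prems(2)) (use that False in auto)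
    then have "\<not> free_in' (cVar' (num' x)) (cfm \<sigma> (All y A))"
      by (intro not_free_in'_cfm) simp_all
    then show ?thesis unfolding eq by (rule is_subst'_id)
  next
    case True
    then have y: "x \<noteq> y" "\<not> free_in' (cVar' (num' y)) s" "binders_avoid x (\<lambda>y. \<not> free_in' (cVar' (num' y)) s) A"
      using All.prems(3) by auto
    have "is_subst' (cVar' (num' x)) s (cfm (\<sigma>(y := cVar' (num' y))) A) (cfm (\<sigma>(y := cVar' (num' y), x := s)) A)"
      by (rule All.IH) (use All.prems y in \<open>auto simp: not_free_in'\<close>)
    moreover have "\<sigma>(y := cVar' (num' y), x := s) = \<sigma>(x := s, y := cVar' (num' y))"
      using y(1) by auto
    ultimately show ?thesis using y(1,2) by (simp add: is_subst'_all del: fun_upd_apply)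
  qed
qed (auto intro!: is_subst'_intros is_subst'_ctm is_subst'_id simp: not_free_in')

lemma is_subst'_code:
  assumes "free_for x t A"
  shows "is_subst' (cVar' (num' x)) (ctm cvars t) (cfm cvars A) (cfm cvars (subst x t A))"
proof -
  have "binders_avoid x (\<lambda>y. \<not> free_in' (cVar' (num' y)) (ctm cvars t)) A"
    using assms
  proof (induction A)
    case (All y A)
    moreover have "\<not> free_in' (cVar' (num' y)) (ctm cvars t)" if "y \<notin> vars t"
      by (rule not_free_in'_ctm) (use that in \<open>auto dest!: free_in'_cvarD\<close>)
    ultimately show ?case by auto
  qed auto
  then show ?thesis unfolding cfm_subst[OF assms] by (intro is_subst'_cfm) (auto simp: not_free_in')
qed

end

context zf_interp
begin

subsection \<open>Coded derivations\<close>

definition C_axiom' :: "'a \<Rightarrow> bool" where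
  "C_axiom' d = ((\<exists>A\<in>set C_finite_axioms. d = cfm cvars A) \<or> is_comprehension' d)"

lemma Df_C_axiom' [Df_intros]: "Tm t \<Longrightarrow> Df (\<lambda>e. C_axiom' (t e))"
  by (rule Df_subst1[where P = C_axiom'], unfold C_axiom'_def) (intro Df_intros finite_set)+

lemma sat_C_axiom: "below d t \<Longrightarrow> sat e (C_axiom t d) \<longleftrightarrow> C_axiom' (val e t)"
proof -
  assume t: "below d t"
  have "sat e (foldr (\<lambda>A b. t \<^bold>= code_fm A \<^bold>\<or> b) xs (is_comprehension t) d) \<longleftrightarrow>
      (\<exists>A\<in>set xs. val e t = cfm cvars A) \<or> is_comprehension' (val e t)" for xs
    using t by (induction xs) auto
  then show ?thesis by (simp add: C_axiom_def C_axiom'_def)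
qed

definition line :: "'a \<Rightarrow> 'a \<Rightarrow> 'a \<Rightarrow> bool" where
  "line g i d = (logical_axiom' lang' d \<or> C_axiom' d \<or>
     (\<exists>j l c. j \<epsilon> i \<and> l \<epsilon> i \<and> pr' j c \<epsilon> g \<and> pr' l (cImp' c d) \<epsilon> g) \<or>
     (\<exists>j c v. j \<epsilon> i \<and> pr' j c \<epsilon> g \<and> is_var' v \<and> d = cAll' v c))"

definition derivation :: "'a \<Rightarrow> 'a \<Rightarrow> bool" where
  "derivation g k = (fin_ord' k \<and> fun_on' g (succ' k) \<and> (\<forall>i d. pr' i d \<epsilon> g \<longrightarrow> line g i d))"

definition Prov :: "'a \<Rightarrow> bool" where
  "Prov p = (\<exists>g k. derivation g k \<and> pr' k p \<epsilon> g)"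

lemma sat_C_proves: "below d t \<Longrightarrow> sat e (C_proves t d) \<longleftrightarrow> Prov (val e t)"
  by (simp add: C_proves_def is_provable_def sat_C_axiom Prov_def derivation_def line_def) blast

lemma Df_line [Df_intros]: "Tm g \<Longrightarrow> Tm i \<Longrightarrow> Tm d \<Longrightarrow> Df (\<lambda>e. line (g e) (i e) (d e))"
  by (rule Df_subst3[where P = line], unfold line_def) (intro Df_intros)+

lemma Df_derivation [Df_intros]: "Tm g \<Longrightarrow> Tm k \<Longrightarrow> Df (\<lambda>e. derivation (g e) (k e))"
  by (rule Df_subst2[where P = derivation], unfold derivation_def) (intro Df_intros)+

lemma Df_Prov [Df_intros]: "Tm p \<Longrightarrow> Df (\<lambda>e. Prov (p e))"
  by (rule Df_subst1[where P = Prov], unfold Prov_def) (intro Df_intros)+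

lemma fun_on'_iff: "fun_on' f a \<longleftrightarrow> (\<forall>p. p \<epsilon> f \<longrightarrow> (\<exists>x y. p = pr' x y)) \<and>
    (\<forall>x y z. pr' x y \<epsilon> f \<longrightarrow> pr' x z \<epsilon> f \<longrightarrow> y = z) \<and> (\<forall>x. (\<exists>y. pr' x y \<epsilon> f) \<longleftrightarrow> x \<epsilon> a)"
  by (auto simp: fun_on'_def is_fun'_def in_dom'_def)

lemma fun_on'_extend:
  assumes "fun_on' g k" "\<not> k \<epsilon> k" shows "fun_on' (J g (pr' k d)) (succ' k)"
proof -
  have "x \<noteq> k" if "pr' x y \<epsilon> g" for x y using assms that unfolding fun_on'_iff by blast
  then show ?thesis using assms(1) unfolding fun_on'_iff
    by (simp only: mem_J[OF UNIV_I] mem_succ'[OF UNIV_I] pr'_eq[OF UNIV_I UNIV_I UNIV_I UNIV_I]) blast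
qed

lemma line_mono: "(\<And>j c. pr' j c \<epsilon> g \<Longrightarrow> pr' j c \<epsilon> g') \<Longrightarrow> line g i d \<Longrightarrow> line g' i d"
  unfolding line_def by blast

lemma derivation_extend:
  assumes g: "derivation g k" and d: "line g (succ' k) d"
  shows "derivation (J g (pr' (succ' k) d)) (succ' k)"
proof -
  have "line (J g (pr' (succ' k) d)) i c" if "pr' i c \<epsilon> J g (pr' (succ' k) d)" for i c
  proof -
    have "line g i c" using that g d unfolding derivation_def by auto
    then show ?thesis by (rule line_mono[rotated]) simp
  qed
  moreover have "fun_on' (J g (pr' (succ' k) d)) (succ' (succ' k))"
    using g not_mem_self[of "succ' k"] unfolding derivation_def by (intro fun_on'_extend) auto
  ultimately show ?thesis using g unfolding derivation_def by auto
qed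

lemma derivation_index: "derivation g k \<Longrightarrow> pr' j c \<epsilon> g \<Longrightarrow> j \<epsilon> succ' k"
  unfolding derivation_def fun_on'_iff by blast

text \<open>Positions in the second derivation shift, so only the occurrence of its lines is
  claimed; this avoids ordinal addition. The lines are appended one at a time, by an induction on
  \<open>k2\<close> inside the model that varies \<open>g2\<close>.\<close>

lemma derivation_concat:
  assumes g1: "derivation g1 k1"
  shows "derivation g2 k2 \<Longrightarrow>
    \<exists>g k. derivation g k \<and> (\<forall>i d. pr' i d \<epsilon> g1 \<or> pr' i d \<epsilon> g2 \<longrightarrow> (\<exists>j. pr' j d \<epsilon> g))"
proof -
  let ?P = "\<lambda>k2. \<forall>g2. derivation g2 k2 \<longrightarrow>
    (\<exists>g k. derivation g k \<and> (\<forall>i d. pr' i d \<epsilon> g1 \<or> pr' i d \<epsilon> g2 \<longrightarrow> (\<exists>j. pr' j d \<epsilon> g)))"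
  \<comment> \<open>A line stays justified at the end of \<open>g\<close> as soon as the premises it
    refers to occur anywhere in \<open>g\<close>.\<close>
  have line': "line g (succ' k) d"
    if "line g2 i d" "derivation g k" "\<And>i d. pr' i d \<epsilon> g2' \<Longrightarrow> \<exists>j. pr' j d \<epsilon> g"
      "\<And>j c. j \<epsilon> i \<Longrightarrow> pr' j c \<epsilon> g2 \<Longrightarrow> pr' j c \<epsilon> g2'" for g k g2 g2' i d
  proof -
    have "\<exists>j. j \<epsilon> succ' k \<and> pr' j c \<epsilon> g" if "j \<epsilon> i" "pr' j c \<epsilon> g2" for j c
      using that \<open>\<And>j c. j \<epsilon> i \<Longrightarrow> pr' j c \<epsilon> g2 \<Longrightarrow> pr' j c \<epsilon> g2'\<close> \<open>\<And>i d. pr' i d \<epsilon> g2' \<Longrightarrow> \<exists>j. pr' j d \<epsilon> g\<close>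
        derivation_index[OF \<open>derivation g k\<close>] by blast
    then show ?thesis using \<open>line g2 i d\<close> unfolding line_def by (elim disjE exE conjE) blast+
  qed
  assume "derivation g2 k2"
  then have "fin_ord' k2" unfolding derivation_def by blast
  have "?P k2"
  proof (rule fin_ord'_induct[OF _ \<open>fin_ord' k2\<close>])
    show "Df (\<lambda>e. ?P (e 0))" by (intro Df_intros)
    show "?P Z"
    proof (intro allI impI)
      fix g2 assume g2: "derivation g2 Z"
      have "Z \<epsilon> succ' Z" by simp
      then obtain d where d: "pr' Z d \<epsilon> g2" using g2 unfolding derivation_def fun_on'_iff by blast
      have only: "pr' i c \<epsilon> g2 \<Longrightarrow> c = d" for i c
      proof -
        assume c: "pr' i c \<epsilon> g2"
        then have "i = Z" using derivation_index[OF g2] by simp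
        then show "c = d" using c d g2 unfolding derivation_def fun_on'_iff by blast
      qed
      \<comment> \<open>The first line has no predecessors, so it is an axiom and may stand
        anywhere.\<close>
      have "line g2 Z d" using g2 d unfolding derivation_def by blast
      then have "line g1 (succ' k1) d" unfolding line_def by auto
      from derivation_extend[OF g1 this] only
      show "\<exists>g k. derivation g k \<and> (\<forall>i d. pr' i d \<epsilon> g1 \<or> pr' i d \<epsilon> g2 \<longrightarrow> (\<exists>j. pr' j d \<epsilon> g))"
        by (intro exI[of _ "J g1 (pr' (succ' k1) d)"] exI[of _ "succ' k1"]) auto
    qed
    fix k2 assume "fin_ord' k2" and IH: "?P k2"
    show "?P (succ' k2)"
    proof (intro allI impI)
      fix g2 assume g2: "derivation g2 (succ' k2)"
      have f2: "fun_on' g2 (succ' (succ' k2))" "\<And>i d. pr' i d \<epsilon> g2 \<Longrightarrow> line g2 i d"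
        using g2 unfolding derivation_def by auto
      \<comment> \<open>The induction hypothesis is applied to \<open>g2\<close> without its last
        line.\<close>
      have "Df (\<lambda>e. \<exists>i d. e 0 = pr' i d \<and> i \<epsilon> succ' k2)" by (intro Df_intros)
      from separation[OF this, of g2] obtain g2' where
        g2': "\<And>p. p \<epsilon> g2' \<longleftrightarrow> p \<epsilon> g2 \<and> (\<exists>i d. p = pr' i d \<and> i \<epsilon> succ' k2)" by blast
      have mem: "pr' i d \<epsilon> g2' \<longleftrightarrow> pr' i d \<epsilon> g2 \<and> i \<epsilon> succ' k2" for i d by (subst g2') auto
      have "derivation g2' k2" unfolding derivation_def
      proof (intro conjI allI impI)
        show "fun_on' g2' (succ' k2)"
        proof -
          have "p \<epsilon> g2' \<Longrightarrow> \<exists>x y. p = pr' x y" for p using g2' by blast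
          moreover have "pr' x y \<epsilon> g2' \<Longrightarrow> pr' x z \<epsilon> g2' \<Longrightarrow> y = z" for x y z
            using f2(1) mem unfolding fun_on'_iff by blast
          moreover have "(\<exists>y. pr' x y \<epsilon> g2') \<longleftrightarrow> x \<epsilon> succ' k2" for x
            using f2(1) mem unfolding fun_on'_iff by auto
          ultimately show ?thesis unfolding fun_on'_iff by blast
        qed
        fix i d assume i: "pr' i d \<epsilon> g2'"
        have "j \<epsilon> succ' k2" if "j \<epsilon> i" for j
          using fin_ord'_trans[of "succ' k2" i j] i that \<open>fin_ord' k2\<close> mem by simp
        then show "line g2' i d" using f2(2)[of i d] i mem unfolding line_def by blast
      qed fact
      then obtain g k where g: "derivation g k" "\<forall>i d. pr' i d \<epsilon> g1 \<or> pr' i d \<epsilon> g2' \<longrightarrow> (\<exists>j. pr' j d \<epsilon> g)"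
        using IH by blast
      have "succ' k2 \<epsilon> succ' (succ' k2)" by simp
      then obtain d where d: "pr' (succ' k2) d \<epsilon> g2" using f2(1) unfolding fun_on'_iff by blast
      have "line g (succ' k) d"
        by (rule line'[OF f2(2)[OF d] g(1), of g2']) (use g(2) mem in blast)+
      from derivation_extend[OF g(1) this] have ext: "derivation (J g (pr' (succ' k) d)) (succ' k)" .
      have "\<exists>j. pr' j c \<epsilon> J g (pr' (succ' k) d)" if "pr' i c \<epsilon> g1 \<or> pr' i c \<epsilon> g2" for i c
      proof (cases "pr' i c \<epsilon> g2 \<and> i = succ' k2")
        case True
        then have "c = d" using f2(1) d unfolding fun_on'_iff by blast
        then show ?thesis by auto
      next
        case False
        then have "pr' i c \<epsilon> g1 \<or> pr' i c \<epsilon> g2'"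
          using that mem derivation_index[OF g2, of i c] by auto
        then show ?thesis using g(2) by auto
      qed
      with ext show "\<exists>g k. derivation g k \<and> (\<forall>i d. pr' i d \<epsilon> g1 \<or> pr' i d \<epsilon> g2 \<longrightarrow> (\<exists>j. pr' j d \<epsilon> g))"
        by blast
    qed
  qed
  then show ?thesis using \<open>derivation g2 k2\<close> by blast
qed

lemma Prov_axiom:
  assumes "logical_axiom' lang' d \<or> C_axiom' d" shows "Prov d"
proof -
  have "derivation (J Z (pr' Z d)) Z" unfolding derivation_def
  proof (intro conjI allI impI)
    show "fun_on' (J Z (pr' Z d)) (succ' Z)" by (auto simp: fun_on'_iff)
    show "line (J Z (pr' Z d)) i c" if "pr' i c \<epsilon> J Z (pr' Z d)" for i c
      using that assms by (auto simp: line_def)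
  qed simp
  then show ?thesis unfolding Prov_def by (intro exI[of _ "J Z (pr' Z d)"] exI[of _ Z]) simp
qed

lemma Prov_extend: "derivation g k \<Longrightarrow> line g (succ' k) d \<Longrightarrow> Prov d"
  unfolding Prov_def using derivation_extend by (metis mem_J UNIV_I)

lemma Prov_gen: "Prov p \<Longrightarrow> is_var' v \<Longrightarrow> Prov (cAll' v p)"
proof -
  assume "Prov p" and v: "is_var' v"
  then obtain g k where g: "derivation g k" "pr' k p \<epsilon> g" unfolding Prov_def by blast
  have "line g (succ' k) (cAll' v p)"
    unfolding line_def using g v mem_succ'[of k k] by blast
  with g(1) show ?thesis by (rule Prov_extend)
qed

lemma Prov_mp: "Prov p \<Longrightarrow> Prov (cImp' p q) \<Longrightarrow> Prov q"
proof -
  assume "Prov p" "Prov (cImp' p q)"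
  then obtain g1 k1 g2 k2 where "derivation g1 k1" "pr' k1 p \<epsilon> g1" "derivation g2 k2" "pr' k2 (cImp' p q) \<epsilon> g2"
    unfolding Prov_def by blast
  then obtain g k j l where g: "derivation g k" "pr' j p \<epsilon> g" "pr' l (cImp' p q) \<epsilon> g"
    using derivation_concat[of g1 k1 g2 k2] by blast
  then have "line g (succ' k) q"
    unfolding line_def using derivation_index[OF g(1)] by blast
  with g(1) show ?thesis by (rule Prov_extend)
qed

lemma Prov_inst:
  assumes "is_formula' lang' p" "is_subst' v t p p'" "is_var' v" "is_term' lang' t" "Prov (cAll' v p)"
  shows "Prov p'"
proof -
  have "logical_axiom' lang' (cImp' (cAll' v p) p')"
    using assms(1-4) unfolding logical_axiom'_def by (simp only: bex_UNIV) blast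
  then show ?thesis using Prov_axiom Prov_mp assms(5) by blast
qed

lemma logical_axiom'_Leib:
  assumes "is_var' v" "is_term' r s" "is_term' r t" "is_formula' r p" "is_subst' v s p p'" "is_subst' v t p p''"
  shows "logical_axiom' r (cImp' (cEq' s t) (cImp' p' p''))"
  unfolding logical_axiom'_def bex_UNIV
  by ((rule disjI2)+, rule exI[of _ v], rule exI[of _ s], rule exI[of _ t], rule exI[of _ p],
      rule exI[of _ p'], rule exI[of _ p'']) (simp add: assms)

lemma cfm_SetF: "cfm cvars (SetF i) = cSet' (num' i)"
  by (simp only: SetF_def cfm.simps ctm.simps cvars_upd cSet'_def) (simp add: num'.simps)

lemma is_term'_code: "is_term' lang' (ctm cvars t)"
  by (rule is_term'_ctm) (simp add: is_term'_var)

lemma is_predicative'_code: "is_predicative' (cfm cvars (relativize A))"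
proof (induction A)
  case (Mem s t)
  then show ?case by (auto intro!: is_predicative'_atomic is_atomic'_intros is_term'_code)
next
  case (Eq s t)
  then show ?case by (auto intro!: is_predicative'_atomic is_atomic'_intros is_term'_code)
next
  case Fls
  then show ?case by (simp add: is_predicative'_atomic is_atomic'_def)
next
  case (All x A)
  then show ?case by (simp add: is_predicative'_all cfm_SetF del: fun_upd_apply)
qed (simp add: is_predicative'_imp)

lemma C_axiom'_code:
  assumes "A \<in> C_axioms" shows "C_axiom' (cfm cvars A)"
  using assms unfolding C_axioms_def
proof (elim UnE CollectE exE conjE)
  assume "A \<in> set C_finite_axioms"
  then show ?thesis unfolding C_axiom'_def by blast
next
  fix i j p
  assume A: "A = Ex j (All i (Imp (SetF i) (Iff (Mem (Var i) (Var j)) (relativize p))))" "i \<noteq> j" "j \<notin> fv p"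
  have code: "cfm cvars A = cEx' (cVar' (num' j)) (cAll' (cVar' (num' i)) (cImp' (cSet' (num' i))
      (cIff' (cMem' (cVar' (num' i)) (cVar' (num' j))) (cfm cvars (relativize p)))))"
    by (simp add: A cfm_SetF del: fun_upd_apply)
  have "\<not> free_in' (cVar' (num' j)) (cfm cvars (relativize p))"
    by (rule not_free_in'_code) (simp add: A)
  then have "is_comprehension' (cfm cvars A)"
    unfolding is_comprehension'_def bex_UNIV code
    using is_predicative'_code fin_ord'_num num'_eq A(2) by blast
  then show ?thesis unfolding C_axiom'_def by blast
qed

lemma is_formula'_code: "is_formula' lang' (cfm cvars A)"
  by (rule is_formula'_cfm) (simp add: is_term'_var)

text \<open>An actual derivation has finitely many steps, each with a coded copy in the model; so
  the induction is on \<open>provable\<close> in the metalogic, not inside the model.\<close>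

lemma Prov_code: "C_axioms \<turnstile> A \<Longrightarrow> Prov (cfm cvars A)"
proof (induction rule: provable.induct)
  case (Ax A)
  then show ?case using C_axiom'_code Prov_axiom by blast
next
  case (K A B)
  show ?case using is_formula'_code[of A] is_formula'_code[of B]
    by (intro Prov_axiom disjI1) (simp only: logical_axiom'_def bex_UNIV cfm.simps, blast)
next
  case (S A B C)
  show ?case using is_formula'_code[of A] is_formula'_code[of B] is_formula'_code[of C]
    by (intro Prov_axiom disjI1) (simp only: logical_axiom'_def bex_UNIV cfm.simps, blast)
next
  case (DN A)
  show ?case using is_formula'_code[of A]
    by (intro Prov_axiom disjI1) (simp only: logical_axiom'_def bex_UNIV cfm.simps, blast)
next
  case (Inst x t A)
  show ?case using is_subst'_code[OF Inst] is_formula'_code[of A] is_term'_code[of t] is_var'_num[of x]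
    by (intro Prov_axiom disjI1) (simp only: logical_axiom'_def bex_UNIV cfm.simps cvars_upd, blast)
next
  case (Dist x A B)
  show ?case using not_free_in'_code[OF Dist] is_formula'_code[of A] is_formula'_code[of B] is_var'_num[of x]
    by (intro Prov_axiom disjI1) (simp only: logical_axiom'_def bex_UNIV cfm.simps cvars_upd, blast)
next
  case (Refl t)
  show ?case using is_term'_code[of t]
    by (intro Prov_axiom disjI1) (simp only: logical_axiom'_def bex_UNIV cfm.simps, blast)
next
  case (Leib x s A t)
  have "logical_axiom' lang' (cImp' (cEq' (ctm cvars s) (ctm cvars t))
      (cImp' (cfm cvars (subst x s A)) (cfm cvars (subst x t A))))"
    by (rule logical_axiom'_Leib[OF is_var'_num is_term'_code is_term'_code is_formula'_code
      is_subst'_code[OF Leib(1)] is_subst'_code[OF Leib(2)]])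
  then show ?case by (simp add: Prov_axiom)
next
  case (MP A B)
  then show ?case using Prov_mp[of "cfm cvars A" "cfm cvars B"] by simp
next
  case (Gen A x)
  then show ?case by (simp add: Prov_gen del: fun_upd_apply)
qed

end

section \<open>Hereditarily finite sets and canonical names\<close>

context zf_interp
begin

section \<open>Finite sets of the model\<close>

lemma finite_set'_iff: "finite_set' x \<longleftrightarrow> (\<exists>n f. fin_ord' n \<and> fun_on' f n \<and> (\<forall>y. y \<epsilon> x \<longleftrightarrow> (\<exists>i. pr' i y \<epsilon> f)) \<and>
    (\<forall>i j y. pr' i y \<epsilon> f \<longrightarrow> pr' j y \<epsilon> f \<longrightarrow> i = j))"
  by (simp add: finite_set'_def) blast

lemma finite_set'_Z: "finite_set' Z"
  unfolding finite_set'_iff by (intro exI[of _ Z]) (simp add: fun_on'_iff)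

lemma finite_set'_J:
  assumes "finite_set' x" shows "finite_set' (J x z)"
proof (cases "z \<epsilon> x")
  case True
  then have "J x z = x" by (intro ext) auto
  with assms show ?thesis by simp
next
  case False
  obtain n f where f: "fin_ord' n" "fun_on' f n" "\<And>y. y \<epsilon> x \<longleftrightarrow> (\<exists>i. pr' i y \<epsilon> f)"
    "\<And>i j y. pr' i y \<epsilon> f \<Longrightarrow> pr' j y \<epsilon> f \<Longrightarrow> i = j"
    using assms unfolding finite_set'_iff by blast
  let ?f = "J f (pr' n z)"
  have n: "\<not> pr' n y \<epsilon> f" for y using f(2) not_mem_self[of n] unfolding fun_on'_iff by blast
  have z: "\<not> pr' i z \<epsilon> f" for i using f(3) False by blast
  have "fun_on' ?f (succ' n)" using f(2) not_mem_self by (intro fun_on'_extend) auto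
  moreover have "y \<epsilon> J x z \<longleftrightarrow> (\<exists>i. pr' i y \<epsilon> ?f)" for y using f(3) by auto
  moreover have "pr' i y \<epsilon> ?f \<Longrightarrow> pr' j y \<epsilon> ?f \<Longrightarrow> i = j" for i j y using f(4) n z by auto
  ultimately show ?thesis unfolding finite_set'_iff using f(1) fin_ord'_succ by blast
qed

text \<open>Internal induction along an enumeration \<open>f\<close> of \<open>x\<close>:
  \<open>?Q k\<close> says that the set of the values at indices in \<open>k\<close> exists and
  satisfies \<open>P\<close>.\<close>

lemma finite_set'_induct:
  assumes Df: "Df (\<lambda>e. P (e 0))" and "finite_set' x" "P Z" "\<And>y z. P y \<Longrightarrow> P (J y z)"
  shows "P x"
proof -
  have P: "Tm t \<Longrightarrow> Df (\<lambda>e. P (t e))" for t by (rule Df_subst1[OF Df])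
  obtain n f where f: "fin_ord' n" "fun_on' f n" "\<And>y. y \<epsilon> x \<longleftrightarrow> (\<exists>i. pr' i y \<epsilon> f)"
    using assms(2) unfolding finite_set'_iff by blast
  let ?Q = "\<lambda>k. k \<epsilon> succ' n \<longrightarrow> (\<exists>y. (\<forall>z. z \<epsilon> y \<longleftrightarrow> (\<exists>i. i \<epsilon> k \<and> pr' i z \<epsilon> f)) \<and> P y)"
  have "?Q n"
  proof (rule fin_ord'_induct[where P = ?Q, OF _ f(1)])
    show "Df (\<lambda>e. ?Q (e 0))" by (intro Df_intros P)
    show "?Q Z" using assms(3) by (intro impI exI[of _ Z]) simp
    fix k assume k: "fin_ord' k" "?Q k"
    show "?Q (succ' k)"
    proof
      assume "succ' k \<epsilon> succ' n"
      moreover have "k \<epsilon> succ' k" by simp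
      ultimately have "k \<epsilon> n"
        using fin_ord'_trans[OF f(1), of "succ' k" k] by (metis UNIV_I mem_succ')
      then obtain w where w: "pr' k w \<epsilon> f" using f(2) unfolding fun_on'_iff by blast
      obtain y where y: "\<And>z. z \<epsilon> y \<longleftrightarrow> (\<exists>i. i \<epsilon> k \<and> pr' i z \<epsilon> f)" "P y" using k \<open>k \<epsilon> n\<close> by auto
      have "z \<epsilon> J y w \<longleftrightarrow> (\<exists>i. i \<epsilon> succ' k \<and> pr' i z \<epsilon> f)" for z
        using y(1)[of z] w f(2) unfolding fun_on'_iff by (simp only: mem_J[OF UNIV_I] mem_succ'[OF UNIV_I]) blast
      then show "\<exists>y. (\<forall>z. z \<epsilon> y \<longleftrightarrow> (\<exists>i. i \<epsilon> succ' k \<and> pr' i z \<epsilon> f)) \<and> P y"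
        using assms(4)[OF y(2), of w] by blast
    qed
  qed
  then obtain y where y: "\<And>z. z \<epsilon> y \<longleftrightarrow> (\<exists>i. i \<epsilon> n \<and> pr' i z \<epsilon> f)" "P y" by auto
  have "z \<epsilon> y \<longleftrightarrow> z \<epsilon> x" for z
    using y(1)[of z] f(3)[of z] f(2)[unfolded fun_on'_iff] by blast
  then have "y = x" by (rule ext)
  with y(2) show ?thesis by simp
qed

lemma remove_exists: "\<exists>y'. (\<forall>w. w \<epsilon> y' \<longleftrightarrow> w \<epsilon> y \<and> w \<noteq> z)"
  by (rule separation) (intro Df_intros)

lemma finite_set'_subset:
  assumes "finite_set' s" "\<And>w. w \<epsilon> y \<Longrightarrow> w \<epsilon> s" shows "finite_set' y"
proof -
  let ?P = "\<lambda>s. \<forall>y. (\<forall>w. w \<epsilon> y \<longrightarrow> w \<epsilon> s) \<longrightarrow> finite_set' y"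
  have "?P s"
  proof (rule finite_set'_induct[OF _ assms(1)])
    show "Df (\<lambda>e. ?P (e 0))" by (intro Df_intros)
    show "?P Z"
    proof (intro allI impI)
      fix y assume "\<forall>w. w \<epsilon> y \<longrightarrow> w \<epsilon> Z"
      then have "y = Z" by (intro ext) simp
      then show "finite_set' y" by (simp add: finite_set'_Z)
    qed
    fix s z assume IH: "?P s"
    show "?P (J s z)"
    proof (intro allI impI)
      fix y assume y: "\<forall>w. w \<epsilon> y \<longrightarrow> w \<epsilon> J s z"
      obtain y' where y': "\<forall>w. w \<epsilon> y' \<longleftrightarrow> w \<epsilon> y \<and> w \<noteq> z" using remove_exists by blast
      then have "finite_set' y'" using IH y by auto
      moreover have "y = y' \<or> y = J y' z"
      proof (cases "z \<epsilon> y")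
        case True
        then have "y = J y' z" by (intro ext) (use y' in auto)
        then show ?thesis ..
      next
        case False
        then have "y = y'" by (intro ext) (use y' in auto)
        then show ?thesis ..
      qed
      ultimately show "finite_set' y" using finite_set'_J by auto
    qed
  qed
  with assms(2) show ?thesis by blast
qed

text \<open>Tarski's criterion of finiteness, by induction on \<open>s\<close>. It serves in
  \<open>ack_linear_finite_trans\<close> to obtain a maximal part of a finite set.\<close>

lemma finite_set'_minimal:
  assumes "finite_set' s" "\<And>c w. c \<epsilon> K \<Longrightarrow> w \<epsilon> c \<Longrightarrow> w \<epsilon> s" "c0 \<epsilon> K"
  shows "\<exists>c. c \<epsilon> K \<and> (\<forall>d. d \<epsilon> K \<longrightarrow> (\<forall>w. w \<epsilon> d \<longrightarrow> w \<epsilon> c) \<longrightarrow> d = c)"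
proof -
  let ?min = "\<lambda>K c. c \<epsilon> K \<and> (\<forall>d. d \<epsilon> K \<longrightarrow> (\<forall>w. w \<epsilon> d \<longrightarrow> w \<epsilon> c) \<longrightarrow> d = c)"
  let ?P = "\<lambda>s. \<forall>K. (\<forall>c w. c \<epsilon> K \<longrightarrow> w \<epsilon> c \<longrightarrow> w \<epsilon> s) \<longrightarrow> (\<exists>c. c \<epsilon> K) \<longrightarrow> (\<exists>c. ?min K c)"
  have "?P s"
  proof (rule finite_set'_induct[OF _ assms(1)])
    show "Df (\<lambda>e. ?P (e 0))" by (intro Df_intros)
    show "?P Z"
    proof (intro allI impI)
      fix K assume K: "\<forall>c w. c \<epsilon> K \<longrightarrow> w \<epsilon> c \<longrightarrow> w \<epsilon> Z" "\<exists>c. c \<epsilon> K"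
      then have "c \<epsilon> K \<Longrightarrow> c = Z" for c by (intro ext) auto
      with K(2) show "\<exists>c. ?min K c" by blast
    qed
    fix s z assume IH: "?P s"
    show "?P (J s z)"
    proof (intro allI impI)
      fix K assume K: "\<forall>c w. c \<epsilon> K \<longrightarrow> w \<epsilon> c \<longrightarrow> w \<epsilon> J s z" "\<exists>c. c \<epsilon> K"
      have "Df (\<lambda>e. \<not> z \<epsilon> e 0)" by (intro Df_intros)
      from separation[OF this, of K] obtain K0 where K0: "\<And>c. c \<epsilon> K0 \<longleftrightarrow> c \<epsilon> K \<and> \<not> z \<epsilon> c" by blast
      show "\<exists>c. ?min K c"
      \<comment> \<open>If some member omits \<open>z\<close>, a minimal one among these is minimal
        in \<open>K\<close>, because smaller sets omit \<open>z\<close> too. Otherwise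
        \<open>z\<close> is removed from all members, which preserves and reflects
        inclusion.\<close>
      proof (cases "\<exists>c. c \<epsilon> K0")
        case True
        have "w \<epsilon> s" if "c \<epsilon> K0" "w \<epsilon> c" for c w
        proof -
          have "w \<epsilon> J s z" "w \<noteq> z" using that K0[of c] K(1) by blast+
          then show ?thesis by simp
        qed
        then have "\<forall>c w. c \<epsilon> K0 \<longrightarrow> w \<epsilon> c \<longrightarrow> w \<epsilon> s" by blast
        from IH[THEN spec, THEN mp, THEN mp, OF this True] obtain c where c: "?min K0 c" by blast
        then have "\<not> z \<epsilon> d" if "\<forall>w. w \<epsilon> d \<longrightarrow> w \<epsilon> c" for d using that K0 by blast
        then have "?min K c" using c K0 by blast
        then show ?thesis by blast
      next
        case False
        then have zK: "c \<epsilon> K \<Longrightarrow> z \<epsilon> c" for c using K0 by blast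
        let ?R = "\<lambda>x y. \<forall>w. w \<epsilon> y \<longleftrightarrow> w \<epsilon> x \<and> w \<noteq> z"
        have "Df (\<lambda>e. ?R (e 0) (e (Suc 0)))" by (intro Df_intros)
        then have "\<exists>K1. \<forall>y. y \<epsilon> K1 \<longleftrightarrow> (\<exists>x. x \<epsilon> K \<and> ?R x y)"
          by (rule replacement) (rule ext, simp)
        then obtain K1 where K1: "\<And>y. y \<epsilon> K1 \<longleftrightarrow> (\<exists>x. x \<epsilon> K \<and> ?R x y)" by blast
        obtain x where "x \<epsilon> K" using K(2) by blast
        moreover obtain y where "?R x y" using remove_exists by blast
        ultimately have ex: "\<exists>c. c \<epsilon> K1" using K1 by blast
        have "w \<epsilon> s" if "c \<epsilon> K1" "w \<epsilon> c" for c w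
        proof -
          have "w \<epsilon> J s z" "w \<noteq> z" using that K1[of c] K(1) by blast+
          then show ?thesis by simp
        qed
        then have "\<forall>c w. c \<epsilon> K1 \<longrightarrow> w \<epsilon> c \<longrightarrow> w \<epsilon> s" by blast
        from IH[THEN spec, THEN mp, THEN mp, OF this ex] obtain c1 where c1: "?min K1 c1" by blast
        then obtain c where c: "c \<epsilon> K" "?R c c1" using K1 by blast
        have "d = c" if d: "d \<epsilon> K" "\<forall>w. w \<epsilon> d \<longrightarrow> w \<epsilon> c" for d
        proof -
          obtain d1 where d1: "?R d d1" using remove_exists by blast
          then have "d1 \<epsilon> K1" using K1 d by blast
          moreover have "\<forall>w. w \<epsilon> d1 \<longrightarrow> w \<epsilon> c1" using d1 c d by blast
          ultimately have "d1 = c1" using c1 by blast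
          show "d = c"
          proof (rule ext)
            fix w show "w \<epsilon> d \<longleftrightarrow> w \<epsilon> c"
              using d1 c(2) zK[OF c(1)] zK[OF d(1)] \<open>d1 = c1\<close> by (cases "w = z") auto
          qed
        qed
        with c(1) show ?thesis by blast
      qed
    qed
  qed
  then show ?thesis using assms(2,3) by blast
qed

subsection \<open>The Ackermann ordering\<close>

lemma ack_less'_cases:
  assumes "ack_less' x y"
  shows "\<exists>z. z \<epsilon> y \<and> \<not> z \<epsilon> x \<and> (\<forall>w. w \<epsilon> x \<and> \<not> w \<epsilon> y \<longrightarrow> ack_less' w z)"
proof -
  obtain T where T: "pr' x y \<epsilon> T" "\<And>q. q \<epsilon> T \<Longrightarrow> \<exists>a b z. q = pr' a b \<and>
     z \<epsilon> b \<and> \<not> z \<epsilon> a \<and> (\<forall>w. w \<epsilon> a \<and> \<not> w \<epsilon> b \<longrightarrow> pr' w z \<epsilon> T)"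
    using assms unfolding ack_less'_def by auto
  have "ack_less' u v" if "pr' u v \<epsilon> T" for u v
    unfolding ack_less'_def bex_UNIV ball_UNIV using that T(2) by blast
  moreover obtain z where "z \<epsilon> y" "\<not> z \<epsilon> x" "\<forall>w. w \<epsilon> x \<and> \<not> w \<epsilon> y \<longrightarrow> pr' w z \<epsilon> T"
    using T(2)[OF T(1)] by auto
  ultimately show ?thesis by blast
qed

lemma ack_less'_irrefl: "\<not> ack_less' x x"
  using ack_less'_cases by blast

text \<open>The comparisons of \<open>w\<close> with \<open>z\<close> come with justifying sets of
  their own. Instead of collecting these, \<open>B\<close> takes all pairs of the ordering on
  \<open>t\<close> at once. It exists by two power sets and is closed under the descent because
  \<open>t\<close> is transitive.\<close>

lemma ack_less'_intro:
  assumes t: "trans_set' t" and xy: "\<And>w. w \<epsilon> x \<Longrightarrow> w \<epsilon> t" "\<And>w. w \<epsilon> y \<Longrightarrow> w \<epsilon> t"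
    and z: "z \<epsilon> y" "\<not> z \<epsilon> x" "\<And>w. w \<epsilon> x \<Longrightarrow> \<not> w \<epsilon> y \<Longrightarrow> ack_less' w z"
  shows "ack_less' x y"
proof -
  obtain p where p: "\<And>u. u \<epsilon> p \<longleftrightarrow> subset_of' u t" using power by blast
  obtain pp where pp: "\<And>u. u \<epsilon> pp \<longleftrightarrow> subset_of' u p" using power by blast
  have pair: "pr' a b \<epsilon> pp" if "a \<epsilon> t" "b \<epsilon> t" for a b
    unfolding pp pr'_def using that by (auto simp: subset_of'_def p)
  have "Df (\<lambda>e. \<exists>a b. e 0 = pr' a b \<and> a \<epsilon> t \<and> b \<epsilon> t \<and> ack_less' a b)" by (intro Df_intros)
  from separation[OF this, of pp] obtain B where
    B: "\<And>q. q \<epsilon> B \<longleftrightarrow> q \<epsilon> pp \<and> (\<exists>a b. q = pr' a b \<and> a \<epsilon> t \<and> b \<epsilon> t \<and> ack_less' a b)" by blast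
  have B_mem: "pr' a b \<epsilon> B \<longleftrightarrow> a \<epsilon> t \<and> b \<epsilon> t \<and> ack_less' a b" for a b
    unfolding B using pair by auto
  have tr: "u \<epsilon> t" if "u \<epsilon> v" "v \<epsilon> t" for u v using t that unfolding trans_set'_iff by blast
  let ?T = "J B (pr' x y)"
  have "\<exists>a b z. q = pr' a b \<and> z \<epsilon> b \<and> \<not> z \<epsilon> a \<and> (\<forall>w. w \<epsilon> a \<and> \<not> w \<epsilon> b \<longrightarrow> pr' w z \<epsilon> ?T)" if q: "q \<epsilon> ?T" for q
  proof (cases "q = pr' x y")
    case True
    have "pr' w z \<epsilon> ?T" if "w \<epsilon> x" "\<not> w \<epsilon> y" for w
      using z(3)[OF that] xy(1)[OF that(1)] xy(2)[OF z(1)] B_mem by simp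
    with True z(1,2) show ?thesis by blast
  next
    case False
    then have "q \<epsilon> B" using q by simp
    then obtain a b where ab: "q = pr' a b" "a \<epsilon> t" "b \<epsilon> t" "ack_less' a b" using B by blast
    obtain v where v: "v \<epsilon> b" "\<not> v \<epsilon> a" "\<forall>w. w \<epsilon> a \<and> \<not> w \<epsilon> b \<longrightarrow> ack_less' w v"
      using ack_less'_cases[OF ab(4)] by blast
    then have "pr' w v \<epsilon> ?T" if "w \<epsilon> a" "\<not> w \<epsilon> b" for w
      using that tr[OF that(1) ab(2)] tr[OF v(1) ab(3)] B_mem by simp
    with ab(1) v(1,2) show ?thesis by blast
  qed
  then show ?thesis unfolding ack_less'_def bex_UNIV ball_UNIV
    by (intro exI[of _ ?T]) simp
qed

definition ack_linear :: "'a \<Rightarrow> bool" where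
  "ack_linear s = ((\<forall>x y. x \<epsilon> s \<longrightarrow> y \<epsilon> s \<longrightarrow> x = y \<or> ack_less' x y \<or> ack_less' y x) \<and>
     (\<forall>x y z. x \<epsilon> s \<longrightarrow> y \<epsilon> s \<longrightarrow> z \<epsilon> s \<longrightarrow> ack_less' x y \<longrightarrow> ack_less' y z \<longrightarrow> ack_less' x z))"

lemma Df_ack_linear [Df_intros]: "Tm s \<Longrightarrow> Df (\<lambda>e. ack_linear (s e))"
  by (rule Df_subst1[where P = ack_linear], unfold ack_linear_def) (intro Df_intros)+

text \<open>Stated for a definable relation \<open>R\<close>, so that the reversed ordering yields
  least elements as well.\<close>

lemma finite_set'_greatest:
  assumes y: "finite_set' y" "\<And>w. w \<epsilon> y \<Longrightarrow> w \<epsilon> s" "w0 \<epsilon> y" and "Df (\<lambda>e. R (e 0) (e (Suc 0)))"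
    and total: "\<And>u v. u \<epsilon> s \<Longrightarrow> v \<epsilon> s \<Longrightarrow> u = v \<or> R u v \<or> R v u"
    and trans: "\<And>u v w. u \<epsilon> s \<Longrightarrow> v \<epsilon> s \<Longrightarrow> w \<epsilon> s \<Longrightarrow> R u v \<Longrightarrow> R v w \<Longrightarrow> R u w"
  shows "\<exists>g. g \<epsilon> y \<and> (\<forall>w. w \<epsilon> y \<longrightarrow> w = g \<or> R w g)"
proof -
  have R: "Tm a \<Longrightarrow> Tm b \<Longrightarrow> Df (\<lambda>e. R (a e) (b e))" for a b by (rule Df_subst2[OF assms(4)])
  let ?P = "\<lambda>y. (\<forall>w. w \<epsilon> y \<longrightarrow> w \<epsilon> s) \<longrightarrow> (\<exists>w. w \<epsilon> y) \<longrightarrow> (\<exists>g. g \<epsilon> y \<and> (\<forall>w. w \<epsilon> y \<longrightarrow> w = g \<or> R w g))"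
  have "?P y"
  proof (rule finite_set'_induct[OF _ y(1)])
    show "Df (\<lambda>e. ?P (e 0))" by (intro Df_intros R)
    show "?P Z" by simp
    fix y z assume IH: "?P y"
    show "?P (J y z)"
    proof (intro impI)
      assume ys: "\<forall>w. w \<epsilon> J y z \<longrightarrow> w \<epsilon> s"
      show "\<exists>g. g \<epsilon> J y z \<and> (\<forall>w. w \<epsilon> J y z \<longrightarrow> w = g \<or> R w g)"
      proof (cases "\<exists>w. w \<epsilon> y")
        case False
        then show ?thesis by (intro exI[of _ z]) auto
      next
        case True
        then obtain g where g: "g \<epsilon> y" "\<forall>w. w \<epsilon> y \<longrightarrow> w = g \<or> R w g" using IH ys by auto
        have gz: "g \<epsilon> s" "z \<epsilon> s" using ys g(1) by auto
        then consider "z = g \<or> R z g" | "R g z" using total by blast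
        then show ?thesis
        proof cases
          case 1
          then show ?thesis using g by (intro exI[of _ g]) auto
        next
          case 2
          have "w = z \<or> R w z" if "w \<epsilon> J y z" for w
          proof -
            have "w = z \<or> w = g \<or> R w g" "w \<epsilon> s" using that g ys by auto
            then show ?thesis using 2 gz trans by blast
          qed
          then show ?thesis by (intro exI[of _ z]) auto
        qed
      qed
    qed
  qed
  then show ?thesis using y(2,3) by blast
qed

lemma ack_greatest:
  assumes s: "ack_linear s" and y: "finite_set' y" "\<And>w. w \<epsilon> y \<Longrightarrow> w \<epsilon> s" "w0 \<epsilon> y"
  shows "\<exists>g. g \<epsilon> y \<and> (\<forall>w. w \<epsilon> y \<longrightarrow> w = g \<or> ack_less' w g)"
proof (rule finite_set'_greatest[OF y])
  show "Df (\<lambda>e. ack_less' (e 0) (e (Suc 0)))" by (intro Df_intros)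
qed (use s in \<open>unfold ack_linear_def, blast\<close>)+

lemma ack_least:
  assumes s: "ack_linear s" and y: "finite_set' y" "\<And>w. w \<epsilon> y \<Longrightarrow> w \<epsilon> s" "w0 \<epsilon> y"
  shows "\<exists>g. g \<epsilon> y \<and> (\<forall>w. w \<epsilon> y \<longrightarrow> w = g \<or> ack_less' g w)"
proof (rule finite_set'_greatest[where R = "\<lambda>u v. ack_less' v u", OF y])
  show "Df (\<lambda>e. ack_less' (e (Suc 0)) (e 0))" by (intro Df_intros)
qed (use s in \<open>unfold ack_linear_def, blast\<close>)+

text \<open>Subsets of a finite linearly ordered set compare like binary numerals: the greatest
  element of their symmetric difference decides.\<close>

lemma ack_linear_subsets:
  assumes s: "trans_set' s" "finite_set' s" "ack_linear s"
  shows "\<And>x y. (\<forall>w. w \<epsilon> x \<longrightarrow> w \<epsilon> s) \<Longrightarrow> (\<forall>w. w \<epsilon> y \<longrightarrow> w \<epsilon> s) \<Longrightarrow> x = y \<or> ack_less' x y \<or> ack_less' y x"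
    and "\<And>x y z. (\<forall>w. w \<epsilon> x \<longrightarrow> w \<epsilon> s) \<Longrightarrow> (\<forall>w. w \<epsilon> y \<longrightarrow> w \<epsilon> s) \<Longrightarrow> (\<forall>w. w \<epsilon> z \<longrightarrow> w \<epsilon> s) \<Longrightarrow>
      ack_less' x y \<Longrightarrow> ack_less' y z \<Longrightarrow> ack_less' x z"
proof -
  fix x y assume x: "\<forall>w. w \<epsilon> x \<longrightarrow> w \<epsilon> s" and y: "\<forall>w. w \<epsilon> y \<longrightarrow> w \<epsilon> s"
  have "Df (\<lambda>e. (e 0 \<epsilon> x \<and> \<not> e 0 \<epsilon> y) \<or> (e 0 \<epsilon> y \<and> \<not> e 0 \<epsilon> x))" by (intro Df_intros)
  from separation[OF this, of s] obtain d where
    d: "\<And>w. w \<epsilon> d \<longleftrightarrow> w \<epsilon> s \<and> ((w \<epsilon> x \<and> \<not> w \<epsilon> y) \<or> (w \<epsilon> y \<and> \<not> w \<epsilon> x))" by blast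
  show "x = y \<or> ack_less' x y \<or> ack_less' y x"
  proof (cases "\<exists>w. w \<epsilon> d")
    case False
    then have "x = y" by (intro ext) (use d x y in blast)
    then show ?thesis ..
  next
    case True
    have "finite_set' d" by (rule finite_set'_subset[OF s(2)]) (use d in blast)
    then obtain g where g: "g \<epsilon> d" "\<forall>w. w \<epsilon> d \<longrightarrow> w = g \<or> ack_less' w g"
      using ack_greatest[OF s(3), of d] d True by blast
    consider "g \<epsilon> y" "\<not> g \<epsilon> x" | "g \<epsilon> x" "\<not> g \<epsilon> y" using g(1) d by blast
    then show ?thesis
    proof cases
      case 1
      have "ack_less' x y"
        by (rule ack_less'_intro[OF s(1), where z = g]) (use x y 1 g(2) d in blast)+
      then show ?thesis by simp
    next
      case 2
      have "ack_less' y x"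
        by (rule ack_less'_intro[OF s(1), where z = g]) (use x y 2 g(2) d in blast)+
      then show ?thesis by simp
    qed
  qed
next
  fix x y z assume sub: "\<forall>w. w \<epsilon> x \<longrightarrow> w \<epsilon> s" "\<forall>w. w \<epsilon> y \<longrightarrow> w \<epsilon> s" "\<forall>w. w \<epsilon> z \<longrightarrow> w \<epsilon> s"
    and xy: "ack_less' x y" and yz: "ack_less' y z"
  obtain a where a: "a \<epsilon> y" "\<not> a \<epsilon> x" "\<forall>w. w \<epsilon> x \<and> \<not> w \<epsilon> y \<longrightarrow> ack_less' w a"
    using ack_less'_cases[OF xy] by blast
  obtain b where b: "b \<epsilon> z" "\<not> b \<epsilon> y" "\<forall>w. w \<epsilon> y \<and> \<not> w \<epsilon> z \<longrightarrow> ack_less' w b"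
    using ack_less'_cases[OF yz] by blast
  have tr: "ack_less' u w" if "u \<epsilon> s" "v \<epsilon> s" "w \<epsilon> s" "ack_less' u v" "ack_less' v w" for u v w
    using s(3) that unfolding ack_linear_def by blast
  have ab: "a \<epsilon> s" "b \<epsilon> s" "a \<noteq> b" using a b sub by auto
  \<comment> \<open>\<open>a\<close> decides between \<open>x\<close> and \<open>y\<close>, and
    \<open>b\<close> between \<open>y\<close> and \<open>z\<close>; the greater of the two decides
    between \<open>x\<close> and \<open>z\<close>.\<close>
  then consider "ack_less' a b" | "ack_less' b a" using s(3) unfolding ack_linear_def by blast
  then show "ack_less' x z"
  proof cases
    case 1
    have "\<not> ack_less' b a" using tr[OF ab(1,2,1) 1] ack_less'_irrefl by blast
    then have nb: "\<not> b \<epsilon> x" using a(3) b(2) by blast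
    have lt: "ack_less' w b" if "w \<epsilon> x" "\<not> w \<epsilon> z" for w
    proof (cases "w \<epsilon> y")
      case True
      then show ?thesis using that(2) b(3) by blast
    next
      case False
      then have "ack_less' w a" "w \<epsilon> s" using that(1) a(3) sub(1) by blast+
      then show ?thesis using tr[OF _ ab(1,2) _ 1] by blast
    qed
    show ?thesis by (rule ack_less'_intro[OF s(1) _ _ b(1) nb lt]) (use sub in blast)+
  next
    case 2
    have "\<not> ack_less' a b" using tr[OF ab(2,1,2) 2] ack_less'_irrefl by blast
    then have az: "a \<epsilon> z" using b(3) a(1) by blast
    have lt: "ack_less' w a" if "w \<epsilon> x" "\<not> w \<epsilon> z" for w
    proof (cases "w \<epsilon> y")
      case True
      then have "ack_less' w b" "w \<epsilon> s" using that b(3) sub(1) by blast+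
      then show ?thesis using tr[OF _ ab(2,1) _ 2] by blast
    next
      case False
      then show ?thesis using that(1) a(3) by blast
    qed
    show ?thesis by (rule ack_less'_intro[OF s(1) _ _ az a(2) lt]) (use sub in blast)+
  qed
qed

text \<open>A maximal transitive part \<open>s\<close> of \<open>t\<close> with linear ordering
  exhausts \<open>t\<close>: an \<in>-minimal \<open>m\<close> outside has all its members in
  \<open>s\<close>, so all elements of \<open>J s m\<close> are subsets of \<open>s\<close> and
  compare by \<open>ack_linear_subsets\<close>.\<close>

lemma ack_linear_finite_trans:
  assumes t: "trans_set' t" "finite_set' t"
  shows "ack_linear t"
proof -
  \<comment> \<open>Complements are collected, so that a minimal \<open>c\<close> gives a maximal
    \<open>s\<close>.\<close>
  let ?G = "\<lambda>c. \<exists>s. (\<forall>w. w \<epsilon> s \<longleftrightarrow> w \<epsilon> t \<and> \<not> w \<epsilon> c) \<and> trans_set' s \<and> ack_linear s"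
  obtain p where p: "\<And>u. u \<epsilon> p \<longleftrightarrow> subset_of' u t" using power by blast
  have "Df (\<lambda>e. ?G (e 0))" by (intro Df_intros)
  from separation[OF this, of p] obtain K where K: "\<And>c. c \<epsilon> K \<longleftrightarrow> subset_of' c t \<and> ?G c"
    unfolding p by blast
  have sub: "c \<epsilon> K \<Longrightarrow> w \<epsilon> c \<Longrightarrow> w \<epsilon> t" for c w unfolding K subset_of'_def by auto
  have "?G t" by (intro exI[of _ Z]) (simp add: trans_set'_iff ack_linear_def)
  then have "t \<epsilon> K" unfolding K subset_of'_def by simp
  have "\<exists>c. c \<epsilon> K \<and> (\<forall>d. d \<epsilon> K \<longrightarrow> (\<forall>w. w \<epsilon> d \<longrightarrow> w \<epsilon> c) \<longrightarrow> d = c)"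
  proof (rule finite_set'_minimal[OF t(2)])
    show "t \<epsilon> K" by fact
    show "w \<epsilon> t" if "c \<epsilon> K" "w \<epsilon> c" for c w using sub[OF that] .
  qed
  then obtain c where c: "c \<epsilon> K" "\<And>d. d \<epsilon> K \<Longrightarrow> (\<forall>w. w \<epsilon> d \<longrightarrow> w \<epsilon> c) \<Longrightarrow> d = c" by blast
  then obtain s where s: "\<And>w. w \<epsilon> s \<longleftrightarrow> w \<epsilon> t \<and> \<not> w \<epsilon> c" "trans_set' s" "ack_linear s"
    unfolding K by blast
  have "\<not> x \<epsilon> c" for x
  proof
    assume "x \<epsilon> c"
    then obtain m where m: "m \<epsilon> c" "\<not> (\<exists>z. z \<epsilon> c \<and> z \<epsilon> m)" using foundation[of c x] by auto
    have mt: "m \<epsilon> t" using m(1) c(1) sub by blast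
    have ms: "\<forall>w. w \<epsilon> m \<longrightarrow> w \<epsilon> s" using m s(1) t(1) mt unfolding trans_set'_iff by blast
    have fs: "finite_set' s" by (rule finite_set'_subset[OF t(2)]) (use s(1) in blast)
    note lin = ack_linear_subsets[OF s(2) fs s(3)]
    have sub_s: "\<forall>w. w \<epsilon> u \<longrightarrow> w \<epsilon> s" if "u \<epsilon> J s m" for u
      using that ms s(2) unfolding trans_set'_iff by auto
    have "ack_linear (J s m)"
      unfolding ack_linear_def
    proof (intro conjI allI impI)
      show "x = y \<or> ack_less' x y \<or> ack_less' y x" if "x \<epsilon> J s m" "y \<epsilon> J s m" for x y
        by (rule lin(1)[OF sub_s[OF that(1)] sub_s[OF that(2)]])
      show "ack_less' x z"
        if "x \<epsilon> J s m" "y \<epsilon> J s m" "z \<epsilon> J s m" "ack_less' x y" "ack_less' y z" for x y z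
        by (rule lin(2)[OF sub_s[OF that(1)] sub_s[OF that(2)] sub_s[OF that(3)] that(4,5)])
    qed
    moreover have "trans_set' (J s m)" unfolding trans_set'_iff using sub_s by simp
    moreover obtain c' where c': "\<And>w. w \<epsilon> c' \<longleftrightarrow> w \<epsilon> c \<and> w \<noteq> m" using remove_exists by blast
    moreover have "w \<epsilon> J s m \<longleftrightarrow> w \<epsilon> t \<and> \<not> w \<epsilon> c'" for w
      using s(1)[of w] c'[of w] mt by auto
    ultimately have "?G c'" by blast
    moreover have "subset_of' c' t" using c' c(1) sub unfolding subset_of'_def by auto
    ultimately have "c' \<epsilon> K" unfolding K by blast
    then have "c' = c" using c(2) c' by blast
    then show False using c'[of m] m(1) by simp
  qed
  then have "s = t" by (intro ext) (use s(1) in blast)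
  with s(3) show ?thesis by simp
qed

subsection \<open>Canonical names\<close>

text \<open>A code without free variables can be substituted anywhere without capture; therefore
  this property accompanies the names throughout.\<close>

definition closed_term :: "'a \<Rightarrow> bool" where
  "closed_term c = (is_term' lang' c \<and> (\<forall>v. is_var' v \<longrightarrow> \<not> free_in' v c))"

definition name_clause :: "'a \<Rightarrow> 'a \<Rightarrow> bool" where
  "name_clause T q = (q = pr' Z cZero' \<or> (\<exists>y z s t. q = pr' (J y z) (cAdj' s t) \<and>
     \<not> z \<epsilon> y \<and> (\<forall>w. w \<epsilon> y \<longrightarrow> ack_less' w z) \<and> pr' y s \<epsilon> T \<and> pr' z t \<epsilon> T))"

definition named :: "'a \<Rightarrow> bool" where
  "named x = (\<exists>c. canonical_name' x c \<and> closed_term c)"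

lemma Df_closed_term [Df_intros]: "Tm c \<Longrightarrow> Df (\<lambda>e. closed_term (c e))"
  by (rule Df_subst1[where P = closed_term], unfold closed_term_def) (intro Df_intros)+

lemma Df_named [Df_intros]: "Tm c \<Longrightarrow> Df (\<lambda>e. named (c e))"
  by (rule Df_subst1[where P = named], unfold named_def) (intro Df_intros)+

lemma canonical_name'_justified: "canonical_name' x c \<longleftrightarrow> justified name_clause (pr' x c)"
  unfolding canonical_name'_def justified_def name_clause_def by simp

lemma canonical_name'_zero: "canonical_name' Z cZero'"
  unfolding canonical_name'_justified by (rule justified_base) (simp add: name_clause_def)

lemma canonical_name'_J:
  assumes "canonical_name' y s" "canonical_name' z t" "\<not> z \<epsilon> y" "\<And>w. w \<epsilon> y \<Longrightarrow> ack_less' w z"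
  shows "canonical_name' (J y z) (cAdj' s t)"
  using assms(1,2) unfolding canonical_name'_justified
proof (rule justified_step)
  show "\<forall>T T' d. (\<forall>x. x \<epsilon> T \<longrightarrow> x \<epsilon> T') \<longrightarrow> name_clause T d \<longrightarrow> name_clause T' d"
    unfolding name_clause_def by blast
  have "pr' y s \<epsilon> J (J Z (pr' y s)) (pr' z t)" "pr' z t \<epsilon> J (J Z (pr' y s)) (pr' z t)" by auto
  then show "name_clause (J (J Z (pr' y s)) (pr' z t)) (pr' (J y z) (cAdj' s t))"
    unfolding name_clause_def using assms(3,4) by blast
qed

lemma closed_term_zero: "closed_term cZero'"
  unfolding closed_term_def by (simp add: is_term'_zero not_free_in')

lemma closed_term_adj: "closed_term s \<Longrightarrow> closed_term t \<Longrightarrow> closed_term (cAdj' s t)"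
  unfolding closed_term_def by (simp add: is_term'_adj not_free_in')

text \<open>The elements of \<open>y\<close> are adjoined in increasing Ackermann order. Otherwise
  some least \<open>b\<close> has an initial segment, \<open>b\<close> included, without a name; but
  the segment strictly below \<open>b\<close> has one, and \<open>b\<close> can be adjoined as its
  new greatest element.\<close>

lemma named_subset:
  assumes t: "ack_linear t" "finite_set' t" and y: "\<And>w. w \<epsilon> y \<Longrightarrow> w \<epsilon> t" "\<And>w. w \<epsilon> y \<Longrightarrow> named w"
  shows "named y"
proof (rule ccontr)
  assume not: "\<not> named y"
  have Z: "named Z" using canonical_name'_zero closed_term_zero unfolding named_def by blast
  have irr: "\<not> ack_less' u u" for u by (rule ack_less'_irrefl)
  have tr: "ack_less' u w" if "u \<epsilon> t" "v \<epsilon> t" "w \<epsilon> t" "ack_less' u v" "ack_less' v w" for u v w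
    using t(1) that unfolding ack_linear_def by blast
  have fin: "finite_set' u" if "\<And>w. w \<epsilon> u \<Longrightarrow> w \<epsilon> y" for u
    by (rule finite_set'_subset[OF t(2)]) (use that y(1) in blast)
  let ?seg = "\<lambda>b u. \<forall>v. v \<epsilon> u \<longleftrightarrow> v \<epsilon> y \<and> (v = b \<or> ack_less' v b)"
  have "Df (\<lambda>e. \<forall>u. ?seg (e 0) u \<longrightarrow> \<not> named u)" by (intro Df_intros)
  from separation[OF this, of y] obtain B where
    B: "\<And>b. b \<epsilon> B \<longleftrightarrow> b \<epsilon> y \<and> (\<forall>u. ?seg b u \<longrightarrow> \<not> named u)" by blast
  have "y \<noteq> Z" using not Z by blast
  then obtain w0 where "w0 \<epsilon> y" using ext[of y Z] by auto
  then obtain g where g: "g \<epsilon> y" "\<forall>w. w \<epsilon> y \<longrightarrow> w = g \<or> ack_less' w g"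
    using ack_greatest[OF t(1) fin[of y] y(1)] by blast
  \<comment> \<open>The segment up to the greatest element is \<open>y\<close> itself, so failure at
    \<open>y\<close> makes \<open>B\<close> nonempty.\<close>
  have "u = y" if "?seg g u" for u by (rule ext) (use that g in blast)
  then have "g \<epsilon> B" using B g(1) not by blast
  then obtain b where b: "b \<epsilon> B" "\<forall>w. w \<epsilon> B \<longrightarrow> w = b \<or> ack_less' b w"
    using ack_least[OF t(1) fin[of B], of g] B y(1) by blast
  have bY: "b \<epsilon> y" using b(1) B by blast
  have "Df (\<lambda>e. ack_less' (e 0) b)" by (intro Df_intros)
  \<comment> \<open>The segment strictly below \<open>b\<close> is empty or is the full segment of
    its own greatest element \<open>b'\<close>, which precedes \<open>b\<close> and so is not in
    \<open>B\<close>.\<close>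
  from separation[OF this, of y] obtain u where u: "\<And>v. v \<epsilon> u \<longleftrightarrow> v \<epsilon> y \<and> ack_less' v b" by blast
  have "named u"
  proof (cases "\<exists>v. v \<epsilon> u")
    case False
    then have "u = Z" by (intro ext) simp
    with Z show ?thesis by simp
  next
    case True
    then obtain b' where b': "b' \<epsilon> u" "\<forall>w. w \<epsilon> u \<longrightarrow> w = b' \<or> ack_less' w b'"
      using ack_greatest[OF t(1) fin[of u], of _] u y(1) by blast
    have b'y: "b' \<epsilon> y" "ack_less' b' b" using b'(1) u by auto
    have "\<not> b' \<epsilon> B"
    proof
      assume "b' \<epsilon> B"
      then have "b' = b \<or> ack_less' b b'" using b(2) by blast
      then show False using b'y irr tr[of b b' b] bY y(1) by blast
    qed
    then obtain u' where u': "?seg b' u'" "named u'" using B b'y(1) by blast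
    have "v \<epsilon> u' \<longleftrightarrow> v \<epsilon> u" for v
    proof
      assume "v \<epsilon> u'"
      then have v: "v \<epsilon> y" "v = b' \<or> ack_less' v b'" using u'(1) by auto
      then have "ack_less' v b" using b'y tr[of v b' b] y(1) bY by blast
      with v(1) u show "v \<epsilon> u" by blast
    next
      assume "v \<epsilon> u"
      then show "v \<epsilon> u'" using b'(2) u u'(1) by blast
    qed
    then have "u' = u" by (rule ext)
    with u'(2) show ?thesis by simp
  qed
  then obtain s where s: "canonical_name' u s" "closed_term s" unfolding named_def by blast
  obtain c where c: "canonical_name' b c" "closed_term c" using y(2)[OF bY] unfolding named_def by blast
  have "canonical_name' (J u b) (cAdj' s c)"
    by (rule canonical_name'_J[OF s(1) c(1)]) (use u irr in blast)+
  then have "named (J u b)" unfolding named_def using closed_term_adj s c by blast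
  moreover have "?seg b (J u b)" using u bY by auto
  ultimately show False using b(1) B by blast
qed

text \<open>Foundation is applied inside the transitive finite set \<open>t\<close>: an
  \<in>-minimal unnamed element of \<open>t\<close> would have only named members, all in
  \<open>t\<close>.\<close>

lemma hered_finite'_named:
  assumes "hered_finite' r" shows "named r"
proof -
  obtain t where t: "finite_set' t" "trans_set' t" "\<And>w. w \<epsilon> r \<Longrightarrow> w \<epsilon> t"
    using assms unfolding hered_finite'_def subset_of'_def by auto
  have lin: "ack_linear t" using ack_linear_finite_trans t by blast
  have "Df (\<lambda>e. \<not> named (e 0))" by (intro Df_intros)
  from separation[OF this, of t] obtain b where b: "\<And>x. x \<epsilon> b \<longleftrightarrow> x \<epsilon> t \<and> \<not> named x" by blast
  have "\<not> x \<epsilon> b" for x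
  proof
    assume "x \<epsilon> b"
    then obtain m where m: "m \<epsilon> b" "\<not> (\<exists>z. z \<epsilon> b \<and> z \<epsilon> m)" using foundation[of b x] by auto
    have "named m"
      by (rule named_subset[OF lin t(1)]) (use m b t(2) in \<open>unfold trans_set'_iff, blast\<close>)+
    then show False using m(1) b by blast
  qed
  then have "named w" if "w \<epsilon> r" for w using t(3)[OF that] b by blast
  then show ?thesis using named_subset[OF lin t(1) t(3)] by blast
qed

text \<open>The deciding element is \<open>w\<close> itself: it belongs to \<open>n\<close> and not
  to \<open>w\<close>, and transitivity of \<open>n\<close> leaves nothing in \<open>w\<close>
  outside \<open>n\<close>.\<close>

lemma ack_less'_fin_ord:
  assumes "fin_ord' n" "w \<epsilon> n" shows "ack_less' w n"
proof -
  have "v \<epsilon> n" if "v \<epsilon> w" for v using fin_ord'_trans[OF assms(1,2) that] .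
  then show ?thesis unfolding ack_less'_def bex_UNIV ball_UNIV
    using assms(2) not_mem_self[of w] by (intro exI[of _ "J Z (pr' w n)"]) auto
qed

lemma canonical_name'_succ:
  "fin_ord' n \<Longrightarrow> canonical_name' n t \<Longrightarrow> canonical_name' (succ' n) (cAdj' t t)"
  unfolding succ'_def using not_mem_self ack_less'_fin_ord by (intro canonical_name'_J) auto

end

section \<open>The internal induction\<close>

text \<open>Lets free variables be computed through the bold notation, without expanding a formula
  into raw syntax.\<close>

definition closed_at :: "nat \<Rightarrow> fb \<Rightarrow> bool" where
  "closed_at d b = (fv (b d) \<subseteq> {..<d})"

lemma vars_below: "vars t \<subseteq> {..<d} \<longleftrightarrow> below d t"
  by (auto simp: below_def)

lemma closed_at_bold [simp]:
  "closed_at d (s \<^bold>\<in> t) \<longleftrightarrow> below d s \<and> below d t"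
  "closed_at d (s \<^bold>= t) \<longleftrightarrow> below d s \<and> below d t"
  "closed_at d (\<^bold>\<not> b) \<longleftrightarrow> closed_at d b"
  "closed_at d (b \<^bold>\<and> c) \<longleftrightarrow> closed_at d b \<and> closed_at d c"
  "closed_at d (b \<^bold>\<or> c) \<longleftrightarrow> closed_at d b \<and> closed_at d c"
  "closed_at d (b \<^bold>\<longrightarrow> c) \<longleftrightarrow> closed_at d b \<and> closed_at d c"
  "closed_at d (b \<^bold>\<longleftrightarrow> c) \<longleftrightarrow> closed_at d b \<and> closed_at d c"
  "closed_at d (sets_only b) \<longleftrightarrow> closed_at d b"
  by (auto simp: closed_at_def bmem_def beq_def bneg_def band_def bor_def bimp_def biff_def
      sets_only_def vars_below[symmetric])

lemma closed_at_quant [simp]: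
  "closed_at d (ball f) \<longleftrightarrow> closed_at (Suc d) (f (Var d))"
  "closed_at d (bex f) \<longleftrightarrow> closed_at (Suc d) (f (Var d))"
  by (auto simp: closed_at_def ball_def bex_def less_Suc_eq)

lemma below_code_tm [simp]: "below d (code_tm t)"
  by (induction t) simp_all

lemma below_code_fm [simp]: "below d (code_fm A)"
  by (induction A) simp_all

lemma fv_Theta: "fv Theta \<subseteq> {0, 1}"
  and fv_step_hyp: "fv (evaluations_step_hyp (Var 0) (Var 1) 2) \<subseteq> {0, 1}"
proof -
  note defs = subset_of_def trans_set_def fin_ord_def is_fun_def in_dom_def fun_on_def finite_set_def tuple_def
    in_V_def rel_symbol_def fun_symbol_def signature_def is_var_def is_term_def is_atomic_def
    is_formula_def imm_part_def subexpr_def free_in_def is_structure_def assignment_def is_update_def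
    eval_dom_def arg_values_def evaluation_def
  have "closed_at 2 (satisfaction_exists (Var 0) (Var 1))"
    by (simp add: satisfaction_exists_def satisfaction_relation_def Phi_def defs)
  then show "fv Theta \<subseteq> {0, 1}"
    by (auto simp: closed_at_def Theta_def)
  have "closed_at 2 (evaluations_step_hyp (Var 0) (Var 1))"
    by (simp add: evaluations_step_hyp_def evaluations_exist_def V_trans_def V_seq_def V_expr_def defs)
  then show "fv (evaluations_step_hyp (Var 0) (Var 1) 2) \<subseteq> {0, 1}"
    by (auto simp: closed_at_def)
qed

context zf_interp
begin

lemma Tm_ctm: "(\<And>i. Tm (\<sigma> i)) \<Longrightarrow> Tm (\<lambda>e. ctm (\<lambda>i. \<sigma> i e) t)"
  by (induction t) (auto intro!: Tm_cAdj simp: Tm_const)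

text \<open>Makes the code of \<theta> at a name a term function of the name, so that provability of
  this instance is a definable predicate, fit for \<open>fin_ord'_induct\<close>.\<close>

lemma Tm_cfm: "(\<And>i. Tm (\<sigma> i)) \<Longrightarrow> Tm (\<lambda>e. cfm (\<lambda>i. \<sigma> i e) A)"
proof (induction A arbitrary: \<sigma>)
  case (All x A)
  have upd: "(\<lambda>i. (\<sigma>(x := \<lambda>e. cVar' (num' x))) i e) = (\<lambda>i. \<sigma> i e)(x := cVar' (num' x))" for e by auto
  have "Tm (\<lambda>e. cfm (\<lambda>i. (\<sigma>(x := \<lambda>e. cVar' (num' x))) i e) A)"
    by (rule All.IH) (use All.prems Tm_const in auto)
  then have "Tm (\<lambda>e. cfm ((\<lambda>i. \<sigma> i e)(x := cVar' (num' x))) A)" by (simp only: upd)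
  then show ?case unfolding cfm.simps by (intro Df_intros)
qed (auto intro!: Tm_cMem Tm_cEq Tm_cImp Tm_ctm simp: Tm_const)

text \<open>The intermediate state of an instantiation: some variables already have closed names,
  the others stand for themselves.\<close>

definition closed_subst :: "(nat \<Rightarrow> 'a) \<Rightarrow> bool" where
  "closed_subst \<sigma> = (\<forall>y. \<sigma> y = cVar' (num' y) \<or> closed_term (\<sigma> y))"

lemma closed_subst_cvars: "closed_subst cvars"
  by (simp add: closed_subst_def)

lemma closed_subst_upd: "closed_subst \<sigma> \<Longrightarrow> closed_term t \<Longrightarrow> closed_subst (\<sigma>(x := t))"
  by (auto simp: closed_subst_def)

lemma binders_avoid_all: "(\<And>y. P y) \<Longrightarrow> binders_avoid x P A"
  by (induction A) auto

lemma is_subst'_closed: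
  assumes \<sigma>: "closed_subst \<sigma>" "\<sigma> x = cVar' (num' x)" and t: "closed_term t"
  shows "is_subst' (cVar' (num' x)) t (cfm \<sigma> A) (cfm (\<sigma>(x := t)) A)"
proof (rule is_subst'_cfm[where \<sigma> = \<sigma> and x = x, OF \<sigma>(2)])
  show "\<not> free_in' (cVar' (num' x)) (\<sigma> y)" if "y \<noteq> x" for y
  proof (cases "\<sigma> y = cVar' (num' y)")
    case True
    then show ?thesis using that free_in'_cvarD by metis
  next
    case False
    then show ?thesis using \<sigma>(1) unfolding closed_subst_def closed_term_def by auto
  qed
  show "binders_avoid x (\<lambda>y. \<not> free_in' (cVar' (num' y)) t) A"
    using t by (intro binders_avoid_all) (simp add: closed_term_def)
qed

text \<open>A closed name is never captured, so coded instantiation of the outer quantifier is an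
  update of \<open>\<sigma>\<close>, whatever the binders of \<open>A\<close>.\<close>

lemma Prov_instance:
  assumes \<sigma>: "closed_subst \<sigma>" and t: "closed_term t" and "Prov (cfm \<sigma> (All x A))"
  shows "Prov (cfm (\<sigma>(x := t)) A)"
proof -
  let ?\<sigma> = "\<sigma>(x := cVar' (num' x))"
  have c: "closed_subst ?\<sigma>" using \<sigma> by (auto simp: closed_subst_def)
  have "is_term' lang' (?\<sigma> y)" for y
  proof (cases "?\<sigma> y = cVar' (num' y)")
    case True
    then show ?thesis by (simp only: is_term'_var is_var'_num)
  next
    case False
    then show ?thesis using c unfolding closed_subst_def closed_term_def by blast
  qed
  then have "is_formula' lang' (cfm ?\<sigma> A)" by (rule is_formula'_cfm)
  moreover have "is_subst' (cVar' (num' x)) t (cfm ?\<sigma> A) (cfm (?\<sigma>(x := t)) A)"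
    by (rule is_subst'_closed[OF c _ t]) simp
  moreover have "Prov (cAll' (cVar' (num' x)) (cfm ?\<sigma> A))" using assms(3) by (simp del: fun_upd_apply)
  ultimately have "Prov (cfm (?\<sigma>(x := t)) A)"
    using Prov_inst[OF _ _ is_var'_num] t unfolding closed_term_def by blast
  then show ?thesis by simp
qed

lemma Prov_refl: "closed_term t \<Longrightarrow> Prov (cEq' t t)"
  by (rule Prov_axiom, rule disjI1) (auto simp: logical_axiom'_def closed_term_def)

theorem C_proves_instances:
  assumes r: "hered_finite' r" and n: "fin_ord' n"
  shows "\<exists>s t q. canonical_name' r s \<and> canonical_name' n t \<and>
    (\<exists>p. is_subst' (cVar' (num' 0)) s (cfm cvars Theta) p \<and> is_subst' (cVar' (num' 1)) t p q) \<and> Prov q"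
proof -
  define \<theta> where "\<theta> = evaluations_step_hyp (Var 0) (Var 1) 2"
  obtain s where s: "canonical_name' r s" "closed_term s"
    using hered_finite'_named[OF r] unfolding named_def by blast
  define \<sigma> where "\<sigma> t = cvars(0 := s, 1 := t)" for t
  have \<sigma>: "closed_subst (\<sigma> t)" if "closed_term t" for t
    unfolding \<sigma>_def using s that by (intro closed_subst_upd closed_subst_cvars)
  have inst: "Prov (cfm (\<sigma> t) A)" if "C_axioms \<turnstile> All 0 (All 1 A)" "closed_term t" for t A
    unfolding \<sigma>_def
    by (rule Prov_instance[OF closed_subst_upd[OF closed_subst_cvars s(2)] that(2)
      Prov_instance[OF closed_subst_cvars s(2) Prov_code[OF that(1)]]])
  \<comment> \<open>The name is quantified inside the predicate, so the internal induction produces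
    the name of \<open>n\<close> along with the derivation.\<close>
  let ?P = "\<lambda>n. \<exists>t. canonical_name' n t \<and> closed_term t \<and> Prov (cfm (\<sigma> t) \<theta>)"
  have "?P n"
  proof (rule fin_ord'_induct[where P = ?P, OF _ n])
    have "Tm (\<lambda>e. cfm (\<sigma> (t e)) \<theta>)" if "Tm t" for t
    proof -
      have "\<sigma> u = (\<lambda>i. if i = 1 then u else (cvars(0 := s)) i)" for u by (auto simp: \<sigma>_def)
      moreover have "Tm (\<lambda>e. if i = 1 then t e else (cvars(0 := s)) i)" for i
        using that Tm_const by (cases "i = 1") (simp_all del: fun_upd_apply)
      from Tm_cfm[OF this] have "Tm (\<lambda>e. cfm (\<lambda>i. if i = 1 then t e else (cvars(0 := s)) i) \<theta>)" .
      ultimately show ?thesis by (simp only:)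
    qed
    note Tm_\<sigma> = this
    show "Df (\<lambda>e. ?P (e 0))" by (intro Df_intros Tm_\<sigma>)
    have "Prov (cImp' (cEq' cZero' cZero') (cfm (\<sigma> cZero') \<theta>))"
      using inst[OF C_step_zero closed_term_zero] unfolding \<theta>_def by (simp add: \<sigma>_def del: One_nat_def)
    then have "Prov (cfm (\<sigma> cZero') \<theta>)" using Prov_mp Prov_refl[OF closed_term_zero] by blast
    then show "?P Z" using canonical_name'_zero closed_term_zero by blast
    fix k assume k: "fin_ord' k" "?P k"
    then obtain t where t: "canonical_name' k t" "closed_term t" "Prov (cfm (\<sigma> t) \<theta>)" by blast
    let ?t = "cAdj' t t"
    have t': "closed_term ?t" using closed_term_adj t(2) by blast
    have "Prov (cImp' (cfm (\<sigma> t) \<theta>) (cfm (\<sigma> t)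
        (All 2 (Imp (Eq (Var 2) (succ (Var 1))) (All 1 (Imp (Eq (Var 1) (Var 2)) \<theta>))))))"
      using inst[OF C_step_succ t(2)] unfolding \<theta>_def by (simp only: cfm.simps)
    then have "Prov (cfm (\<sigma> t) (All 2 (Imp (Eq (Var 2) (succ (Var 1))) (All 1 (Imp (Eq (Var 1) (Var 2)) \<theta>)))))"
      using Prov_mp t(3) by blast
    \<comment> \<open>Variable 2 receives the name of the successor. Since \<open>succ\<close>
      adjoins a term to itself, the coded equation has \<open>?t\<close> on both sides.\<close>
    from Prov_instance[OF \<sigma>[OF t(2)] t' this]
    have "Prov (cImp' (cEq' ?t ?t) (cfm ((\<sigma> t)(2 := ?t)) (All 1 (Imp (Eq (Var 1) (Var 2)) \<theta>))))"
      by (simp add: \<sigma>_def succ_def del: One_nat_def cfm.simps(5)) 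
    then have "Prov (cfm ((\<sigma> t)(2 := ?t)) (All 1 (Imp (Eq (Var 1) (Var 2)) \<theta>)))"
      using Prov_mp Prov_refl[OF t'] by blast
    \<comment> \<open>Variable 1 now receives the same name in place of the name of
      \<open>k\<close>; the second equation is again reflexive.\<close>
    from Prov_instance[OF closed_subst_upd[OF \<sigma>[OF t(2)] t'] t' this]
    have "Prov (cImp' (cEq' ?t ?t) (cfm ((\<sigma> t)(2 := ?t, 1 := ?t)) \<theta>))"
      by (simp del: One_nat_def)
    then have "Prov (cfm ((\<sigma> t)(2 := ?t, 1 := ?t)) \<theta>)" using Prov_mp Prov_refl[OF t'] by blast
    moreover have "cfm ((\<sigma> t)(2 := ?t, 1 := ?t)) \<theta> = cfm (\<sigma> ?t) \<theta>"
      by (rule cfm_cong) (use fv_step_hyp in \<open>auto simp: \<theta>_def \<sigma>_def\<close>)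
    ultimately have "Prov (cfm (\<sigma> ?t) \<theta>)" by simp
    then show "?P (succ' k)" using canonical_name'_succ[OF k(1) t(1)] t' by blast
  qed
  then obtain t where t: "canonical_name' n t" "closed_term t" "Prov (cfm (\<sigma> t) \<theta>)" by blast
  have "Prov (cImp' (cfm (\<sigma> t) \<theta>) (cfm (\<sigma> t) Theta))"
    using inst[OF C_step_Theta t(2)] unfolding \<theta>_def by simp
  then have "Prov (cfm (\<sigma> t) Theta)" using Prov_mp t(3) by blast
  moreover have "is_subst' (cVar' (num' 0)) s (cfm cvars Theta) (cfm (cvars(0 := s)) Theta)"
    by (rule is_subst'_closed[OF closed_subst_cvars _ s(2)]) simp
  moreover have "is_subst' (cVar' (num' 1)) t (cfm (cvars(0 := s)) Theta) (cfm (\<sigma> t) Theta)"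
    unfolding \<sigma>_def
    by (rule is_subst'_closed[OF closed_subst_upd[OF closed_subst_cvars s(2)] _ t(2)]) simp
  ultimately show ?thesis using s(1) t(1) by blast
qed

end

section \<open>Models of set theory\<close>

lemma S_axioms_infinite:
  fixes E :: "nat \<Rightarrow> nat \<Rightarrow> bool"
  assumes V: "Z \<in> V" "\<And>x y. x \<in> V \<Longrightarrow> y \<in> V \<Longrightarrow> J x y \<in> V"
    and sat: "\<And>B e. B \<in> S_axioms \<Longrightarrow> range e \<subseteq> V \<Longrightarrow> interp.sat E Z J V e B"
  shows "infinite V"
proof -
  interpret interp E Z J V .
  have ax: "sat (\<lambda>_. Z) B" if "B \<in> S_axioms" for B
    by (rule sat) (use that V in auto)
  have zero: "\<forall>z\<in>V. \<not> E z Z"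
    using ax[of "ax_zero 0"] by (simp add: S_axioms_def ax_zero_def)
  have adj: "E z (J x y) \<longleftrightarrow> E z x \<or> z = y" if "x \<in> V" "y \<in> V" "z \<in> V" for x y z
    using ax[of "ax_adj 0"] that by (simp add: S_axioms_def ax_adj_def)
  show ?thesis
    by (rule infinite_carrier[where P = "\<lambda>_. True"]) (use V zero adj in auto)
qed

lemma zf_interp_model:
  assumes sat: "\<And>B e. B \<in> S_axioms \<Longrightarrow> interp.sat E Z J UNIV e B"
  shows "zf_interp E Z J"
proof -
  interpret interp E Z J UNIV .
  have ext: "x = y" if "\<And>z. E z x \<longleftrightarrow> E z y" for x y
    using sat[of "ax_ext 0"] that by (simp add: S_axioms_def ax_ext_def)
  have zero: "\<not> E z Z" for z
    using sat[of "ax_zero 0"] by (simp add: S_axioms_def ax_zero_def)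
  have adj: "E z (J x y) \<longleftrightarrow> E z x \<or> z = y" for x y z
    using sat[of "ax_adj 0"] by (simp add: S_axioms_def ax_adj_def)
  have union: "\<exists>y. \<forall>z. E z y \<longleftrightarrow> (\<exists>w. E z w \<and> E w x)" for x
    using sat[of "ax_union 0"] by (simp add: S_axioms_def ax_union_def)
  have power: "\<exists>y. \<forall>z. E z y \<longleftrightarrow> subset_of' z x" for x
    using sat[of "ax_power 0"] by (simp add: S_axioms_def ax_power_def)
  have foundation: "\<exists>y. E y x \<and> \<not> (\<exists>z. E z x \<and> E z y)" if "E y x" for x y
    using sat[of "ax_foundation 0"] that by (simp add: S_axioms_def ax_foundation_def) blast
  interpret set_interp E Z J UNIV
    by unfold_locales (use ext zero adj foundation in auto)
  show ?thesis
  proof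
    show "\<exists>b. \<forall>y. E y b \<longleftrightarrow> (\<exists>x. E x a \<and> Q x y)"
      if Q: "Df (\<lambda>e. Q (e 0) (e (Suc 0)))" and func: "\<And>x y z. E x a \<Longrightarrow> Q x y \<Longrightarrow> Q x z \<Longrightarrow> y = z" for Q a
    proof -
      \<comment> \<open>The arguments of \<open>Q\<close> go to the even names 0 and 2, and the set
        \<open>a\<close> will go to 4, because the odd names hold parameters.\<close>
      have "\<exists>A. \<forall>e. good e \<longrightarrow> sat e A = Q (e 0) (e 2)"
        using Q[unfolded Df_def, THEN conjunct2, THEN spec, of "\<lambda>i. Var (2 * i)"] by simp
      then obtain A where A: "\<And>e. good e \<Longrightarrow> sat e A \<longleftrightarrow> Q (e 0) (e 2)" by auto
      obtain N where N: "\<forall>v\<in>fv A. v < N" using finite_fv finite_nat_set_iff_bounded by blast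
      \<comment> \<open>The auxiliary variables of the scheme must avoid \<open>A\<close> and 0, 2,
        4, and must be even for the same reason.\<close>
      define z b where "z = 2 * (N + 3)" and "b = 2 * (N + 4)"
      have "v \<in> fv A \<Longrightarrow> v < N" for v using N by blast
      from this[of z] this[of b] have fresh: "z \<notin> fv A" "b \<notin> fv A" by (auto simp: z_def b_def)
      have zb: "z \<noteq> 0" "z \<noteq> 2" "z \<noteq> 4" "b \<noteq> 0" "b \<noteq> 2" "b \<noteq> 4" "z \<noteq> b" "even z" "even b"
        by (simp_all add: z_def b_def)
      have "distinct [0, 2, z, 4, b] \<and> z \<notin> fv A \<and> b \<notin> fv A" using zb fresh by auto
      then have inst: "replacement 0 2 z 4 b A \<in> S_axioms" unfolding S_axioms_def by blast
      obtain e where e: "good e" using ex_good by blast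
      let ?e = "e(4 := a)"
      have "sat ?e (replacement 0 2 z 4 b A)" by (rule sat[OF inst])
      then have "(\<forall>x. E x a \<longrightarrow> (\<exists>u. \<forall>y. sat (?e(0 := x, z := u, 2 := y)) A \<longrightarrow> y = u)) \<longrightarrow>
          (\<exists>c. \<forall>y. E y c \<longleftrightarrow> (\<exists>x. E x a \<and> sat (?e(b := c, 2 := y, 0 := x)) A))"
        using zb by (simp add: replacement_def fun_upd_same fun_upd_other del: fun_upd_apply) blast
      moreover have "good (?e(0 := x, z := u, 2 := y))" "good (?e(b := u, 2 := y, 0 := x))" for x y u
        using e zb by (intro good_upd; simp)+
      then have "sat (?e(0 := x, z := u, 2 := y)) A \<longleftrightarrow> Q x y" "sat (?e(b := u, 2 := y, 0 := x)) A \<longleftrightarrow> Q x y" for x y u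
        using A zb by simp_all
      ultimately have "(\<forall>x. E x a \<longrightarrow> (\<exists>u. \<forall>y. Q x y \<longrightarrow> y = u)) \<longrightarrow> (\<exists>c. \<forall>y. E y c \<longleftrightarrow> (\<exists>x. E x a \<and> Q x y))"
        by simp
      moreover have "\<exists>u. \<forall>y. Q x y \<longrightarrow> y = u" if "E x a" for x using func[OF that] by blast
      ultimately show ?thesis by blast
    qed
  qed (use union power in auto)
qed

theorem theorem2p7:
  shows "S_axioms \<turnstile> C_proves_satisfaction_exists 0"
proof (rule completeness)
  show "infinite V" if "Z \<in> V" "\<And>x y. x \<in> V \<Longrightarrow> y \<in> V \<Longrightarrow> J x y \<in> V"
    "\<And>B e. B \<in> S_axioms \<Longrightarrow> range e \<subseteq> V \<Longrightarrow> interp.sat E Z J V e B"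
    for E :: "nat \<Rightarrow> nat \<Rightarrow> bool" and Z J V
    by (rule S_axioms_infinite[OF that])
  fix E :: "nat \<Rightarrow> nat \<Rightarrow> bool" and Z J e
  assume "\<And>B e. B \<in> S_axioms \<Longrightarrow> interp.sat E Z J UNIV e B"
  then interpret zf_interp E Z J by (rule zf_interp_model)
  show "sat e (C_proves_satisfaction_exists 0)"
    using C_proves_instances
    by (simp add: C_proves_satisfaction_exists_def is_Theta_instance_def sat_C_proves
        del: num.simps num'.simps One_nat_def)
qed

end
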